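(* Let $G=(V,E)$ be an undirected graph with $n$ vertices and let $f\ge1$ be an integer. There is a randomized labeling function $L_V:V\to\{0,1\}^{O(f^2\log^6 n)}$ such that, for any query $\langle s,t,F\rangle$ with $s,t\in V$, $F\subset V$, $|F|\le f$, with high probability (probability $1-1/\mathrm{poly}(n)$ over the randomness of the labeling) one can determine whether $s$ and $t$ are connected in $G-F$ by inspecting only $L_V(s)$, $L_V(t)$ and $\{L_V(v)\mid v\in F\}$.
   Context: $G-F$ is the graph obtained from $G$ by deleting the vertices of $F$ and their incident edges. Labels are assigned in preprocessing (knowing $G$ and $f$, using random bits); queries are answered by a fixed decoding procedure with access only to the stated labels. *)

theory Defs
  imports "HOL-Probability.Probability" "Graph_Theory.Digraph_Component"
begin

text \<open>
  An undirected graph is a finite symmetric digraph without loops and parallel arcs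
  (\<^locale>\<open>graph\<close>). \<^const>\<open>reachable\<close> requires both endpoints to be vertices of the graph, so
  the predicate below is false whenever \<open>s\<close> or \<open>t\<close> lies in \<open>F\<close>.
\<close>

definition connected_avoiding :: "('a, 'b) pre_digraph \<Rightarrow> 'a set \<Rightarrow> 'a \<Rightarrow> 'a \<Rightarrow> bool" where
  "connected_avoiding G F s t \<longleftrightarrow> reachable (induce_subgraph G (verts G - F)) s t"

text \<open>
  A randomized labeling function is a probability distribution over functions from vertices to
  bit strings. The decoder \<open>D\<close> sees the label of \<open>s\<close>, the label of \<open>t\<close> and the set of labels of
  the deleted vertices, and nothing else.
\<close>

definition answers_correctly ::
  "(bool list \<Rightarrow> bool list \<Rightarrow> bool list set \<Rightarrow> bool) \<Rightarrow> ('a, 'b) pre_digraph \<Rightarrow> ('a \<Rightarrow> bool list)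
    \<Rightarrow> 'a \<Rightarrow> 'a \<Rightarrow> 'a set \<Rightarrow> bool" where
  "answers_correctly D G L s t F \<longleftrightarrow>
     (D (L s) (L t) (L ` F) \<longleftrightarrow> connected_avoiding G F s t)"

end

theory Submission imports Defs "HOL-Library.Z2" begin

text \<open>Cut the graph recursively by paths. A connected vertex set contains, from any start
  vertex, a path whose removal leaves components of at most half the size
  (\<open>path_separator\<close>). Calling the component from which a path is removed its cluster,
  every vertex lies in at most L = O(log n) clusters, the clusters are laminar, and adjacent
  vertices have nested clusters (\<open>path_decomposition_exists\<close>). For a query let T
  consist of F, s and t. Only the paths whose clusters meet T are touched; there are at most (f+2)L
  of them, and F cuts them into O(f log n) pieces. An untouched cluster stays connected and intact,
  so it matters only through its outside neighbours, which lie on ancestor paths.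

  Connectivity of the pieces in G - F becomes linear algebra over the two-element field. A vector in
  \<open>pieces\<close> gives one bit to every piece; the \<open>consistent\<close> vectors are
  constant on components of G - F, and s and t are connected iff all consistent vectors agree on s
  and t. The decoder cuts out the consistent vectors by random linear checks. A check adds up the
  differences of the values at a and b over a random set Z of pairs (a,b) with both ends in a random
  vertex set R. A vertex on an untouched path inherits its value from a representative neighbour of
  its cluster, repeatedly, until a touched path is reached. Instead of pulling values down, one can
  push the weights of the pairs up to the representatives (\<open>flow_identity\<close>,
  \<open>functional_eq\<close>); the check then becomes an inner product with a mass on the touched
  paths plus terms that the labels reveal. As the vector is constant on pieces, path totals and
  prefix sums of the mass at failed vertices determine this inner product
  (\<open>sum_matching_mass\<close>).

  Representatives must survive F and must not depend on R. The vertices are coloured with 2f colours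
  so that every cluster with many neighbours sees every colour (\<open>hitting_colouring\<close>),
  and one colour class S supplies the representatives; at least half of the classes avoid F. A
  cluster without neighbours in S has few neighbours; it is bypassed by shortcut pairs between them,
  and its neighbour list is stored. Graph edges and shortcuts together still determine the
  consistent vectors (\<open>consistent_if_tests\<close>).

  A vertex enters R with probability 1/(f+1), so R misses F with probability at least 1/3. If the
  space of surviving vectors is 2^q times too large, there are q independent tests it violates
  (\<open>independent_tests\<close>). By the second moment method
  (\<open>pair_hit_colourings\<close>) R contains both ends of one of them with probability of order
  1/(f^2 (1/q + 1/f)), and a random Z then halves the space with probability at least 1/2. A drift
  argument (\<open>elimination_count\<close>) shows that O(f^2 log n) checks succeed with
  probability 1/2. The error is one-sided (\<open>decode_correct\<close>), and O(log n) independent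
  copies make it polynomially small.

  The random choices are too long to be stored. By an averaging argument
  (\<open>few_seeds_bound\<close>) polynomially many seeds, fixed for all graphs with n vertices at
  once, are enough; the decoder knows the table of seeds and a label carries only an index. Counting
  the possible labels gives O(f^2 log^4 n) bits, within the required bound.\<close>

section \<open>Connectivity inside a vertex set\<close>

definition conn :: "('v \<times> 'v) set \<Rightarrow> 'v set \<Rightarrow> 'v \<Rightarrow> 'v \<Rightarrow> bool" where
  "conn E C u v \<longleftrightarrow> (u, v) \<in> (Restr E C)\<^sup>*"

definition conn_set :: "('v \<times> 'v) set \<Rightarrow> 'v set \<Rightarrow> bool" where
  "conn_set E C \<longleftrightarrow> (\<forall>u\<in>C. \<forall>v\<in>C. conn E C u v)"

definition component :: "('v \<times> 'v) set \<Rightarrow> 'v set \<Rightarrow> 'v \<Rightarrow> 'v set" where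
  "component E C u = {v\<in>C. conn E C u v}"

lemma conn_refl [simp]: "conn E C u u"
  by (simp add: conn_def)

lemma conn_trans: "conn E C u v \<Longrightarrow> conn E C v w \<Longrightarrow> conn E C u w"
  unfolding conn_def by (rule rtrancl_trans)

lemma conn_edge: "(u, v) \<in> E \<Longrightarrow> u \<in> C \<Longrightarrow> v \<in> C \<Longrightarrow> conn E C u v"
  unfolding conn_def by auto

lemma conn_sym: "sym E \<Longrightarrow> conn E C u v \<Longrightarrow> conn E C v u"
  unfolding conn_def by (rule symD[OF sym_rtrancl]) (auto simp: sym_def)

lemma conn_mono: "conn E C u v \<Longrightarrow> C \<subseteq> D \<Longrightarrow> conn E D u v"
  unfolding conn_def by (erule rtrancl_mono[THEN subsetD, rotated]) auto

lemma conn_in: "conn E C u v \<Longrightarrow> u \<in> C \<Longrightarrow> v \<in> C"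
  unfolding conn_def by (induction rule: rtrancl_induct) auto

text \<open>A set that the walk cannot leave confines the whole walk, not only its endpoint. This is
  how components with respect to different ambient sets are compared below.\<close>

lemma conn_invariant:
  assumes "conn E C u v" "u \<in> D" "\<And>x y. x \<in> D \<Longrightarrow> (x, y) \<in> E \<Longrightarrow> x \<in> C \<Longrightarrow> y \<in> C \<Longrightarrow> y \<in> D"
  shows "v \<in> D \<and> conn E (C \<inter> D) u v"
  using assms(1) unfolding conn_def
proof (induction rule: rtrancl_induct)
  case base then show ?case using assms(2) by simp
next
  case (step y z)
  then have "z \<in> D" using assms(3) by auto
  with step have "(y, z) \<in> Restr E (C \<inter> D)" by auto
  with step \<open>z \<in> D\<close> show ?case by (meson rtrancl.rtrancl_into_rtrancl)
qed

lemma component_subset: "component E C u \<subseteq> C"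
  by (auto simp: component_def)

lemma component_self: "u \<in> C \<Longrightarrow> u \<in> component E C u"
  by (simp add: component_def)

lemma component_closed: "x \<in> component E C u \<Longrightarrow> (x, y) \<in> E \<Longrightarrow> y \<in> C \<Longrightarrow> y \<in> component E C u"
  by (auto simp: component_def intro: conn_trans conn_edge)

lemma component_mono: "C \<subseteq> D \<Longrightarrow> component E C u \<subseteq> component E D u"
  by (auto simp: component_def intro: conn_mono)

lemma conn_set_component:
  assumes "sym E" "u \<in> C" shows "conn_set E (component E C u)"
proof -
  have *: "conn E (component E C u) u v" if "v \<in> component E C u" for v
  proof -
    have "conn E C u v" using that by (simp add: component_def)
    then have "conn E (C \<inter> component E C u) u v"
      by (rule conn_invariant[THEN conjunct2]) (auto intro: component_closed component_self assms)
    then show ?thesis by (rule conn_mono) auto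
  qed
  show ?thesis unfolding conn_set_def
    using * conn_sym[OF assms(1)] conn_trans by metis
qed

section \<open>Path separators and the recursive path decomposition\<close>

text \<open>Walk greedily: while some remaining component has more than h vertices, step into it.
  Fewer than h vertices are left behind outside it besides the path, so all components left behind
  are small already, and the walk stops when no large component is left.\<close>

lemma path_separator:
  assumes "finite D" "sym E" "conn_set E D" "u \<in> D" "card D \<le> 2 * h + 1"
  shows "\<exists>P. P \<noteq> [] \<and> hd P = u \<and> distinct P \<and> set P \<subseteq> D \<and>
     (\<forall>i. Suc i < length P \<longrightarrow> (P ! i, P ! Suc i) \<in> E) \<and>
     (\<forall>v\<in>D - set P. card (component E (D - set P) v) \<le> h)"
  using assms(1,3-5)
proof (induction "card D" arbitrary: D u rule: less_induct)
  case less
  show ?case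
  proof (cases "\<forall>v\<in>D - {u}. card (component E (D - {u}) v) \<le> h")
    case True
    then show ?thesis using less.prems by (intro exI[of _ "[u]"]) auto
  next
    case False
    then obtain v where v: "v \<in> D - {u}" and big: "card (component E (D - {u}) v) > h"
      by (auto simp: not_le)
    define D' where "D' = component E (D - {u}) v"
    have sub: "D' \<subseteq> D - {u}" by (simp add: D'_def component_subset)
    \<comment> \<open>A walk in D can leave the component D' only by an edge into u. Applied to a
      walk from v to u this yields the neighbour of u at which the path continues.\<close>
    have "x \<in> D' \<or> (\<exists>u'\<in>D'. (u', u) \<in> E)" if "(v, x) \<in> (Restr E D)\<^sup>*" for x
      using that
    proof (induction rule: rtrancl_induct)
      case base then show ?case using v by (simp add: D'_def component_self)
    next
      case (step y z)
      then show ?case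
        by (cases "z = u") (auto simp: D'_def intro: component_closed)
    qed
    moreover have "(v, u) \<in> (Restr E D)\<^sup>*" "u \<notin> D'"
      using less.prems v sub by (auto simp: conn_set_def conn_def)
    ultimately have "\<exists>u'\<in>D'. (u', u) \<in> E" by blast
    then obtain u' where u': "u' \<in> D'" "(u, u') \<in> E" using assms(2) by (auto dest: symD)
    have "card D' < card D" using sub less.prems by (intro psubset_card_mono) auto
    moreover have "finite D'" using sub less.prems finite_subset by blast
    moreover have "conn_set E D'" using conn_set_component[OF assms(2) v] by (simp add: D'_def)
    moreover have "card D' \<le> 2 * h + 1" using calculation(1) less.prems by simp
    ultimately obtain P where P: "P \<noteq> []" "hd P = u'" "distinct P" "set P \<subseteq> D'"
      "\<forall>i. Suc i < length P \<longrightarrow> (P ! i, P ! Suc i) \<in> E"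
      "\<forall>v\<in>D' - set P. card (component E (D' - set P) v) \<le> h"
      using less.hyps u'(1) by blast
    let ?P = "u # P"
    have "card (component E (D - set ?P) w) \<le> h" if w: "w \<in> D - set ?P" for w
    proof (cases "w \<in> D'")
      case True
      have "component E (D - set ?P) w \<subseteq> component E (D' - set P) w"
      proof
        fix x assume "x \<in> component E (D - set ?P) w"
        then have "conn E (D - set ?P) w x" by (simp add: component_def)
        then have "x \<in> D' \<and> conn E ((D - set ?P) \<inter> D') w x"
          by (rule conn_invariant) (use True in \<open>auto simp: D'_def intro: component_closed\<close>)
        moreover have "x \<in> D - set ?P" using \<open>x \<in> component E (D - set ?P) w\<close> by (simp add: component_def)
        ultimately show "x \<in> component E (D' - set P) w"
          by (auto simp: component_def elim: conn_mono)
      qed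
      then have "card (component E (D - set ?P) w) \<le> card (component E (D' - set P) w)"
        by (intro card_mono) (use \<open>finite D'\<close> component_subset finite_subset in \<open>auto simp: component_def\<close>)
      also have "\<dots> \<le> h" using P(6) True w by auto
      finally show ?thesis .
    next
      case False
      \<comment> \<open>A component that avoids D' fits into at most (2h+1) - 1 - (h+1)
        vertices.\<close>
      have "component E (D - set ?P) w \<subseteq> D - {u} - D'"
      proof
        fix x assume "x \<in> component E (D - set ?P) w"
        then have "conn E (D - set ?P) w x" by (simp add: component_def)
        then have "x \<in> - D' \<and> conn E ((D - set ?P) \<inter> - D') w x"
        proof (rule conn_invariant)
          fix x y assume "x \<in> - D'" "(x, y) \<in> E" "x \<in> D - set ?P" "y \<in> D - set ?P"
          then show "y \<in> - D'" using symD[OF assms(2)] component_closed[of y E "D - {u}" v x]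
            by (auto simp: D'_def)
        qed (use False in auto)
        then show "x \<in> D - {u} - D'" using \<open>x \<in> component E (D - set ?P) w\<close> by (auto simp: component_def)
      qed
      then have "card (component E (D - set ?P) w) \<le> card (D - {u} - D')"
        by (intro card_mono) (use less.prems in auto)
      also have "\<dots> = card (D - {u}) - card D'"
        using sub less.prems by (intro card_Diff_subset) (auto intro: finite_subset)
      also have "\<dots> \<le> h" using big less.prems by (simp add: D'_def)
      finally show ?thesis .
    qed
    moreover have "(?P ! i, ?P ! Suc i) \<in> E" if "Suc i < length ?P" for i
      using that P(1,2,5) u'(2) by (cases i) (auto simp: hd_conv_nth)
    ultimately show ?thesis
      using P sub u' less.prems by (intro exI[of _ ?P]) auto
  qed
qed

text \<open>\<open>K v\<close> is the component from which the path through v was removed. A path is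
  named by its first vertex, \<open>apex v\<close>, and \<open>pos v\<close> is the position of v on
  it. The depth condition counts paths, not vertices: all vertices of a path share one
  cluster.\<close>

locale path_decomposition =
  fixes E :: "('v \<times> 'v) set" and C :: "'v set" and h :: nat
    and apex :: "'v \<Rightarrow> 'v" and pos :: "'v \<Rightarrow> nat" and K :: "'v \<Rightarrow> 'v set"
  assumes mem_K: "\<And>v. v \<in> C \<Longrightarrow> v \<in> K v"
    and K_subset: "\<And>v. v \<in> C \<Longrightarrow> K v \<subseteq> C"
    and conn_K: "\<And>v. v \<in> C \<Longrightarrow> conn_set E (K v)"
    and apex_in: "\<And>v. v \<in> C \<Longrightarrow> apex v \<in> C"
    and apex_apex: "\<And>v. v \<in> C \<Longrightarrow> apex (apex v) = apex v"
    and pos_less: "\<And>v. v \<in> C \<Longrightarrow> pos v < card C"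
    and path_step: "\<And>v i. v \<in> C \<Longrightarrow> pos v = Suc i \<Longrightarrow> \<exists>u\<in>C. apex u = apex v \<and> pos u = i \<and> (u, v) \<in> E"
    and depth: "\<And>v. v \<in> C \<Longrightarrow> card (apex ` {u\<in>C. v \<in> K u}) \<le> h"
    and K_eq_iff: "\<And>u v. u \<in> C \<Longrightarrow> v \<in> C \<Longrightarrow> K u = K v \<longleftrightarrow> apex u = apex v"
    and pos_inj: "\<And>u v. u \<in> C \<Longrightarrow> v \<in> C \<Longrightarrow> apex u = apex v \<Longrightarrow> pos u = pos v \<Longrightarrow> u = v"
    and K_mono: "\<And>u v. u \<in> C \<Longrightarrow> v \<in> C \<Longrightarrow> u \<in> K v \<Longrightarrow> K u \<subseteq> K v"
    and laminar: "\<And>u v. u \<in> C \<Longrightarrow> v \<in> C \<Longrightarrow> K u \<inter> K v = {} \<or> K u \<subseteq> K v \<or> K v \<subseteq> K u"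
    and edge_nested: "\<And>u v. u \<in> C \<Longrightarrow> v \<in> C \<Longrightarrow> (u, v) \<in> E \<Longrightarrow> u \<in> K v \<or> v \<in> K u"

text \<open>Pick one component D, remove a separating path P, and recurse on D - P with h reduced by
  one and on C - D with the same h. The new cluster D is added only above the vertices of D, which
  pays for the lost unit of h.\<close>

lemma path_decomposition_exists:
  assumes "finite C" "sym E" "\<forall>v\<in>C. card (component E C v) < 2 ^ h"
  shows "\<exists>apex pos K. path_decomposition E C h apex pos K"
  using assms(1,3)
proof (induction "card C" arbitrary: C h rule: less_induct)
  case less
  show ?case
  proof (cases "C = {}")
    case True
    then have "path_decomposition E C h id (\<lambda>_. 0) (\<lambda>_. {})" by unfold_locales auto
    then show ?thesis by blast
  next
    case False
    then obtain u0 where u0: "u0 \<in> C" by auto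
    define D where "D = component E C u0"
    have D: "D \<subseteq> C" "finite D" "u0 \<in> D" "conn_set E D"
      using less.prems u0 conn_set_component[OF assms(2) u0] finite_subset[OF component_subset]
      by (auto simp: D_def component_subset component_self intro: component_subset[THEN subsetD])
    have cD: "card D < 2 ^ h" "card D \<ge> 1"
      using less.prems(2) u0 D card_0_eq[of D] by (auto simp: D_def Suc_le_eq card_gt_0_iff)
    then obtain h' where h: "h = Suc h'" by (cases h) auto
    \<comment> \<open>Using the separator with bound 2^h' - 1 keeps the remaining components
      strictly below a power of two.\<close>
    have "card D \<le> 2 * (2 ^ h' - 1) + 1" using cD h by simp
    from path_separator[OF D(2) assms(2) D(4,3) this]
    obtain P where P: "P \<noteq> []" "hd P = u0" "distinct P" "set P \<subseteq> D"
      "\<And>i. Suc i < length P \<Longrightarrow> (P ! i, P ! Suc i) \<in> E"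
      "\<And>v. v \<in> D - set P \<Longrightarrow> card (component E (D - set P) v) \<le> 2 ^ h' - 1"
      by blast
    have noE: "(x, y) \<notin> E" "(y, x) \<notin> E" if "x \<in> D" "y \<in> C - D" for x y
      using that component_closed[of x E C u0 y] symD[OF assms(2)] by (auto simp: D_def)
    have uP: "u0 \<in> set P" using P by (metis hd_in_set)
    have "card (D - set P) < card C" "card (C - D) < card C"
      using D uP u0 less.prems(1) by (auto intro!: psubset_card_mono)
    moreover have "\<forall>v\<in>D - set P. card (component E (D - set P) v) < 2 ^ h'"
    proof
      fix v assume "v \<in> D - set P"
      from P(6)[OF this] show "card (component E (D - set P) v) < 2 ^ h'"
        by (metis One_nat_def Suc_pred less_Suc_eq_le pos2 zero_less_power)
    qed
    moreover have "\<forall>v\<in>C - D. card (component E (C - D) v) < 2 ^ h"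
    proof
      fix v assume v: "v \<in> C - D"
      have "card (component E (C - D) v) \<le> card (component E C v)"
        by (intro card_mono component_mono) (auto intro: finite_subset[OF component_subset] less.prems)
      then show "card (component E (C - D) v) < 2 ^ h" using less.prems(2) v by force
    qed
    ultimately obtain t1 p1 K1 t2 p2 K2 where
      I1: "path_decomposition E (D - set P) h' t1 p1 K1" and
      I2: "path_decomposition E (C - D) h t2 p2 K2"
      using less.hyps[of "D - set P" h'] less.hyps[of "C - D" h] less.prems D by (metis finite_Diff)
    interpret A: path_decomposition E "D - set P" h' t1 p1 K1 by (rule I1)
    interpret B: path_decomposition E "C - D" h t2 p2 K2 by (rule I2)
    note d1 = A.mem_K A.K_subset A.conn_K A.apex_in A.apex_apex A.pos_less A.path_step A.depth
      A.K_eq_iff A.pos_inj A.K_mono A.laminar A.edge_nested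
    note d2 = B.mem_K B.K_subset B.conn_K B.apex_in B.apex_apex B.pos_less B.path_step B.depth
      B.K_eq_iff B.pos_inj B.K_mono B.laminar B.edge_nested
    define idx where "idx v = (THE i. i < length P \<and> P ! i = v)" for v
    have idx: "idx (P ! i) = i" if "i < length P" for i
      unfolding idx_def using that P(3) by (intro the_equality) (auto simp: nth_eq_iff_index_eq)
    have idx': "idx v < length P" "P ! idx v = v" if "v \<in> set P" for v
      using that idx by (auto simp: in_set_conv_nth)
    have lenP: "length P \<le> card C"
      using P(3,4) D(1) less.prems(1) by (metis card_mono distinct_card dual_order.trans)
    define apex where "apex v = (if v \<in> set P then u0 else if v \<in> D then t1 v else t2 v)" for v
    define pos where "pos v = (if v \<in> set P then idx v else if v \<in> D then p1 v else p2 v)" for v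
    define K where "K v = (if v \<in> set P then D else if v \<in> D then K1 v else K2 v)" for v
    have cases3: "(v \<in> set P \<and> v \<in> D) \<or> (v \<in> D - set P \<and> v \<notin> set P \<and> v \<in> D) \<or> (v \<in> C - D \<and> v \<notin> set P \<and> v \<notin> D)" if "v \<in> C" for v
      using that P(4) by auto
    have P': "apex v = u0" "pos v = idx v" "K v = D" if "v \<in> set P" for v
      using that by (auto simp: apex_def pos_def K_def)
    have Q1: "apex v = t1 v" "pos v = p1 v" "K v = K1 v" if "v \<in> D - set P" for v
      using that by (auto simp: apex_def pos_def K_def)
    have Q2: "apex v = t2 v" "pos v = p2 v" "K v = K2 v" if "v \<in> C - D" for v
      using that P(4) by (auto simp: apex_def pos_def K_def)
    have s1: "K1 v \<subseteq> D - set P" "t1 v \<in> D - set P" "v \<in> K1 v" if "v \<in> D - set P" for v by (rule d1(2)[OF that] d1(4)[OF that] d1(1)[OF that])+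
    have s2: "K2 v \<subseteq> C - D" "t2 v \<in> C - D" "v \<in> K2 v" if "v \<in> C - D" for v by (rule d2(2)[OF that] d2(4)[OF that] d2(1)[OF that])+
    have c1: "card (D - set P) \<le> card C" "card (C - D) \<le> card C"
      using D less.prems by (auto intro!: card_mono)
    have "path_decomposition E C h apex pos K"
    proof
      fix v assume v: "v \<in> C"
      have "v \<in> K v \<and> K v \<subseteq> C \<and> conn_set E (K v) \<and> apex v \<in> C \<and> apex (apex v) = apex v \<and> pos v < card C"
        using cases3[OF v]
      proof (elim disjE conjE)
        assume v: "v \<in> set P"
        then have "v \<in> D" using P(4) by auto
        then show ?thesis
          using P'[OF v] P'[OF uP] D idx'(1)[OF v] lenP u0 by auto
      next
        assume v: "v \<in> D - set P"
        show ?thesis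
          using Q1[OF v] Q1(1)[OF s1(2)[OF v]] s1[OF v] d1(3,5,6)[OF v] c1 D(1) by auto
      next
        assume v: "v \<in> C - D"
        show ?thesis
          using Q2[OF v] Q2(1)[OF s2(2)[OF v]] s2[OF v] d2(3,5,6)[OF v] c1 by auto
      qed
      then show "v \<in> K v" "K v \<subseteq> C" "conn_set E (K v)" "apex v \<in> C" "apex (apex v) = apex v" "pos v < card C"
        by auto
      show "\<exists>u\<in>C. apex u = apex v \<and> pos u = i \<and> (u, v) \<in> E" if "pos v = Suc i" for i
        using cases3[OF v]
      proof (elim disjE conjE)
        assume "v \<in> set P"
        then have "Suc i < length P" "P ! Suc i = v" using idx'[of v] P'[of v] that by auto
        then show ?thesis using P(5)[of i] P'[of "P ! i"] P'[of v] idx[of i] \<open>v \<in> set P\<close>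
            subsetD[OF D(1) subsetD[OF P(4) nth_mem, of i]]
          by (intro bexI[of _ "P ! i"]) auto
      next
        assume "v \<in> D - set P"
        then show ?thesis using d1(7)[of v i] Q1 that D by force
      next
        assume "v \<in> C - D"
        then show ?thesis using d2(7)[of v i] Q2 that by force
      qed
      \<comment> \<open>The three parts P, D - P and C - D interact in one way only: the cluster D
        of the vertices on P also contains D - P. The depth count in each case rests on
        this.\<close>
      have where_u: "u \<in> set P \<and> apex u = u0 \<and> v \<in> D \<or> u \<in> D - set P \<and> apex u = t1 u \<and> v \<in> K1 u \<and> v \<in> D - set P \<or>
          u \<in> C - D \<and> apex u = t2 u \<and> v \<in> K2 u \<and> v \<in> C - D" if "u \<in> C" "v \<in> K u" for u
        using cases3[OF that(1)]
      proof (elim disjE conjE)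
        assume "u \<in> set P" then show ?thesis using P'[of u] that(2) by simp
      next
        assume "u \<in> D - set P" then show ?thesis using Q1[of u] s1(1)[of u] that(2) by auto
      next
        assume "u \<in> C - D" then show ?thesis using Q2[of u] s2(1)[of u] that(2) by auto
      qed
      show "card (apex ` {u\<in>C. v \<in> K u}) \<le> h"
        using cases3[OF v]
      proof (elim disjE conjE)
        assume v: "v \<in> set P"
        have "apex ` {u\<in>C. v \<in> K u} \<subseteq> {u0}"
        proof (rule subsetI, elim imageE CollectE conjE)
          fix x u assume "x = apex u" "u \<in> C" "v \<in> K u"
          then show "x \<in> {u0}" using where_u[of u] v P(4) by auto
        qed
        then have "card (apex ` {u\<in>C. v \<in> K u}) \<le> card {u0}" by (rule card_mono[rotated]) simp
        then show ?thesis using h by simp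
      next
        assume v: "v \<in> D - set P"
        have "apex ` {u\<in>C. v \<in> K u} \<subseteq> insert u0 (t1 ` {u\<in>D - set P. v \<in> K1 u})"
        proof (rule subsetI, elim imageE CollectE conjE)
          fix x u assume "x = apex u" "u \<in> C" "v \<in> K u"
          then show "x \<in> insert u0 (t1 ` {u\<in>D - set P. v \<in> K1 u})" using where_u[of u] v P(4) by auto
        qed
        then have "card (apex ` {u\<in>C. v \<in> K u}) \<le> card (insert u0 (t1 ` {u\<in>D - set P. v \<in> K1 u}))"
          using D(2) by (intro card_mono) auto
        also have "\<dots> \<le> Suc (card (t1 ` {u\<in>D - set P. v \<in> K1 u}))"
          by (rule card_insert_le_m1) auto
        also have "\<dots> \<le> h" using d1(8)[OF v] h by simp
        finally show ?thesis .
      next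
        assume v: "v \<in> C - D"
        have "apex ` {u\<in>C. v \<in> K u} \<subseteq> t2 ` {u\<in>C - D. v \<in> K2 u}"
        proof (rule subsetI, elim imageE CollectE conjE)
          fix x u assume "x = apex u" "u \<in> C" "v \<in> K u"
          then show "x \<in> t2 ` {u\<in>C - D. v \<in> K2 u}" using where_u[of u] v P(4) by auto
        qed
        then have "card (apex ` {u\<in>C. v \<in> K u}) \<le> card (t2 ` {u\<in>C - D. v \<in> K2 u})"
          using less.prems by (intro card_mono) auto
        also have "\<dots> \<le> h" using d2(8)[OF v] by simp
        finally show ?thesis .
      qed
    next
      fix u v assume uv: "u \<in> C" "v \<in> C"
      have where5: "K x \<subseteq> D \<and> apex x \<in> D \<and> x \<in> K x" if "x \<in> D" for x
      proof (cases "x \<in> set P")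
        case True
        then show ?thesis using P'(1,3)[OF True] that D(3) by simp
      next
        case False
        then have "x \<in> D - set P" using that by simp
        then show ?thesis using Q1(1,3)[of x] s1[of x] by auto
      qed
      note c = cases3[OF uv(1)] cases3[OF uv(2)]
      consider "u \<in> set P" "v \<in> set P" | "u \<in> set P" "v \<in> D - set P" | "u \<in> D - set P" "v \<in> set P"
        | "u \<in> D - set P" "v \<in> D - set P" | "u \<in> D" "v \<in> C - D" | "u \<in> C - D" "v \<in> D"
        | "u \<in> C - D" "v \<in> C - D"
        using c by blast
      then have "(K u = K v \<longleftrightarrow> apex u = apex v) \<and> (apex u = apex v \<and> pos u = pos v \<longrightarrow> u = v) \<and>
        (u \<in> K v \<longrightarrow> K u \<subseteq> K v) \<and> (K u \<inter> K v = {} \<or> K u \<subseteq> K v \<or> K v \<subseteq> K u) \<and>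
        ((u, v) \<in> E \<longrightarrow> u \<in> K v \<or> v \<in> K u)"
      proof cases
        case 1
        have "u \<in> D" "v \<in> D" using 1 P(4) by auto
        moreover have "pos u = pos v \<longrightarrow> u = v"
          using P'(2)[OF 1(1)] P'(2)[OF 1(2)] idx'(2)[OF 1(1)] idx'(2)[OF 1(2)] by metis
        ultimately show ?thesis
          unfolding P'(1,3)[OF 1(1)] P'(1,3)[OF 1(2)] by simp
      next
        case 2
        have "K v \<subset> K u" "apex v \<noteq> apex u" "u \<notin> K v" "v \<in> K u"
          using P'[OF 2(1)] Q1[OF 2(2)] s1[OF 2(2)] uP 2 P(4) by auto
        then show ?thesis by auto
      next
        case 3
        have "K u \<subset> K v" "apex v \<noteq> apex u" "u \<in> K v" "v \<notin> K u"
          using P'[OF 3(2)] Q1[OF 3(1)] s1[OF 3(1)] uP 3 P(4) by auto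
        then show ?thesis by auto
      next
        case 4
        show ?thesis using Q1[OF 4(1)] Q1[OF 4(2)] d1(9-13)[OF 4] by simp
      next
        case 5
        have "K u \<subseteq> D" "apex u \<in> D" "u \<in> K u"
          using where5[OF 5(1)] by auto
        moreover have "K v \<subseteq> C - D" "apex v \<in> C - D" using Q2[OF 5(2)] s2[OF 5(2)] by auto
        ultimately have "K u \<inter> K v = {}" "apex u \<noteq> apex v" "u \<notin> K v" "K u \<noteq> K v" by (blast, metis DiffE, blast, blast)
        then show ?thesis using noE[OF 5] by simp
      next
        case 6
        have "K v \<subseteq> D" "apex v \<in> D" "v \<in> K v"
          using where5[OF 6(2)] by auto
        moreover have "K u \<subseteq> C - D" "apex u \<in> C - D" "u \<in> K u" using Q2[OF 6(1)] s2[OF 6(1)] by auto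
        ultimately have "K u \<inter> K v = {}" "apex u \<noteq> apex v" "u \<notin> K v" "K u \<noteq> K v" by (blast, metis DiffE, blast, blast)
        then show ?thesis using noE[OF 6(2,1)] by simp
      next
        case 7
        show ?thesis using Q2[OF 7(1)] Q2[OF 7(2)] d2(9-13)[OF 7] by simp
      qed
      then show "K u = K v \<longleftrightarrow> apex u = apex v"
        "apex u = apex v \<Longrightarrow> pos u = pos v \<Longrightarrow> u = v" "u \<in> K v \<Longrightarrow> K u \<subseteq> K v"
        "K u \<inter> K v = {} \<or> K u \<subseteq> K v \<or> K v \<subseteq> K u" "(u, v) \<in> E \<Longrightarrow> u \<in> K v \<or> v \<in> K u"
        by (blast, blast, blast, blast, blast)
    qed
    then show ?thesis by blast
  qed
qed

section \<open>Bits as a field, and flow along pointers\<close>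

lemma bit_add_self [simp]: "(x::bit) + x = 0" "x + (x + y) = y"
  by (cases x; cases y; simp)+

declare add_bit_eq_xor [simp del] mult_bit_eq_and [simp del]

lemma bit_add_moveI: "(x::bit) = a + b \<Longrightarrow> x = c \<Longrightarrow> c + a = b"
  by (cases a; cases b) simp_all

lemma bit_neq_iff: "(x::bit) + y = 1 \<longleftrightarrow> x \<noteq> y" "(x::bit) + y = 0 \<longleftrightarrow> x = y"
  by (cases x; cases y; simp)+

text \<open>A fixed number of rounds stands in for well-founded recursion along \<open>nx\<close>.
  Once a bounded rank increases along the pointers, enough rounds reach the fixed point
  (\<open>push_mass_stable\<close>).\<close>

primrec push_mass :: "'v set \<Rightarrow> ('v \<Rightarrow> 'v option) \<Rightarrow> ('v \<Rightarrow> bit) \<Rightarrow> nat \<Rightarrow> 'v \<Rightarrow> bit" where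
  "push_mass V nx w 0 = w"
| "push_mass V nx w (Suc k) = (\<lambda>u. w u + (\<Sum>v | v \<in> V \<and> nx v = Some u. push_mass V nx w k v))"

lemma push_mass_stable:
  assumes "\<And>v u. v \<in> V \<Longrightarrow> nx v = Some u \<Longrightarrow> lev v < (lev u :: nat)"
  shows "lev u < k \<Longrightarrow> push_mass V nx w (Suc k) u = push_mass V nx w k u"
proof (induction k arbitrary: u)
  case (Suc k)
  have "(\<Sum>v | v \<in> V \<and> nx v = Some u. push_mass V nx w (Suc k) v) =
        (\<Sum>v | v \<in> V \<and> nx v = Some u. push_mass V nx w k v)"
    using assms Suc by (intro sum.cong) (auto simp del: push_mass.simps, fastforce)
  then show ?case by simp
qed simp

text \<open>The dual of pushing: follow the pointers to the first vertex satisfying T and read the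
  value there. A chain that ends earlier gives the default 0, which later is the value of dead
  vertices.\<close>

primrec pull_value :: "('v \<Rightarrow> bool) \<Rightarrow> ('v \<Rightarrow> 'v option) \<Rightarrow> ('v \<Rightarrow> bit) \<Rightarrow> nat \<Rightarrow> 'v \<Rightarrow> bit" where
  "pull_value T nx \<alpha> 0 v = (if T v then \<alpha> v else 0)"
| "pull_value T nx \<alpha> (Suc k) v =
     (if T v then \<alpha> v else case nx v of None \<Rightarrow> 0 | Some u \<Rightarrow> pull_value T nx \<alpha> k u)"

lemma pull_value_stable:
  assumes "\<And>v u. v \<in> V \<Longrightarrow> nx v = Some u \<Longrightarrow> u \<in> V \<and> lev v < (lev u :: nat) \<and> lev u \<le> N"
  shows "v \<in> V \<Longrightarrow> N - lev v \<le> k \<Longrightarrow> pull_value T nx \<alpha> (Suc k) v = pull_value T nx \<alpha> k v"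
proof (induction k arbitrary: v)
  case 0
  then show ?case using assms[OF 0(1)] by (fastforce split: option.splits)
next
  case (Suc k)
  show ?case
  proof (cases "nx v")
    case (Some u)
    then have "pull_value T nx \<alpha> (Suc k) u = pull_value T nx \<alpha> k u"
      using assms[OF Suc.prems(1) Some] Suc.prems by (intro Suc.IH) auto
    then show ?thesis using Some by simp
  qed simp
qed

lemma pull_value_add:
  "pull_value T nx (\<lambda>v. \<alpha> v + \<beta> v) k v = pull_value T nx \<alpha> k v + pull_value T nx \<beta> k v"
  by (induction k arbitrary: v) (auto split: option.splits)

text \<open>Summation by parts on the pointer forest. Write the weight as mass minus incoming mass
  and exchange the sums: each vertex contributes its mass times the difference between its own value
  and that of its successor. Outside T these two values coincide, so only vertices in T
  remain.\<close>

lemma flow_identity: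
  fixes w M \<rho> \<alpha> :: "'v \<Rightarrow> 'b :: comm_ring"
  assumes "finite V"
    and nx: "\<And>v u. v \<in> V \<Longrightarrow> nx v = Some u \<Longrightarrow> u \<in> V"
    and M: "\<And>u. u \<in> V \<Longrightarrow> M u = w u + (\<Sum>v | v \<in> V \<and> nx v = Some u. M v)"
    and \<rho>: "\<And>v. v \<in> V \<Longrightarrow> \<rho> v = (if T v then \<alpha> v else case nx v of None \<Rightarrow> 0 | Some u \<Rightarrow> \<rho> u)"
  shows "(\<Sum>v\<in>V. w v * \<rho> v) =
    (\<Sum>v | v \<in> V \<and> T v. M v * \<alpha> v) - (\<Sum>v | v \<in> V \<and> T v. M v * (case nx v of None \<Rightarrow> 0 | Some u \<Rightarrow> \<rho> u))"
proof -
  let ?ext = "\<lambda>v. case nx v of None \<Rightarrow> 0 | Some u \<Rightarrow> \<rho> u"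
  have w: "w u = M u - (\<Sum>v | v \<in> V \<and> nx v = Some u. M v)" if "u \<in> V" for u
    using M[OF that] by simp
  have "(\<Sum>u\<in>V. (\<Sum>v | v \<in> V \<and> nx v = Some u. M v) * \<rho> u) =
        (\<Sum>u\<in>V. \<Sum>v\<in>V. if nx v = Some u then M v * \<rho> u else 0)"
    by (intro sum.cong refl) (subst sum_distrib_right, subst sum.inter_filter[OF assms(1)], rule refl)
  also have "\<dots> = (\<Sum>v\<in>V. \<Sum>u\<in>V. if nx v = Some u then M v * \<rho> u else 0)"
    by (rule sum.swap)
  also have "\<dots> = (\<Sum>v\<in>V. M v * ?ext v)"
  proof (rule sum.cong[OF refl])
    fix v assume v: "v \<in> V"
    show "(\<Sum>u\<in>V. if nx v = Some u then M v * \<rho> u else 0) = M v * ?ext v"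
    proof (cases "nx v")
      case (Some x)
      then have "x \<in> V" using nx v by blast
      then show ?thesis using Some assms(1) by (simp add: sum.delta' cong: if_cong)
    qed simp
  qed
  finally have "(\<Sum>u\<in>V. w u * \<rho> u) = (\<Sum>v\<in>V. M v * \<rho> v - M v * ?ext v)"
    by (simp add: w left_diff_distrib sum_subtractf cong: sum.cong)
  also have "\<dots> = (\<Sum>v\<in>V. if T v then M v * \<alpha> v - M v * ?ext v else 0)"
    by (intro sum.cong) (auto simp: \<rho>)
  also have "\<dots> = (\<Sum>v | v \<in> V \<and> T v. M v * \<alpha> v - M v * ?ext v)"
    using assms(1) by (simp add: sum.inter_filter)
  finally show ?thesis by (simp add: sum_subtractf)
qed

section \<open>Clusters addressed by path and position\<close>

type_synonym addr = "nat \<times> nat"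

text \<open>The path decomposition with every vertex renamed to the pair of its path and its
  position. A label then reveals the path of its vertex, and prefix sums along a path can be written
  down. Clusters are indexed by paths.\<close>

locale cluster_graph =
  fixes n L :: nat and V :: "addr set" and E :: "(addr \<times> addr) set" and Cl :: "nat \<Rightarrow> addr set"
  assumes V_bound: "V \<subseteq> {..<n} \<times> {..<n}"
    and E_V: "E \<subseteq> V \<times> V"
    and sym_E: "sym E"
    and Cl_self: "v \<in> V \<Longrightarrow> v \<in> Cl (fst v)"
    and Cl_sub: "v \<in> V \<Longrightarrow> Cl (fst v) \<subseteq> V"
    and Cl_conn: "v \<in> V \<Longrightarrow> conn_set E (Cl (fst v))"
    and Cl_mono: "u \<in> V \<Longrightarrow> v \<in> V \<Longrightarrow> u \<in> Cl (fst v) \<Longrightarrow> Cl (fst u) \<subseteq> Cl (fst v)"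
    and Cl_laminar: "u \<in> V \<Longrightarrow> v \<in> V \<Longrightarrow> Cl (fst u) \<inter> Cl (fst v) = {} \<or> Cl (fst u) \<subseteq> Cl (fst v) \<or> Cl (fst v) \<subseteq> Cl (fst u)"
    and path_down: "(c, Suc i) \<in> V \<Longrightarrow> (c, i) \<in> V \<and> ((c, i), (c, Suc i)) \<in> E"
    and E_nested: "(u, v) \<in> E \<Longrightarrow> u \<in> Cl (fst v) \<or> v \<in> Cl (fst u)"
    and Cl_depth: "v \<in> V \<Longrightarrow> card {c \<in> fst ` V. v \<in> Cl c} \<le> L"
begin

definition "H = fst ` V"

lemma finite_V [simp]: "finite V"
  using V_bound by (rule finite_subset) auto

lemma finite_H [simp]: "finite H"
  by (simp add: H_def)

lemma H_bound: "H \<subseteq> {..<n}"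
  using V_bound by (auto simp: H_def)

lemma fst_H [simp]: "v \<in> V \<Longrightarrow> fst v \<in> H"
  by (simp add: H_def)

lemma Cl_H: "c \<in> H \<Longrightarrow> Cl c \<subseteq> V" "c \<in> H \<Longrightarrow> conn_set E (Cl c)"
  using Cl_sub Cl_conn by (auto simp: H_def)

lemma Cl_mono': "u \<in> V \<Longrightarrow> c \<in> H \<Longrightarrow> u \<in> Cl c \<Longrightarrow> Cl (fst u) \<subseteq> Cl c"
  using Cl_mono unfolding H_def by fastforce

lemma Cl_laminar': "c \<in> H \<Longrightarrow> d \<in> H \<Longrightarrow> Cl c \<inter> Cl d = {} \<or> Cl c \<subseteq> Cl d \<or> Cl d \<subseteq> Cl c"
  using Cl_laminar unfolding H_def by fastforce

lemma edge_V: "(a, b) \<in> E \<Longrightarrow> a \<in> V \<and> b \<in> V"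
  using E_V by auto

definition nb :: "nat \<Rightarrow> addr set" where
  "nb c = {x \<in> V - Cl c. \<exists>y\<in>Cl c. (x, y) \<in> E}"

lemma nb_V: "x \<in> nb c \<Longrightarrow> x \<in> V"
  by (simp add: nb_def)

lemma finite_nb [simp]: "finite (nb c)"
  by (rule finite_subset[OF _ finite_V]) (auto simp: nb_def)

text \<open>Edges leave a cluster only towards proper ancestors: the inner endpoint has its own
  cluster inside \<open>Cl c\<close>, so nestedness of edges puts it into the cluster of the outer
  endpoint x, and laminarity makes the inclusion strict since x lies outside.\<close>

lemma nb_above:
  assumes "c \<in> H" "x \<in> nb c"
  shows "Cl c \<subset> Cl (fst x)"
proof -
  obtain y where y: "y \<in> Cl c" "(x, y) \<in> E" and x: "x \<in> V" "x \<notin> Cl c"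
    using assms by (auto simp: nb_def)
  have yV: "y \<in> V" using y Cl_H assms by auto
  have "x \<notin> Cl (fst y)" using Cl_mono'[OF yV assms(1) y(1)] x by auto
  then have "y \<in> Cl (fst x)" using E_nested[OF y(2)] by blast
  moreover have "x \<in> Cl (fst x)" by (rule Cl_self) (rule x)
  ultimately show ?thesis using Cl_laminar'[of c "fst x"] assms x y by auto
qed

lemma nb_in_Cl: "c \<in> H \<Longrightarrow> d \<in> H \<Longrightarrow> x \<in> nb d \<Longrightarrow> x \<in> Cl c \<Longrightarrow> Cl d \<subset> Cl c"
  using nb_above[of d x] Cl_mono'[of x c] nb_V[of x d] by blast

lemma nb_extend: "x \<in> nb d \<Longrightarrow> Cl d \<subseteq> Cl c \<Longrightarrow> x \<notin> Cl c \<Longrightarrow> x \<in> nb c"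
  by (auto simp: nb_def)

end

section \<open>Representatives, sampled pairs and pushed mass\<close>

type_synonym name = "addr \<times> addr \<times> nat option"

text \<open>S is the colour class that supplies representatives of adjacent clusters.\<close>

locale scheme = cluster_graph +
  fixes S :: "addr set"
begin

definition small :: "nat \<Rightarrow> bool" where
  "small c \<longleftrightarrow> nb c \<inter> S = {}"

text \<open>S takes precedence over the sample R. A cluster with a neighbour in S therefore has a
  representative that does not change with the sample.\<close>

definition rep :: "addr set \<Rightarrow> nat \<Rightarrow> addr option" where
  "rep R c = (if nb c \<inter> S \<noteq> {} then Some (SOME x. x \<in> nb c \<inter> S)
     else if nb c \<inter> R \<noteq> {} then Some (SOME x. x \<in> nb c \<inter> R) else None)"

lemma rep_SomeD: "rep R c = Some x \<Longrightarrow> x \<in> nb c \<and> x \<in> S \<union> R"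
  using some_in_eq[of "nb c \<inter> S"] some_in_eq[of "nb c \<inter> R"]
  unfolding rep_def by (metis IntD1 IntD2 UnI1 UnI2 option.inject option.distinct(1))

lemma rep_NoneD: "rep R c = None \<Longrightarrow> nb c \<inter> (S \<union> R) = {}"
  by (auto simp: rep_def split: if_splits)

text \<open>The third component records the reason for a pair: a graph edge, or a shortcut across
  the small cluster c. The decoder can thus discard exactly the shortcuts across touched
  clusters.\<close>

definition names :: "addr set \<Rightarrow> name set" where
  "names R = {(a, b, None) |a b. (a, b) \<in> E \<and> a \<in> R \<and> b \<in> R} \<union>
     {(a, b, Some c) |a b c. c \<in> H \<and> small c \<and> a \<in> nb c \<inter> R \<and> b \<in> nb c \<inter> R}"

lemma names_V: "(a, b, \<tau>) \<in> names R \<Longrightarrow> a \<in> V \<and> b \<in> V \<and> a \<in> R \<and> b \<in> R \<and> \<tau> \<in> insert None (Some ` H)"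
  using nb_V edge_V by (auto simp: names_def)

lemma finite_names [simp]: "finite (names R)"
proof (rule finite_subset)
  show "names R \<subseteq> V \<times> V \<times> insert None (Some ` H)" by (auto dest!: names_V)
qed simp

definition weight :: "addr set \<Rightarrow> name set \<Rightarrow> addr \<Rightarrow> bit" where
  "weight R Z v = (\<Sum>e\<in>names R \<inter> Z. (if fst e = v then 1 else 0) + (if fst (snd e) = v then 1 else 0))"

text \<open>Cluster size is the rank: a representative lies on a path with a strictly larger
  cluster, of size at most \<open>card V\<close>, so this many rounds reach the fixed point
  \<open>mass_eq\<close>.\<close>

definition mass :: "addr set \<Rightarrow> name set \<Rightarrow> addr \<Rightarrow> bit" where
  "mass R Z = push_mass V (rep R \<circ> fst) (weight R Z) (Suc (card V))"

definition path_total :: "addr set \<Rightarrow> name set \<Rightarrow> nat \<Rightarrow> bit" where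
  "path_total R Z c = (\<Sum>v | v \<in> V \<and> fst v = c. mass R Z v)"

lemma rep_rank:
  assumes "v \<in> V" "(rep R \<circ> fst) v = Some u"
  shows "u \<in> V \<and> card (Cl (fst v)) < card (Cl (fst u)) \<and> card (Cl (fst u)) \<le> card V"
proof -
  have "u \<in> nb (fst v)" using rep_SomeD assms by auto
  then have u: "u \<in> V" "Cl (fst v) \<subset> Cl (fst u)" using nb_above[of "fst v"] nb_V assms by auto
  moreover have "Cl (fst u) \<subseteq> V" using Cl_sub u by auto
  ultimately show ?thesis by (auto intro!: psubset_card_mono card_mono finite_subset[OF _ finite_V])
qed

lemma mass_eq:
  assumes "u \<in> V"
  shows "mass R Z u = weight R Z u + (\<Sum>v | v \<in> V \<and> (rep R \<circ> fst) v = Some u. mass R Z v)"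
proof -
  have "card (Cl (fst u)) < Suc (card V)"
    using card_mono[OF finite_V Cl_sub[OF assms]] by simp
  then have "mass R Z u = push_mass V (rep R \<circ> fst) (weight R Z) (Suc (Suc (card V))) u"
    unfolding mass_def
    by (rule push_mass_stable[where lev = "\<lambda>v. card (Cl (fst v))", rotated, symmetric])
      (use rep_rank in blast)
  also have "\<dots> = weight R Z u + (\<Sum>v | v \<in> V \<and> (rep R \<circ> fst) v = Some u. mass R Z v)"
    unfolding mass_def by (subst push_mass.simps(2)) simp
  finally show ?thesis .
qed

end

section \<open>The linear functional of a query\<close>

text \<open>T stands for the vertices whose labels are presented, F for the failed ones among them.
  Disjointness of F and S makes the representatives taken from S survive the failures.\<close>

locale query = scheme +
  fixes F T :: "addr set"
  assumes F_T: "F \<subseteq> T" and T_V: "T \<subseteq> V" and F_S: "F \<inter> S = {}"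
begin

definition touched :: "nat \<Rightarrow> bool" where
  "touched c \<longleftrightarrow> Cl c \<inter> T \<noteq> {}"

definition Q :: "addr set" where
  "Q = {v \<in> V - F. touched (fst v)}"

definition touched_name :: "name \<Rightarrow> bool" where
  "touched_name e \<longleftrightarrow> (\<exists>c. snd (snd e) = Some c \<and> touched c)"

lemma touched_self: "v \<in> T \<Longrightarrow> touched (fst v)"
  using Cl_self T_V unfolding touched_def by blast

lemma touched_mono: "touched c \<Longrightarrow> Cl c \<subseteq> Cl d \<Longrightarrow> touched d"
  by (auto simp: touched_def)

lemma untouched_notin_F: "v \<in> V \<Longrightarrow> \<not> touched (fst v) \<Longrightarrow> v \<notin> F"
  using touched_self F_T by blast

lemma finite_Q [simp]: "finite Q"
  by (rule finite_subset[OF _ finite_V]) (auto simp: Q_def)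

text \<open>Extends a vector on the touched paths to all vertices: an untouched path inherits its
  value from the representative of its cluster.\<close>

definition value_at :: "addr set \<Rightarrow> (addr \<Rightarrow> bit) \<Rightarrow> addr \<Rightarrow> bit" where
  "value_at R \<alpha> = pull_value (touched \<circ> fst) (rep R \<circ> fst) \<alpha> (Suc (card V))"

lemma value_at_eq:
  assumes "v \<in> V"
  shows "value_at R \<alpha> v = (if touched (fst v) then \<alpha> v
    else case rep R (fst v) of None \<Rightarrow> 0 | Some u \<Rightarrow> value_at R \<alpha> u)"
proof -
  have "value_at R \<alpha> v = pull_value (touched \<circ> fst) (rep R \<circ> fst) \<alpha> (Suc (Suc (card V))) v"
    unfolding value_at_def
    by (rule pull_value_stable[OF rep_rank, symmetric]) (use assms in auto)
  then show ?thesis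
    unfolding value_at_def by (simp del: pull_value.simps add: pull_value.simps(2)[of _ _ _ "Suc (card V)"])
qed

lemma value_at_add: "value_at R (\<lambda>v. \<alpha> v + \<beta> v) v = value_at R \<alpha> v + value_at R \<beta> v"
  unfolding value_at_def by (rule pull_value_add)

text \<open>Every term is available to the decoder. The second sum takes back the mass that touched
  paths passed on to their representatives, the third removes shortcuts across touched clusters,
  which the failures may have invalidated. Subtraction is addition here.\<close>

definition functional :: "addr set \<Rightarrow> name set \<Rightarrow> (addr \<Rightarrow> bit) \<Rightarrow> bit" where
  "functional R Z \<alpha> = (\<Sum>v\<in>Q. mass R Z v * \<alpha> v) +
     (\<Sum>c | c \<in> H \<and> touched c. path_total R Z c * (case rep R c of None \<Rightarrow> 0 | Some x \<Rightarrow> \<alpha> x)) +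
     (\<Sum>e | e \<in> names R \<inter> Z \<and> touched_name e. \<alpha> (fst e) + \<alpha> (fst (snd e)))"

text \<open>The sum of weight times extended value is computed twice, once pair by pair and once
  with \<open>flow_identity\<close>. What remains shows that the functional adds up the constraints
  "equal values at both ends" over the untouched pairs in Z.\<close>

lemma functional_eq:
  assumes "\<And>v. v \<notin> Q \<Longrightarrow> \<alpha> v = 0"
  shows "functional R Z \<alpha> =
    (\<Sum>e | e \<in> names R \<inter> Z \<and> \<not> touched_name e. value_at R \<alpha> (fst e) + value_at R \<alpha> (fst (snd e)))"
proof -
  let ?\<rho> = "value_at R \<alpha>" and ?M = "mass R Z" and ?N = "names R \<inter> Z"
  let ?ext = "\<lambda>c. case rep R c of None \<Rightarrow> 0 | Some u \<Rightarrow> ?\<rho> u"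
  \<comment> \<open>Neighbours of a touched cluster lie on paths with larger, hence touched,
    clusters; no value is inherited there.\<close>
  have \<rho>_touched: "?\<rho> x = \<alpha> x" if "x \<in> nb c" "c \<in> H" "touched c" for x c
    using that nb_above[of c x] nb_V touched_mono value_at_eq[of x R \<alpha>] by fastforce
  have "(\<Sum>v\<in>V. weight R Z v * ?\<rho> v) =
     (\<Sum>v\<in>V. \<Sum>e\<in>?N. (if fst e = v then ?\<rho> v else 0) + (if fst (snd e) = v then ?\<rho> v else 0))"
    by (auto simp: weight_def sum_distrib_right intro!: sum.cong)
  also have "\<dots> = (\<Sum>e\<in>?N. \<Sum>v\<in>V. (if fst e = v then ?\<rho> v else 0) + (if fst (snd e) = v then ?\<rho> v else 0))"
    by (rule sum.swap)
  also have "\<dots> = (\<Sum>e\<in>?N. ?\<rho> (fst e) + ?\<rho> (fst (snd e)))"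
  proof (rule sum.cong[OF refl])
    fix e assume "e \<in> ?N"
    then have "fst e \<in> V" "fst (snd e) \<in> V" using names_V[of "fst e" "fst (snd e)" "snd (snd e)" R] by auto
    then show "(\<Sum>v\<in>V. (if fst e = v then ?\<rho> v else 0) + (if fst (snd e) = v then ?\<rho> v else 0)) =
      ?\<rho> (fst e) + ?\<rho> (fst (snd e))"
      by (simp add: sum.distrib)
  qed
  also have "\<dots> = (\<Sum>e | e \<in> ?N \<and> touched_name e. ?\<rho> (fst e) + ?\<rho> (fst (snd e))) +
     (\<Sum>e | e \<in> ?N \<and> \<not> touched_name e. ?\<rho> (fst e) + ?\<rho> (fst (snd e)))"
    by (subst sum.union_disjoint[symmetric]) (auto intro!: sum.cong)
  also have "(\<Sum>e | e \<in> ?N \<and> touched_name e. ?\<rho> (fst e) + ?\<rho> (fst (snd e))) =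
     (\<Sum>e | e \<in> ?N \<and> touched_name e. \<alpha> (fst e) + \<alpha> (fst (snd e)))"
    by (intro sum.cong refl) (auto simp: names_def touched_name_def \<rho>_touched)
  finally have 1: "(\<Sum>v\<in>V. weight R Z v * ?\<rho> v) =
     (\<Sum>e | e \<in> ?N \<and> touched_name e. \<alpha> (fst e) + \<alpha> (fst (snd e))) +
     (\<Sum>e | e \<in> ?N \<and> \<not> touched_name e. ?\<rho> (fst e) + ?\<rho> (fst (snd e)))" .
  have "(\<Sum>v\<in>V. weight R Z v * ?\<rho> v) = (\<Sum>v | v \<in> V \<and> touched (fst v). ?M v * \<alpha> v) +
      (\<Sum>v | v \<in> V \<and> touched (fst v). ?M v * ?ext (fst v))"
  proof -
    have "(\<Sum>v\<in>V. weight R Z v * ?\<rho> v) = (\<Sum>v | v \<in> V \<and> (touched \<circ> fst) v. ?M v * \<alpha> v) -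
      (\<Sum>v | v \<in> V \<and> (touched \<circ> fst) v. ?M v * (case (rep R \<circ> fst) v of None \<Rightarrow> 0 | Some u \<Rightarrow> ?\<rho> u))"
    proof (rule flow_identity)
      fix u assume "u \<in> V"
      then show "?M u = weight R Z u + (\<Sum>v | v \<in> V \<and> (rep R \<circ> fst) v = Some u. ?M v)"
        by (rule mass_eq)
      show "?\<rho> u = (if (touched \<circ> fst) u then \<alpha> u else case (rep R \<circ> fst) u of None \<Rightarrow> 0 | Some x \<Rightarrow> ?\<rho> x)"
        using value_at_eq[OF \<open>u \<in> V\<close>] by simp
    qed (rule finite_V, metis rep_rank)
    then show ?thesis by (simp only: o_apply minus_bit_def)
  qed
  also have "(\<Sum>v | v \<in> V \<and> touched (fst v). ?M v * \<alpha> v) = (\<Sum>v\<in>Q. ?M v * \<alpha> v)"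
    by (intro sum.mono_neutral_right) (use assms in \<open>auto simp: Q_def\<close>)
  also have "(\<Sum>v | v \<in> V \<and> touched (fst v). ?M v * ?ext (fst v)) =
      (\<Sum>c | c \<in> H \<and> touched c. \<Sum>v | v \<in> {v. v \<in> V \<and> touched (fst v)} \<and> fst v = c. ?M v * ?ext (fst v))"
    by (subst sum.group) (auto simp: H_def)
  also have "\<dots> = (\<Sum>c | c \<in> H \<and> touched c. path_total R Z c * ?ext c)"
    unfolding path_total_def sum_distrib_right by (intro sum.cong) auto
  also have "\<dots> = (\<Sum>c | c \<in> H \<and> touched c. path_total R Z c * (case rep R c of None \<Rightarrow> 0 | Some x \<Rightarrow> \<alpha> x))"
    by (intro sum.cong refl) (auto simp: \<rho>_touched dest!: rep_SomeD split: option.splits)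
  finally have 2: "(\<Sum>v\<in>V. weight R Z v * ?\<rho> v) = (\<Sum>v\<in>Q. ?M v * \<alpha> v) +
     (\<Sum>c | c \<in> H \<and> touched c. path_total R Z c * (case rep R c of None \<Rightarrow> 0 | Some x \<Rightarrow> \<alpha> x))" .
  show ?thesis
    unfolding functional_def by (rule bit_add_moveI[OF 1 2])
qed

end

section \<open>Consistent vectors and the tests that cut them out\<close>

context query begin

text \<open>Vertices enclosed by an untouched cluster that has no candidate for a representative at
  all. No chain of representatives leads from them to a touched path.\<close>

definition dead :: "addr set \<Rightarrow> addr set" where
  "dead R = {v. \<exists>c\<in>H. v \<in> Cl c \<and> \<not> touched c \<and> nb c \<inter> (S \<union> R) = {}}"

text \<open>Equality is imposed only between consecutive surviving positions, so a failed vertex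
  separates the two sides of its path.\<close>

definition pieces :: "(addr \<Rightarrow> bit) set" where
  "pieces = {\<alpha>. (\<forall>v. v \<notin> Q \<longrightarrow> \<alpha> v = 0) \<and> (\<forall>c i. (c, i) \<in> Q \<and> (c, Suc i) \<in> Q \<longrightarrow> \<alpha> (c, i) = \<alpha> (c, Suc i))}"

definition consistent :: "(addr \<Rightarrow> bit) set" where
  "consistent = {\<alpha> \<in> pieces. \<forall>u\<in>Q. \<forall>v\<in>Q. conn E (V - F) u v \<longrightarrow> \<alpha> u = \<alpha> v}"

lemma consistentD: "\<alpha> \<in> consistent \<Longrightarrow> u \<in> Q \<Longrightarrow> v \<in> Q \<Longrightarrow> conn E (V - F) u v \<Longrightarrow> \<alpha> u = \<alpha> v"
  unfolding consistent_def by blast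

lemma consistentI:
  "\<alpha> \<in> pieces \<Longrightarrow> (\<And>u v. u \<in> Q \<Longrightarrow> v \<in> Q \<Longrightarrow> conn E (V - F) u v \<Longrightarrow> \<alpha> u = \<alpha> v) \<Longrightarrow> \<alpha> \<in> consistent"
  unfolding consistent_def by blast

lemma consistent_pieces: "\<alpha> \<in> consistent \<Longrightarrow> \<alpha> \<in> pieces"
  by (simp add: consistent_def)

lemma touched_iff_mono: "v \<in> V \<Longrightarrow> c \<in> H \<Longrightarrow> v \<in> Cl c \<Longrightarrow> touched (fst v) \<Longrightarrow> touched c"
  using touched_mono Cl_mono' by blast

lemma Cl_untouched: "c \<in> H \<Longrightarrow> \<not> touched c \<Longrightarrow> Cl c \<subseteq> V - F"
  using Cl_H F_T by (auto simp: touched_def)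

lemma Cl_untouched_conn: "c \<in> H \<Longrightarrow> \<not> touched c \<Longrightarrow> x \<in> Cl c \<Longrightarrow> y \<in> Cl c \<Longrightarrow> conn E (V - F) x y"
  using Cl_H(2)[of c] Cl_untouched[of c] conn_mono[of E "Cl c" x y "V - F"] unfolding conn_set_def by simp

lemma nb_conn:
  assumes "c \<in> H" "\<not> touched c" "x \<in> nb c" "x \<notin> F" "y \<in> Cl c"
  shows "conn E (V - F) x y"
proof -
  obtain z where "z \<in> Cl c" "(x, z) \<in> E" using assms(3) by (auto simp: nb_def)
  moreover have "x \<in> V - F" "z \<in> V - F" using assms(3,4) Cl_untouched[OF assms(1,2)] nb_V[of x c] calculation by auto
  ultimately show ?thesis
    using Cl_untouched_conn[OF assms(1,2), of z y] conn_edge[of x z E "V - F"] conn_trans[of E "V - F" x z y] assms(5) by simp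
qed

lemma dead_subset: "dead R \<subseteq> V - F"
  using Cl_untouched by (auto simp: dead_def)

lemma dead_mono: "R \<subseteq> R' \<Longrightarrow> dead R' \<subseteq> dead R"
  unfolding dead_def by blast

lemma dead_down:
  assumes "u \<in> dead R" "v \<in> V" "Cl (fst v) \<subseteq> Cl (fst u)" "u \<in> V"
  shows "v \<in> dead R"
proof -
  obtain c where c: "c \<in> H" "u \<in> Cl c" "\<not> touched c" "nb c \<inter> (S \<union> R) = {}"
    using assms(1) by (auto simp: dead_def)
  then have "v \<in> Cl c" using Cl_mono'[OF assms(4) c(1,2)] assms(2,3) Cl_self by blast
  then show ?thesis unfolding dead_def using c by blast
qed

text \<open>Without a representative the cluster of v itself would witness that v is dead. The
  representative survives because S and R both avoid F, and it is alive because an enclosing dead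
  cluster would contain the smaller cluster of v too.\<close>

lemma rep_alive:
  assumes "v \<in> V - F" "v \<notin> dead R" "\<not> touched (fst v)" "R \<inter> F = {}"
  obtains u where "rep R (fst v) = Some u" "u \<in> V - F" "u \<notin> dead R" "Cl (fst v) \<subset> Cl (fst u)" "u \<in> nb (fst v)"
proof (cases "rep R (fst v)")
  case None
  then have "v \<in> dead R"
    unfolding dead_def using rep_NoneD assms Cl_self fst_H by blast
  then show ?thesis using assms by simp
next
  case (Some u)
  then have u: "u \<in> nb (fst v)" "u \<in> S \<union> R" using rep_SomeD by blast+
  then have "u \<in> V - F" "Cl (fst v) \<subset> Cl (fst u)"
    using nb_V nb_above[OF fst_H] assms F_S by blast+
  moreover have "u \<notin> dead R" using dead_down calculation assms by blast
  ultimately show ?thesis using that Some u by blast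
qed

text \<open>Each step to a representative goes from an intact connected cluster to a surviving
  neighbour, so the chain stays in one component of G - F until it reaches a touched path.\<close>

lemma value_conn:
  assumes "R \<inter> F = {}" "\<alpha> \<in> consistent" "v \<in> V - F" "v \<notin> dead R"
  shows "\<exists>u\<in>Q. conn E (V - F) v u \<and> value_at R \<alpha> v = \<alpha> u"
  using assms(3,4)
proof (induction "card V - card (Cl (fst v))" arbitrary: v rule: less_induct)
  case less
  show ?case
  proof (cases "touched (fst v)")
    case True
    then have "v \<in> Q" "value_at R \<alpha> v = \<alpha> v" using less.prems value_at_eq by (auto simp: Q_def)
    then show ?thesis by (intro bexI[of _ v]) simp_all
  next
    case False
    obtain u where u: "rep R (fst v) = Some u" "u \<in> V - F" "u \<notin> dead R"
      "Cl (fst v) \<subset> Cl (fst u)" "u \<in> nb (fst v)"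
      using rep_alive[OF less.prems False assms(1)] .
    have "card (Cl (fst v)) < card (Cl (fst u))" "card (Cl (fst u)) \<le> card V"
      using rep_rank[of v R u] less.prems u by simp_all
    then have "card V - card (Cl (fst u)) < card V - card (Cl (fst v))" by linarith
    then obtain w where w: "w \<in> Q" "conn E (V - F) u w" "value_at R \<alpha> u = \<alpha> w"
      using less.hyps[OF _ u(2,3)] by blast
    have "conn E (V - F) u v"
      by (rule nb_conn[of "fst v"]) (use less.prems u False Cl_self[of v] in simp_all)
    then have "conn E (V - F) v u" by (rule conn_sym[OF sym_E])
    then have "conn E (V - F) v w" using w(2) by (rule conn_trans)
    moreover have "value_at R \<alpha> v = \<alpha> w" using value_at_eq[of v R \<alpha>] less.prems False u w by simp
    ultimately show ?thesis using w by blast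
  qed
qed

text \<open>The chain cannot leave the enclosing cluster c: a target outside would be a neighbour of
  c in S or R. All paths met inside are untouched, so the chain ends with the default value.\<close>

lemma value_dead:
  assumes "v \<in> dead R"
  shows "value_at R \<alpha> v = 0"
proof -
  obtain c where c: "c \<in> H" "v \<in> Cl c" "\<not> touched c" "nb c \<inter> (S \<union> R) = {}"
    using assms by (auto simp: dead_def)
  have CV: "Cl c \<subseteq> V" using Cl_H c by blast
  show ?thesis
    using c(2)
  proof (induction "card V - card (Cl (fst v))" arbitrary: v rule: less_induct)
    case less
    have v: "v \<in> V" "\<not> touched (fst v)" using less.prems CV touched_iff_mono c by blast+
    show ?case
    proof (cases "rep R (fst v)")
      case None
      then show ?thesis using value_at_eq v by simp
    next
      case (Some u)
      have u: "u \<in> nb (fst v)" "u \<in> S \<union> R" using rep_SomeD[OF Some] by blast+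
      have "Cl (fst v) \<subseteq> Cl c" using Cl_mono' v c less.prems by blast
      then have "u \<in> Cl c" using nb_extend[OF u(1)] u c by blast
      moreover have "card V - card (Cl (fst u)) < card V - card (Cl (fst v))"
        using rep_rank[of v R u] Some v by auto
      ultimately have "value_at R \<alpha> u = 0" using less.hyps[of u] by simp
      then show ?thesis using value_at_eq[OF v(1)] v Some by simp
    qed
  qed
qed

text \<open>Both ends of a pair are sampled, and a dead cluster has no sampled neighbour. Hence no
  pair joins a dead vertex to an alive one, and the default 0 never creates a false
  constraint.\<close>

lemma names_dead:
  assumes "(a, b, \<tau>) \<in> names R" "a \<in> dead R"
  shows "b \<in> dead R"
proof -
  obtain c where c: "c \<in> H" "a \<in> Cl c" "\<not> touched c" "nb c \<inter> (S \<union> R) = {}"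
    using assms by (auto simp: dead_def)
  have ab: "a \<in> V" "b \<in> V" "b \<in> R" using names_V[OF assms(1)] by auto
  have "b \<in> Cl c"
  proof (rule ccontr)
    assume b: "b \<notin> Cl c"
    have "b \<in> nb c"
    proof (cases \<tau>)
      case None
      then have "(b, a) \<in> E" using assms(1) symD[OF sym_E] by (auto simp: names_def)
      then show ?thesis using b c ab by (auto simp: nb_def)
    next
      case (Some d)
      then have d: "d \<in> H" "a \<in> nb d" "b \<in> nb d" using assms(1) by (auto simp: names_def)
      then have "Cl d \<subset> Cl c" using nb_in_Cl c by blast
      then show ?thesis using nb_extend[OF d(3)] b by blast
    qed
    then show False using c ab by blast
  qed
  then show ?thesis using c unfolding dead_def by blast
qed

lemma names_sym: "(a, b, \<tau>) \<in> names R \<Longrightarrow> (b, a, \<tau>) \<in> names R"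
  using symD[OF sym_E] by (auto simp: names_def)

lemma names_conn:
  assumes "(a, b, \<tau>) \<in> names R" "\<not> touched_name (a, b, \<tau>)" "R \<inter> F = {}"
  shows "conn E (V - F) a b"
proof (cases \<tau>)
  case None
  then show ?thesis using assms names_V[OF assms(1)] by (intro conn_edge) (auto simp: names_def)
next
  case (Some c)
  then have c: "c \<in> H" "\<not> touched c" "a \<in> nb c" "b \<in> nb c" "a \<notin> F" "b \<notin> F"
    using assms by (auto simp: names_def touched_name_def)
  then obtain y where "y \<in> Cl c" by (auto simp: nb_def)
  then show ?thesis using conn_trans[OF nb_conn[OF c(1,2,3,5)] conn_sym[OF sym_E nb_conn[OF c(1,2,4,6)]]] by blast
qed

text \<open>Soundness of the checks: an untouched pair joins two dead vertices, both of value 0, or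
  two alive vertices that are connected in G - F and so inherit equal bits.\<close>

lemma functional_consistent:
  assumes "R \<inter> F = {}" "\<alpha> \<in> consistent"
  shows "functional R Z \<alpha> = 0"
proof -
  have "value_at R \<alpha> a + value_at R \<alpha> b = 0"
    if ab: "(a, b, \<tau>) \<in> names R" "\<not> touched_name (a, b, \<tau>)" for a b \<tau>
  proof (cases "a \<in> dead R")
    case True
    then show ?thesis using value_dead names_dead[OF ab(1)] by simp
  next
    case False
    then have b: "b \<notin> dead R" using names_dead names_sym ab by blast
    have "a \<in> V - F" "b \<in> V - F" using names_V[OF ab(1)] assms by auto
    then obtain u w where uw: "u \<in> Q" "w \<in> Q" "conn E (V - F) a u" "conn E (V - F) b w"
       "value_at R \<alpha> a = \<alpha> u" "value_at R \<alpha> b = \<alpha> w"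
      using value_conn[OF assms _ False] value_conn[OF assms _ b] by blast
    then have "conn E (V - F) u w"
      using conn_trans[OF conn_sym[OF sym_E uw(3)] conn_trans[OF names_conn[OF ab assms(1)] uw(4)]] by simp
    then have "\<alpha> u = \<alpha> w" using consistentD[OF assms(2) uw(1,2)] by simp
    then show ?thesis using uw(5,6) by simp
  qed
  moreover have "\<And>v. v \<notin> Q \<Longrightarrow> \<alpha> v = 0" using assms by (auto simp: consistent_def pieces_def)
  ultimately show ?thesis
    by (subst functional_eq) (auto intro!: sum.neutral)
qed

text \<open>Vertices that are alive without any help from the sample.\<close>

definition live :: "addr set" where
  "live = V - F - dead {}"

text \<open>The constraints among live vertices, listed without reference to the sample. A test
  becomes a pair in \<open>names R\<close> as soon as both its ends are sampled
  (\<open>test_name\<close>).\<close>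

definition tests :: "(addr \<times> addr) set" where
  "tests = {(a, b). a \<in> live \<and> b \<in> live \<and> a \<noteq> b \<and>
     ((a, b) \<in> E \<or> (\<exists>c\<in>H. \<not> touched c \<and> small c \<and> a \<in> nb c \<and> b \<in> nb c))}"

lemma touched_not_dead:
  assumes "v \<in> V" "touched (fst v)" shows "v \<notin> dead R"
proof
  assume "v \<in> dead R"
  then obtain c where "c \<in> H" "v \<in> Cl c" "\<not> touched c" by (auto simp: dead_def)
  then show False using touched_iff_mono assms by blast
qed

lemma Q_live: "Q \<subseteq> live"
  using touched_not_dead by (auto simp: Q_def live_def)

lemma value_Q: "v \<in> Q \<Longrightarrow> value_at R \<alpha> v = \<alpha> v"
  using value_at_eq by (auto simp: Q_def)

text \<open>From a live vertex every cluster met on the way has a neighbour in S, and S takes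
  precedence; the chain is therefore the same for every R.\<close>

lemma value_live:
  assumes "v \<in> live"
  shows "value_at R \<alpha> v = value_at {} \<alpha> v"
  using assms
proof (induction "card V - card (Cl (fst v))" arbitrary: v rule: less_induct)
  case less
  show ?case
  proof (cases "touched (fst v)")
    case True
    then show ?thesis using value_at_eq less.prems by (simp add: live_def)
  next
    case False
    have v: "v \<in> V - F" "v \<notin> dead {}" using less.prems by (auto simp: live_def)
    obtain u where u: "rep {} (fst v) = Some u" "u \<in> V - F" "u \<notin> dead {}"
      using rep_alive[OF v False] by (metis Int_empty_left)
    then have "nb (fst v) \<inter> S \<noteq> {}" by (auto simp: rep_def split: if_splits)
    then have "rep R (fst v) = Some u" using u(1) by (simp add: rep_def)
    moreover have "card V - card (Cl (fst u)) < card V - card (Cl (fst v))"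
      using rep_rank[of v "{}" u] u v by auto
    then have "value_at R \<alpha> u = value_at {} \<alpha> u" using less.hyps[of u] u by (simp add: live_def)
    ultimately show ?thesis using value_at_eq v False u by simp
  qed
qed

lemma tests_consistent:
  assumes "\<alpha> \<in> consistent" "(a, b) \<in> tests"
  shows "value_at {} \<alpha> a = value_at {} \<alpha> b"
proof -
  have ab: "a \<in> V - F" "b \<in> V - F" "a \<notin> dead {}" "b \<notin> dead {}"
    using assms by (auto simp: tests_def live_def)
  obtain u w where uw: "u \<in> Q" "w \<in> Q" "conn E (V - F) a u" "conn E (V - F) b w"
       "value_at {} \<alpha> a = \<alpha> u" "value_at {} \<alpha> b = \<alpha> w"
    using value_conn[OF _ assms(1) ab(1,3)] value_conn[OF _ assms(1) ab(2,4)] by blast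
  have "conn E (V - F) a b"
    using assms(2) unfolding tests_def
  proof clarify
    assume "(a, b) \<in> E \<or> (\<exists>c\<in>H. \<not> touched c \<and> small c \<and> a \<in> nb c \<and> b \<in> nb c)"
    then show ?thesis
    proof (elim disjE bexE conjE)
      assume "(a, b) \<in> E" then show ?thesis using ab by (intro conn_edge) auto
    next
      fix c assume c: "c \<in> H" "\<not> touched c" "a \<in> nb c" "b \<in> nb c"
      then obtain y where "y \<in> Cl c" by (auto simp: nb_def)
      then show ?thesis
        using conn_trans[OF nb_conn[OF c(1-3)] conn_sym[OF sym_E nb_conn[OF c(1,2,4)]]] ab by simp
    qed
  qed
  then have "conn E (V - F) u w"
    using conn_trans[OF conn_sym[OF sym_E uw(3)] conn_trans[OF _ uw(4)]] by simp
  then have "\<alpha> u = \<alpha> w" using consistentD[OF assms(1) uw(1,2)] by simp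
  then show ?thesis using uw(5,6) by simp
qed

text \<open>Completeness of the tests. Along a walk from u to v in G - F, a live vertex hands its
  value to the next live one. Stretches of dead vertices carry no value of their own; they run
  through small untouched clusters, whose live neighbours are tied together by shortcuts.\<close>

lemma consistent_if_tests:
  assumes "\<alpha> \<in> pieces" and tests: "\<And>a b. (a, b) \<in> tests \<Longrightarrow> value_at {} \<alpha> a = value_at {} \<alpha> b"
  shows "\<alpha> \<in> consistent"
proof -
  let ?\<rho> = "value_at {} \<alpha>"
  have small_dead: "c \<in> H \<Longrightarrow> \<not> touched c \<Longrightarrow> small c \<Longrightarrow> v \<in> Cl c \<Longrightarrow> v \<in> dead {}" for c v
    unfolding dead_def small_def by auto
  have dead_small: "\<exists>c\<in>H. \<not> touched c \<and> small c \<and> v \<in> Cl c" if "v \<in> dead {}" for v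
    using that unfolding dead_def small_def by auto
  have tst: "?\<rho> a = ?\<rho> b" if "a \<in> live" "b \<in> live"
    "(a, b) \<in> E \<or> (\<exists>c\<in>H. \<not> touched c \<and> small c \<and> a \<in> nb c \<and> b \<in> nb c)" for a b
    using tests[of a b] that by (cases "a = b") (auto simp: tests_def)
  have main: "?\<rho> u = ?\<rho> v" if uv: "u \<in> Q" "v \<in> Q" "conn E (V - F) u v" for u v
  proof -
    define k where "k = ?\<rho> u"
    \<comment> \<open>The invariant remembers the value k during dead stretches by storing it at the
      live neighbours of every small untouched cluster that contains the current vertex.\<close>
    define I where "I x \<longleftrightarrow> (x \<in> live \<longrightarrow> ?\<rho> x = k) \<and>
      (\<forall>c\<in>H. \<not> touched c \<longrightarrow> small c \<longrightarrow> x \<in> Cl c \<longrightarrow> (\<forall>y\<in>nb c \<inter> live. ?\<rho> y = k))" for x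
    have "(u, v) \<in> (Restr E (V - F))\<^sup>*" using uv by (simp add: conn_def)
    then have "I v"
    proof (induction rule: rtrancl_induct)
      case base
      have "u \<notin> dead {}" using Q_live uv by (auto simp: live_def)
      then show ?case using small_dead unfolding I_def k_def by blast
    next
      case (step x y)
      then have xy: "(x, y) \<in> E" "(y, x) \<in> E" "x \<in> V - F" "y \<in> V - F" using symD[OF sym_E] by auto
      have nbI: "x \<in> nb c" if "x \<notin> Cl c" "y \<in> Cl c" for c
        using that xy by (auto simp: nb_def)
      have nbI': "y \<in> nb c" if "y \<notin> Cl c" "x \<in> Cl c" for c
        using that xy by (auto simp: nb_def)
      have 1: "?\<rho> y = k" if y: "y \<in> live"
      proof (cases "x \<in> live")
        case True
        then have "?\<rho> x = k" using step.IH by (simp add: I_def)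
        moreover have "?\<rho> x = ?\<rho> y" by (rule tst[OF True y]) (use xy in simp)
        ultimately show ?thesis by simp
      next
        case False
        then have "x \<in> dead {}" using xy by (simp add: live_def)
        then obtain c where c: "c \<in> H" "\<not> touched c" "small c" "x \<in> Cl c" using dead_small by blast
        then have "y \<notin> Cl c" using small_dead[OF c(1-3), of y] y by (auto simp: live_def)
        then have "y \<in> nb c" using nbI' c by blast
        then show ?thesis using step.IH c y by (simp add: I_def)
      qed
      have 2: "?\<rho> z = k" if c: "c \<in> H" "\<not> touched c" "small c" "y \<in> Cl c" and z: "z \<in> nb c" "z \<in> live" for c z
      proof (cases "x \<in> Cl c")
        case True
        then show ?thesis using step.IH c z by (simp add: I_def)
      next
        case xc: False
        then have xnb: "x \<in> nb c" using nbI c by blast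
        show ?thesis
        proof (cases "x \<in> live")
          case True
          then have "?\<rho> x = k" using step.IH by (simp add: I_def)
          moreover have "?\<rho> x = ?\<rho> z" by (rule tst[OF True z(2)]) (use c xnb z in blast)
          ultimately show ?thesis by simp
        next
          case False
          then have "x \<in> dead {}" using xy by (simp add: live_def)
          then obtain d where d: "d \<in> H" "\<not> touched d" "small d" "x \<in> Cl d" using dead_small by blast
          \<comment> \<open>The walk moves deeper while already inside a small cluster d. A live
            neighbour of the inner cluster c lies outside d, hence is a neighbour of d, to which the
            invariant applies.\<close>
          have "Cl c \<subset> Cl d" using nb_in_Cl[OF d(1) c(1) xnb d(4)] .
          moreover have "z \<notin> Cl d" using small_dead[OF d(1,2,3), of z] z(2) by (auto simp: live_def)
          ultimately have "z \<in> nb d" using nb_extend[OF z(1)] by blast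
          then show ?thesis using step.IH d z by (simp add: I_def)
        qed
      qed
      show ?case using 1 2 unfolding I_def by blast
    qed
    then show ?thesis using uv Q_live unfolding I_def k_def by auto
  qed
  show ?thesis
    
  proof (rule consistentI)
    fix u v assume "u \<in> Q" "v \<in> Q" "conn E (V - F) u v"
    then show "\<alpha> u = \<alpha> v" using main[of u v] value_Q[of u "{}" \<alpha>] value_Q[of v "{}" \<alpha>] by simp
  qed (rule assms(1))
qed

lemma functional_add:
  "functional R Z (\<lambda>v. \<alpha> v + \<beta> v) = functional R Z \<alpha> + functional R Z \<beta>"
proof -
  have "(case x of None \<Rightarrow> 0 | Some x \<Rightarrow> \<alpha> x + \<beta> x) =
      (case x of None \<Rightarrow> 0 | Some x \<Rightarrow> \<alpha> x) + (case x of None \<Rightarrow> 0 | Some x \<Rightarrow> \<beta> x)" for x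
    by (cases x) auto
  then show ?thesis
    unfolding functional_def by (simp add: distrib_left distrib_right sum.distrib ac_simps)
qed

lemma pieces_add: "\<alpha> \<in> pieces \<Longrightarrow> \<beta> \<in> pieces \<Longrightarrow> (\<lambda>v. \<alpha> v + \<beta> v) \<in> pieces"
  by (simp add: pieces_def)

lemma consistent_add: "\<alpha> \<in> consistent \<Longrightarrow> \<beta> \<in> consistent \<Longrightarrow> (\<lambda>v. \<alpha> v + \<beta> v) \<in> consistent"
  by (rule consistentI) (auto intro: pieces_add consistent_pieces arg_cong2[of _ _ _ _ plus] consistentD)

lemma zero_consistent: "(\<lambda>_. 0) \<in> consistent"
  by (rule consistentI) (simp_all add: pieces_def)

lemma component_consistent:
  assumes "s \<in> Q"
  shows "(\<lambda>v. if v \<in> Q \<and> conn E (V - F) s v then 1 else 0) \<in> consistent"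
proof -
  have "conn E (V - F) s (c, i) \<longleftrightarrow> conn E (V - F) s (c, Suc i)" if "(c, i) \<in> Q" "(c, Suc i) \<in> Q" for c i
  proof -
    have "conn E (V - F) (c, i) (c, Suc i)"
      using that path_down by (intro conn_edge) (auto simp: Q_def)
    then show ?thesis using conn_trans[of E "V - F" s] conn_sym[OF sym_E] by blast
  qed
  moreover have "conn E (V - F) s u \<longleftrightarrow> conn E (V - F) s v" if "conn E (V - F) u v" for u v
    using conn_trans[OF _ that] conn_trans[OF _ conn_sym[OF sym_E that]] by blast
  ultimately show ?thesis
    by (intro consistentI) (simp_all add: pieces_def)
qed

lemma separating_exists:
  assumes "s \<in> Q" "t \<in> Q" "\<not> conn E (V - F) s t"
  shows "\<exists>\<alpha>\<in>consistent. \<alpha> s \<noteq> \<alpha> t"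
  using component_consistent[OF assms(1)] assms by (intro bexI) auto

text \<open>Inserting or removing one violated pair flips the functional, so this toggling matches
  the sets Z with value 1 to those with value 0.\<close>

lemma functional_half:
  assumes "finite NU" "names R \<subseteq> NU" "\<alpha> \<in> pieces"
    and e: "e \<in> names R" "\<not> touched_name e" "value_at R \<alpha> (fst e) \<noteq> value_at R \<alpha> (fst (snd e))"
  shows "2 * card {Z \<in> Pow NU. functional R Z \<alpha> = 1} = card (Pow NU)"
proof -
  let ?flip = "\<lambda>Z. if e \<in> Z then Z - {e} else insert e Z"
  have eN: "e \<in> NU" using assms by auto
  have fun_eq: "functional R Z \<alpha> =
    (\<Sum>e | e \<in> names R \<inter> Z \<and> \<not> touched_name e. value_at R \<alpha> (fst e) + value_at R \<alpha> (fst (snd e)))" for Z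
    by (rule functional_eq) (use assms in \<open>auto simp: pieces_def\<close>)
  have ins: "functional R (insert e Z) \<alpha> = 1 + functional R Z \<alpha>" if "e \<notin> Z" for Z
  proof -
    have "{x. x \<in> names R \<inter> insert e Z \<and> \<not> touched_name x} = insert e {x. x \<in> names R \<inter> Z \<and> \<not> touched_name x}"
      using e by auto
    moreover have "value_at R \<alpha> (fst e) + value_at R \<alpha> (fst (snd e)) = 1"
      using e(3) by (simp add: bit_neq_iff)
    ultimately show ?thesis
      unfolding fun_eq using that by (simp only:, subst sum.insert) auto
  qed
  have flip: "functional R (?flip Z) \<alpha> = 1 + functional R Z \<alpha>" for Z
    using ins[of Z] ins[of "Z - {e}"] by (cases "e \<in> Z") (auto simp: insert_absorb)
  have flip1: "functional R (?flip Z) \<alpha> = 1 \<longleftrightarrow> functional R Z \<alpha> \<noteq> 1" for Z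
    unfolding flip by (cases "functional R Z \<alpha>") simp_all
  have sub: "?flip Z \<in> Pow NU" if "Z \<in> Pow NU" for Z
    using that eN by auto
  let ?A = "{Z \<in> Pow NU. functional R Z \<alpha> = 1}" and ?B = "{Z \<in> Pow NU. functional R Z \<alpha> \<noteq> 1}"
  have "bij_betw ?flip ?A ?B"
  proof (rule bij_betw_byWitness[where f' = ?flip])
    show "?flip ` ?A \<subseteq> ?B" "?flip ` ?B \<subseteq> ?A"
      using flip1 sub by blast+
  qed auto
  then have "card ?A = card ?B" by (rule bij_betw_same_card)
  moreover have "card (Pow NU) = card ?A + card ?B"
    using assms(1) by (subst card_Un_disjoint[symmetric]) (auto intro!: arg_cong[where f = card])
  ultimately show ?thesis by simp
qed

lemma test_name:
  assumes "(a, b) \<in> tests" "a \<in> R" "b \<in> R"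
  shows "\<exists>\<tau>. (a, b, \<tau>) \<in> names R \<and> \<not> touched_name (a, b, \<tau>)"
proof -
  consider "(a, b) \<in> E" | c where "c \<in> H" "\<not> touched c" "small c" "a \<in> nb c" "b \<in> nb c"
    using assms(1) by (auto simp: tests_def)
  then show ?thesis
  proof cases
    case 1
    then have "(a, b, None) \<in> names R" using assms unfolding names_def by blast
    then show ?thesis by (auto simp: touched_name_def)
  next
    case (2 c)
    then have "(a, b, Some c) \<in> names R" using assms unfolding names_def by blast
    then show ?thesis using 2(2) by (intro exI[of _ "Some c"]) (simp add: touched_name_def)
  qed
qed

lemma test_half:
  assumes "finite NU" "names R \<subseteq> NU" "\<alpha> \<in> pieces" "(a, b) \<in> tests" "a \<in> R" "b \<in> R"
    and "value_at {} \<alpha> a \<noteq> value_at {} \<alpha> b"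
  shows "2 * card {Z \<in> Pow NU. functional R Z \<alpha> = 1} = card (Pow NU)"
proof -
  obtain \<tau> where "(a, b, \<tau>) \<in> names R" "\<not> touched_name (a, b, \<tau>)"
    using test_name assms by blast
  moreover have "a \<in> live" "b \<in> live" using assms by (auto simp: tests_def)
  ultimately show ?thesis
    using functional_half[OF assms(1-3), of "(a, b, \<tau>)"] assms(7) value_live[of a R \<alpha>] value_live[of b R \<alpha>] by simp
qed

end

section \<open>Linear algebra over the two-element field by counting\<close>

definition bit_additive :: "(('v \<Rightarrow> bit) \<Rightarrow> bit) \<Rightarrow> bool" where
  "bit_additive \<phi> \<longleftrightarrow> (\<forall>\<alpha> \<beta>. \<phi> (\<lambda>v. \<alpha> v + \<beta> v) = \<phi> \<alpha> + \<phi> \<beta>)"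

definition add_closed :: "('v \<Rightarrow> bit) set \<Rightarrow> bool" where
  "add_closed K \<longleftrightarrow> (\<forall>\<alpha>\<in>K. \<forall>\<beta>\<in>K. (\<lambda>v. \<alpha> v + \<beta> v) \<in> K)"

lemma add_closed_kernel:
  assumes "add_closed K" "bit_additive \<phi>"
  shows "add_closed {\<alpha>\<in>K. \<phi> \<alpha> = 0}"
  using assms by (simp add: add_closed_def bit_additive_def)

text \<open>Adding a fixed vector outside the kernel exchanges the kernel with its
  complement.\<close>

lemma kernel_half:
  assumes "finite K" "add_closed K" "bit_additive \<phi>" "\<alpha>\<^sub>0 \<in> K" "\<phi> \<alpha>\<^sub>0 = 1"
  shows "card K = 2 * card {\<alpha>\<in>K. \<phi> \<alpha> = 0}"
proof -
  let ?f = "\<lambda>\<alpha> v. \<alpha> v + \<alpha>\<^sub>0 v"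
  let ?A = "{\<alpha>\<in>K. \<phi> \<alpha> = 0}" and ?B = "{\<alpha>\<in>K. \<phi> \<alpha> \<noteq> 0}"
  have f: "\<phi> (?f \<alpha>) = \<phi> \<alpha> + 1" "\<alpha> \<in> K \<Longrightarrow> ?f \<alpha> \<in> K" for \<alpha>
    using assms by (auto simp: bit_additive_def add_closed_def)
  have ff: "?f (?f \<alpha>) = \<alpha>" for \<alpha>
    by (rule ext) (simp add: add.assoc)
  have "bij_betw ?f ?A ?B"
    by (rule bij_betw_byWitness[where f' = ?f]) (auto simp: f ff)
  then have "card ?A = card ?B" by (rule bij_betw_same_card)
  moreover have "card K = card ?A + card ?B"
    using assms(1) by (subst card_Un_disjoint[symmetric]) (auto intro!: arg_cong[where f = card])
  ultimately show ?thesis by simp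
qed

text \<open>Cardinality replaces dimension. While the space is too large, some test is not
  identically zero on it; passing to its kernel halves the space. The chosen tests also differ
  pairwise as functionals on K, which later rules out choosing a pair together with its
  reversal.\<close>

lemma independent_tests:
  assumes "finite K" "add_closed K" "Kst \<subseteq> K"
    and "\<And>e. e \<in> Tst \<Longrightarrow> bit_additive (\<psi> e)"
    and "\<And>\<alpha>. \<alpha> \<in> K \<Longrightarrow> (\<forall>e\<in>Tst. \<psi> e \<alpha> = 0) \<Longrightarrow> \<alpha> \<in> Kst"
    and "\<And>\<alpha> e. \<alpha> \<in> Kst \<Longrightarrow> e \<in> Tst \<Longrightarrow> \<psi> e \<alpha> = 0"
  shows "\<exists>es \<subseteq> Tst. finite es \<and> card K = 2 ^ card es * card Kst \<and>
    (\<forall>e\<in>es. \<exists>\<alpha>\<in>K. \<psi> e \<alpha> = 1) \<and> (\<forall>e\<in>es. \<forall>e'\<in>es. e \<noteq> e' \<longrightarrow> (\<exists>\<alpha>\<in>K. \<psi> e \<alpha> \<noteq> \<psi> e' \<alpha>))"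
  using assms(1-3,5)
proof (induction "card K" arbitrary: K rule: less_induct)
  case less
  show ?case
  proof (cases "K = Kst")
    case True
    then show ?thesis by (intro exI[of _ "{}"]) auto
  next
    case False
    then obtain \<alpha>\<^sub>0 where "\<alpha>\<^sub>0 \<in> K" "\<alpha>\<^sub>0 \<notin> Kst" using less.prems by blast
    then obtain e where "e \<in> Tst" "\<psi> e \<alpha>\<^sub>0 \<noteq> 0" using less.prems(4) by blast
    then have e: "e \<in> Tst" "\<psi> e \<alpha>\<^sub>0 = 1" by simp_all
    define K' where "K' = {\<alpha>\<in>K. \<psi> e \<alpha> = 0}"
    have half: "card K = 2 * card K'"
      unfolding K'_def using less.prems e assms(4) \<open>\<alpha>\<^sub>0 \<in> K\<close> by (intro kernel_half) auto
    have "card K \<noteq> 0" using less.prems(1) \<open>\<alpha>\<^sub>0 \<in> K\<close> by auto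
    then have lt: "card K' < card K" using half by simp
    have K': "finite K'" "add_closed K'" "Kst \<subseteq> K'" "\<And>\<alpha>. \<alpha> \<in> K' \<Longrightarrow> (\<forall>e\<in>Tst. \<psi> e \<alpha> = 0) \<Longrightarrow> \<alpha> \<in> Kst"
      using less.prems add_closed_kernel[OF less.prems(2) assms(4)[OF e(1)]] assms(6)[OF _ e(1)]
      by (auto simp: K'_def)
    have "\<exists>es \<subseteq> Tst. finite es \<and> card K' = 2 ^ card es * card Kst \<and> (\<forall>e\<in>es. \<exists>\<alpha>\<in>K'. \<psi> e \<alpha> = 1) \<and>
      (\<forall>e\<in>es. \<forall>e'\<in>es. e \<noteq> e' \<longrightarrow> (\<exists>\<alpha>\<in>K'. \<psi> e \<alpha> \<noteq> \<psi> e' \<alpha>))"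
      by (rule less.hyps[OF lt K'(1-3)]) (rule K'(4))
    then obtain es where es: "es \<subseteq> Tst" "finite es" "card K' = 2 ^ card es * card Kst"
      "\<forall>e\<in>es. \<exists>\<alpha>\<in>K'. \<psi> e \<alpha> = 1"
      "\<forall>e\<in>es. \<forall>e'\<in>es. e \<noteq> e' \<longrightarrow> (\<exists>\<alpha>\<in>K'. \<psi> e \<alpha> \<noteq> \<psi> e' \<alpha>)"
      by (elim exE conjE) (rule that; assumption)
    have sub: "K' \<subseteq> K" by (auto simp: K'_def)
    \<comment> \<open>A test chosen later is nonzero somewhere on the kernel of e, so it differs
      from e.\<close>
    have new: "\<exists>\<alpha>\<in>K. \<psi> e \<alpha> = 0 \<and> \<psi> e' \<alpha> = 1" if "e' \<in> es" for e'
      using es(4) that by (force simp: K'_def)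
    then have "e \<notin> es" by force
    then have "card K = 2 ^ card (insert e es) * card Kst" using half es by simp
    moreover have "\<forall>e'\<in>insert e es. \<exists>\<alpha>\<in>K. \<psi> e' \<alpha> = 1" using es(4) sub e \<open>\<alpha>\<^sub>0 \<in> K\<close> by blast
    moreover have "\<exists>\<alpha>\<in>K. \<psi> x \<alpha> \<noteq> \<psi> y \<alpha>" if "x \<in> insert e es" "y \<in> insert e es" "x \<noteq> y" for x y
      using that
    proof (elim insertE)
      assume "x = e" "y = e" then show ?thesis using that by simp
    next
      assume "x = e" "y \<in> es" then show ?thesis using new[of y] by force
    next
      assume "x \<in> es" "y = e" then show ?thesis using new[of x] by force
    next
      assume "x \<in> es" "y \<in> es" then show ?thesis using es(5) sub that by blast
    qed
    ultimately show ?thesis using es e by (intro exI[of _ "insert e es"]) auto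
  qed
qed

section \<open>Elimination by random checks: a drift argument\<close>

text \<open>Shaped so that the drop from q to q - 1 equals q (1/q + 1/g) (1 + 1/g)^(q-1): the middle
  factor cancels the denominator of the hitting probability, and the relative drift no longer
  depends on q.\<close>

definition potential :: "real \<Rightarrow> nat \<Rightarrow> real" where
  "potential g q = real q * (1 + 1 / g) ^ q"

lemma potential_drop:
  assumes "g \<ge> 1" "q \<ge> 1" "p \<ge> 1 / (6 * g\<^sup>2 * (1 / q + 1 / g))"
  shows "(1 - p) * potential g q + p * potential g (q - 1) \<le> (1 - 1 / (12 * g\<^sup>2)) * potential g q"
proof -
  obtain r where q: "q = Suc r" using assms(2) by (cases q) auto
  define x where "x = (1 + 1 / g) ^ r"
  define s where "s = 1 / real q + 1 / g"
  have pos: "x > 0" "s > 0" using assms by (auto simp: x_def s_def add_pos_nonneg)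
  have P: "potential g q = real q * (1 + 1 / g) * x" "potential g (q - 1) = (real q - 1) * x"
    by (simp_all add: potential_def q x_def)
  have D: "potential g q - potential g (q - 1) = real q * s * x"
    unfolding P s_def using assms by (simp add: field_simps)
  \<comment> \<open>The bound 1 + 1/g <= 2 turns the constant 6 into 12.\<close>
  have "potential g q \<le> 2 * real q * x"
    unfolding P using assms pos by (intro mult_right_mono) (auto simp: field_simps)
  then have "potential g q / (12 * g\<^sup>2) \<le> real q * x / (6 * g\<^sup>2)"
    using assms by (simp add: field_simps)
  also have "\<dots> = 1 / (6 * g\<^sup>2 * s) * (real q * s * x)"
    using pos by simp
  also have "\<dots> \<le> p * (real q * s * x)"
    using assms pos by (intro mult_right_mono) (auto simp: s_def)
  finally have "potential g q / (12 * g\<^sup>2) \<le> p * (potential g q - potential g (q - 1))"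
    by (simp only: D)
  then show ?thesis by (simp add: algebra_simps)
qed

lemma lists_Suc:
  "{zs. set zs \<subseteq> A \<and> length zs = Suc R} = (\<lambda>(z, zs). z # zs) ` (A \<times> {zs. set zs \<subseteq> A \<and> length zs = R})"
  by (auto simp: length_Suc_conv image_iff)

lemma card_lists_Suc_filter:
  assumes "finite A"
  shows "card {zs. set zs \<subseteq> A \<and> length zs = Suc R \<and> P zs} =
    (\<Sum>z\<in>A. card {zs. set zs \<subseteq> A \<and> length zs = R \<and> P (z # zs)})"
proof -
  have "{zs. set zs \<subseteq> A \<and> length zs = Suc R \<and> P zs} =
     (\<lambda>(z, zs). z # zs) ` (SIGMA z:A. {zs. set zs \<subseteq> A \<and> length zs = R \<and> P (z # zs)})"
    by (auto simp: length_Suc_conv image_iff)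
  moreover have "finite {zs. set zs \<subseteq> A \<and> length zs = R \<and> P (z # zs)}" for z
    by (rule finite_subset[OF _ finite_lists_length_eq[OF assms, of R]]) auto
  ultimately show ?thesis using assms
    by (simp add: card_image inj_on_def)
qed

text \<open>An expected-value argument phrased by counting lists of checks. Here q measures the
  excess, on a logarithmic scale. A check leaves K unchanged or halves it, lowering q by one;
  \<open>hit\<close> bounds how often the latter happens, and \<open>potential_drop\<close> supplies
  the decay per step. With no checks left, failure means q >= 1, when the potential is at least
  1.\<close>

lemma elimination_count:
  fixes U :: "'z \<Rightarrow> ('v \<Rightarrow> bit) \<Rightarrow> bit" and g :: real
  assumes fin: "finite Inst" "finite K\<^sub>0" "g \<ge> 1" "finite Kst" "Kst \<noteq> {}"
    and add: "\<And>z. z \<in> Inst \<Longrightarrow> bit_additive (U z)"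
    and zero: "\<And>z \<alpha>. z \<in> Inst \<Longrightarrow> \<alpha> \<in> Kst \<Longrightarrow> U z \<alpha> = 0"
    and hit: "\<And>K q. K \<subseteq> K\<^sub>0 \<Longrightarrow> add_closed K \<Longrightarrow> Kst \<subseteq> K \<Longrightarrow> card K = 2 ^ q * card Kst \<Longrightarrow> q \<ge> 1 \<Longrightarrow>
       real (card {z\<in>Inst. \<exists>\<alpha>\<in>K. U z \<alpha> = 1}) \<ge> real (card Inst) / (6 * g\<^sup>2 * (1 / q + 1 / g))"
    and K: "K \<subseteq> K\<^sub>0" "add_closed K" "Kst \<subseteq> K" "card K = 2 ^ q * card Kst"
  shows "real (card {zs. set zs \<subseteq> Inst \<and> length zs = R \<and> \<not> {\<alpha>\<in>K. \<forall>z\<in>set zs. U z \<alpha> = 0} \<subseteq> Kst})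
     \<le> potential g q * ((1 - 1 / (12 * g\<^sup>2)) * card Inst) ^ R"
  using K
proof (induction R arbitrary: K q)
  case 0
  have "{zs. set zs \<subseteq> Inst \<and> length zs = 0 \<and> \<not> {\<alpha>\<in>K. \<forall>z\<in>set zs. U z \<alpha> = 0} \<subseteq> Kst} = (if K \<subseteq> Kst then {} else {[]})"
    by auto
  moreover have "potential g q \<ge> 1" if "\<not> K \<subseteq> Kst"
  proof -
    have "q \<noteq> 0" using 0 that card_subset_eq[of K Kst] finite_subset[OF 0(1) fin(2)] by auto
    then have "1 * 1 \<le> real q * (1 + 1 / g) ^ q" using fin(3) by (intro mult_mono one_le_power) auto
    then show ?thesis by (simp add: potential_def)
  qed
  moreover have "potential g q \<ge> 0" using fin(3) by (simp add: potential_def)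
  ultimately show ?case by auto
next
  case (Suc R)
  have finK: "finite K" using Suc.prems fin finite_subset by blast
  have cK: "card Kst > 0" using fin by (simp add: card_gt_0_iff)
  define X where "X = ((1 - 1 / (12 * g\<^sup>2)) * card Inst) ^ R"
  have "g\<^sup>2 \<ge> 1" using fin(3) by (rule one_le_power)
  then have "1 / (12 * g\<^sup>2) \<le> 1" by (subst divide_le_eq_1_pos) linarith+
  then have nonneg: "(1 - 1 / (12 * g\<^sup>2)) * card Inst \<ge> 0" by simp
  then have X: "X \<ge> 0" unfolding X_def by (rule zero_le_power)
  define Hit where "Hit = {z\<in>Inst. \<exists>\<alpha>\<in>K. U z \<alpha> = 1}"
  define B where "B z = real (card {zs. set zs \<subseteq> Inst \<and> length zs = R \<and>
      \<not> {\<alpha>\<in>K. U z \<alpha> = 0 \<and> (\<forall>z\<in>set zs. U z \<alpha> = 0)} \<subseteq> Kst})" for z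
  have Hit: "finite Hit" "Hit \<subseteq> Inst" using fin by (auto simp: Hit_def)
  have eq: "real (card {zs. set zs \<subseteq> Inst \<and> length zs = Suc R \<and> \<not> {\<alpha>\<in>K. \<forall>z\<in>set zs. U z \<alpha> = 0} \<subseteq> Kst}) = (\<Sum>z\<in>Inst. B z)"
    unfolding B_def by (subst card_lists_Suc_filter[OF fin(1)]) simp
  have ker: "{\<alpha>\<in>K. U z \<alpha> = 0 \<and> (\<forall>z\<in>set zs. U z \<alpha> = 0)} = {\<alpha>\<in>{\<alpha>\<in>K. U z \<alpha> = 0}. \<forall>z\<in>set zs. U z \<alpha> = 0}" for z zs
    by auto
  have miss: "B z \<le> potential g q * X" if "z \<in> Inst - Hit" for z
  proof -
    have "{\<alpha>\<in>K. U z \<alpha> = 0} = K" using that by (auto simp: Hit_def)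
    then show ?thesis unfolding B_def X_def ker using Suc.IH[OF Suc.prems] by simp
  qed
  have hitB: "B z \<le> potential g (q - 1) * X" "q \<ge> 1" if z: "z \<in> Hit" for z
  proof -
    obtain \<alpha> where \<alpha>: "\<alpha> \<in> K" "U z \<alpha> = 1" "z \<in> Inst" using z by (auto simp: Hit_def)
    let ?K = "{\<alpha>\<in>K. U z \<alpha> = 0}"
    have half: "card K = 2 * card ?K" by (rule kernel_half[OF finK Suc.prems(2) add \<alpha>(1,2)]) (rule \<alpha>)
    have sub: "Kst \<subseteq> ?K" using Suc.prems(3) zero \<alpha> by auto
    have "\<alpha> \<notin> Kst" using zero \<alpha> by auto
    then have "card Kst < card K" using Suc.prems(3) \<alpha>(1) finK by (intro psubset_card_mono) auto
    then have "q \<noteq> 0" using Suc.prems(4) by (intro notI) simp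
    then show "q \<ge> 1" by simp
    have cK': "card ?K = 2 ^ (q - 1) * card Kst"
      using half Suc.prems(4) \<open>q \<noteq> 0\<close> by (cases q) auto
    show "B z \<le> potential g (q - 1) * X"
      unfolding B_def X_def ker
      by (rule Suc.IH) (use Suc.prems add_closed_kernel[OF Suc.prems(2) add[OF \<alpha>(3)]] sub cK' in auto)
  qed
  show ?case
  proof (cases "q \<ge> 1 \<and> Inst \<noteq> {}")
    case True
    define p where "p = real (card Hit) / card Inst"
    have cI: "real (card Inst) > 0" using True fin by (simp add: card_gt_0_iff)
    have "p \<ge> 1 / (6 * g\<^sup>2 * (1 / q + 1 / g))"
      using hit[OF Suc.prems] True cI unfolding p_def Hit_def by (simp add: field_simps)
    then have drop: "(1 - p) * potential g q + p * potential g (q - 1) \<le> (1 - 1 / (12 * g\<^sup>2)) * potential g q"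
      using potential_drop fin True by blast
    have "(\<Sum>z\<in>Inst. B z) = (\<Sum>z\<in>Inst - Hit. B z) + (\<Sum>z\<in>Hit. B z)"
      using Hit fin by (simp add: sum.subset_diff)
    also have "\<dots> \<le> (\<Sum>z\<in>Inst - Hit. potential g q * X) + (\<Sum>z\<in>Hit. potential g (q - 1) * X)"
      using miss hitB by (intro add_mono sum_mono) auto
    also have "\<dots> = (real (card Inst) - real (card Hit)) * (potential g q * X) + real (card Hit) * (potential g (q - 1) * X)"
      using Hit fin card_mono[OF fin(1) Hit(2)] by (simp add: card_Diff_subset of_nat_diff)
    also have "\<dots> = card Inst * X * ((1 - p) * potential g q + p * potential g (q - 1))"
      using cI by (simp add: p_def field_simps)
    also have "\<dots> \<le> card Inst * X * ((1 - 1 / (12 * g\<^sup>2)) * potential g q)"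
      using drop X by (intro mult_left_mono) auto
    finally show ?thesis unfolding eq X_def by (simp add: mult_ac)
  next
    case False
    have "B z = 0" if "z \<in> Inst" for z
    proof -
      have "q = 0" using False that by auto
      then have "potential g q = 0" by (simp add: potential_def)
      moreover have "z \<in> Inst - Hit" using hitB(2) \<open>q = 0\<close> that by force
      ultimately have "B z \<le> 0" using miss[of z] by simp
      then show ?thesis by (simp add: B_def)
    qed
    moreover have "potential g q * ((1 - 1 / (12 * g\<^sup>2)) * card Inst) ^ Suc R \<ge> 0"
      using fin(3) zero_le_power[OF nonneg, of "Suc R"] by (simp add: potential_def)
    ultimately show ?thesis unfolding eq by simp
  qed
qed

lemma potential_mono: "q \<le> p \<Longrightarrow> g \<ge> 1 \<Longrightarrow> potential g q \<le> potential g p"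
  unfolding potential_def by (intro mult_mono power_increasing) auto

section \<open>Random colourings and the second moment method\<close>

lemma card_colourings:
  assumes "finite U" "T \<subseteq> U" "F \<subseteq> U" "T \<inter> F = {}"
  shows "card {c \<in> PiE U (\<lambda>_. {..f}). (\<forall>v\<in>T. c v = 0) \<and> (\<forall>v\<in>F. c v \<noteq> 0)} =
    f ^ card F * Suc f ^ (card U - card F - card T)"
proof -
  let ?D = "\<lambda>v. if v \<in> T then {0} else if v \<in> F then {1..f} else {..f}"
  have "{c \<in> PiE U (\<lambda>_. {..f}). (\<forall>v\<in>T. c v = 0) \<and> (\<forall>v\<in>F. c v \<noteq> 0)} = PiE U ?D"
  proof (intro equalityI subsetI)
    fix c assume c: "c \<in> {c \<in> PiE U (\<lambda>_. {..f}). (\<forall>v\<in>T. c v = 0) \<and> (\<forall>v\<in>F. c v \<noteq> 0)}"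
    then show "c \<in> PiE U ?D"
      by (auto simp: PiE_iff Suc_le_eq)
  next
    fix c assume c: "c \<in> PiE U ?D"
    have "c v \<in> ?D v" if "v \<in> U" for v using c that by (rule PiE_mem)
    then have "c v \<le> f" "v \<in> T \<Longrightarrow> c v = 0" "v \<in> F \<Longrightarrow> c v \<noteq> 0" if "v \<in> U" for v
      using that assms(4) by (fastforce split: if_splits)+
    then show "c \<in> {c \<in> PiE U (\<lambda>_. {..f}). (\<forall>v\<in>T. c v = 0) \<and> (\<forall>v\<in>F. c v \<noteq> 0)}"
      using c assms(2,3) by (auto simp: PiE_iff)
  qed
  then have "card {c \<in> PiE U (\<lambda>_. {..f}). (\<forall>v\<in>T. c v = 0) \<and> (\<forall>v\<in>F. c v \<noteq> 0)} = (\<Prod>v\<in>U. card (?D v))"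
    by (simp add: card_PiE assms(1))
  also have "\<dots> = (\<Prod>v\<in>U. if v \<in> T then 1 else if v \<in> F then f else Suc f)"
    by (intro prod.cong) auto
  also have "\<dots> = (\<Prod>v\<in>U - T. if v \<in> F then f else Suc f)"
    by (intro prod.mono_neutral_cong_right) (use assms in auto)
  also have "\<dots> = f ^ card ((U - T) \<inter> F) * Suc f ^ card ((U - T) \<inter> - F)"
    using assms(1) by (simp add: prod.If_cases Collect_neg_eq)
  also have "(U - T) \<inter> F = F" using assms by auto
  also have "(U - T) \<inter> - F = U - F - T" by auto
  also have "card (U - F - T) = card U - card F - card T"
  proof -
    have "finite T" "finite F" using assms finite_subset by blast+
    moreover have "T \<subseteq> U - F" using assms by blast
    ultimately show ?thesis using assms(3) by (simp add: card_Diff_subset)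
  qed
  finally show ?thesis .
qed

lemma card_colourings_real:
  assumes "finite U" "T \<subseteq> U" "F \<subseteq> U" "T \<inter> F = {}"
  shows "real (card {c \<in> PiE U (\<lambda>_. {..f}). (\<forall>v\<in>T. c v = 0) \<and> (\<forall>v\<in>F. c v \<noteq> 0)}) =
    real (Suc f) ^ card U * (real f / real (Suc f)) ^ card F / real (Suc f) ^ card T"
proof -
  have "card F + card T \<le> card U"
    using assms by (metis Int_commute card_Un_disjoint card_mono finite_subset le_sup_iff)
  then have "real (Suc f) ^ card U = real (Suc f) ^ (card U - card F - card T) * real (Suc f) ^ card F * real (Suc f) ^ card T"
    by (simp flip: power_add)
  then show ?thesis
    unfolding card_colourings[OF assms] by (simp add: power_divide)
qed

text \<open>The extreme case is 1 / (1 + 1/f)^f >= 1/e >= 1/3.\<close>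

lemma survival_ge_third:
  assumes "f \<ge> 1" "k \<le> f"
  shows "(real f / real (Suc f)) ^ k \<ge> 1 / 3"
proof -
  have "(1 + 1 / real f) ^ f \<le> exp 1"
    using exp_ge_one_plus_x_over_n_power_n[of f 1] assms by simp
  also have "\<dots> \<le> 3" by (rule exp_le)
  finally have "1 / 3 \<le> 1 / (1 + 1 / real f) ^ f"
    by (intro divide_left_mono) (auto simp: add_pos_nonneg)
  also have "\<dots> = (real f / real (Suc f)) ^ f"
    using assms by (simp add: field_simps power_divide)
  also have "\<dots> \<le> (real f / real (Suc f)) ^ k"
    using assms by (intro power_decreasing) auto
  finally show ?thesis .
qed

text \<open>Second moment method for the number X of pairs with both ends coloured 0, over
  colourings without 0 on F. Distinct pairs, reversals being excluded, span at least three vertices,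
  so their joint probability carries a factor g^(-3); this yields the summand 1/g next to
  1/q.\<close>

lemma pair_hit_colourings:
  assumes "finite U" "F \<subseteq> U" "card F \<le> f" "f \<ge> 1" "finite es" "card es \<ge> 1"
    and es: "\<And>a b. (a, b) \<in> es \<Longrightarrow> a \<in> U - F \<and> b \<in> U - F \<and> a \<noteq> b \<and> (b, a) \<notin> es"
  shows "real (card {c \<in> PiE U (\<lambda>_. {..f}). (\<forall>v\<in>F. c v \<noteq> 0) \<and> (\<exists>(a, b)\<in>es. c a = 0 \<and> c b = 0)})
    \<ge> real (card (PiE U (\<lambda>_. {..f}))) / (3 * (real (Suc f))\<^sup>2 * (1 / card es + 1 / real (Suc f)))"
proof -
  define g where "g = real (Suc f)"
  define q where "q = real (card es)"
  define N where "N = real (card (PiE U (\<lambda>_. {..f})))"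
  define h where "h = (real f / g) ^ card F"
  define G where "G = {c \<in> PiE U (\<lambda>_. {..f}). \<forall>v\<in>F. c v \<noteq> 0}"
  define act where "act c e \<longleftrightarrow> c (fst e) = 0 \<and> c (snd e) = (0::nat)" for c and e :: "'a \<times> 'a"
  define X where "X c = (\<Sum>e\<in>es. of_bool (act c e) :: real)" for c
  have g: "g \<ge> 1" "g > 0" and q: "q \<ge> 1" using assms by (auto simp: g_def q_def)
  have finG: "finite G" unfolding G_def using assms(1) by (simp add: finite_PiE)
  have N: "N = g ^ card U" by (simp add: N_def g_def card_PiE assms(1))
  have N0: "N \<ge> 0" by (simp add: N_def)
  have h0: "h \<ge> 1 / 3" unfolding h_def g_def using survival_ge_third assms by blast
  have cnt: "(\<Sum>c\<in>G. of_bool (\<forall>v\<in>T. c v = 0) :: real) = N * h / g ^ card T" if "T \<subseteq> U - F" for T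
  proof -
    have "(\<Sum>c\<in>G. of_bool (\<forall>v\<in>T. c v = 0) :: real) = real (card (G \<inter> {c. \<forall>v\<in>T. c v = 0}))"
      using finG by (simp add: sum.If_cases of_bool_def)
    also have "G \<inter> {c. \<forall>v\<in>T. c v = 0} = {c \<in> PiE U (\<lambda>_. {..f}). (\<forall>v\<in>T. c v = 0) \<and> (\<forall>v\<in>F. c v \<noteq> 0)}"
      by (auto simp: G_def)
    also have "real (card \<dots>) = N * h / g ^ card T"
      unfolding N h_def g_def using that assms by (intro card_colourings_real) auto
    finally show ?thesis .
  qed
  have one: "(\<Sum>c\<in>G. of_bool (act c e)) = N * h / g\<^sup>2" if "e \<in> es" for e
  proof -
    obtain a b where e: "e = (a, b)" by (cases e)
    then have ab: "a \<in> U - F" "b \<in> U - F" "a \<noteq> b" using es that by auto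
    then have "card {a, b} = 2" by simp
    then show ?thesis using cnt[of "{a, b}"] ab by (simp add: e act_def power2_eq_square)
  qed
  have two: "(\<Sum>c\<in>G. of_bool (act c e) * of_bool (act c e')) \<le> N * h / g ^ 3"
    if ee: "e \<in> es" "e' \<in> es" "e \<noteq> e'" for e e'
  proof -
    obtain a b where e: "e = (a, b)" by (cases e)
    obtain a' b' where e': "e' = (a', b')" by (cases e')
    let ?T = "{a, b, a', b'}"
    have ab: "a \<in> U - F" "b \<in> U - F" "a \<noteq> b" "(b, a) \<notin> es"
      "a' \<in> U - F" "b' \<in> U - F" "a' \<noteq> b'" using es ee e e' by auto
    have "card ?T \<ge> 3"
    proof -
      have "a' \<notin> {a, b} \<or> b' \<notin> {a, b}" using ee e e' ab by auto
      then have "\<exists>x. x \<in> ?T \<and> x \<notin> {a, b}" by auto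
      then obtain x where "x \<in> ?T" "x \<notin> {a, b}" by blast
      then have "card {a, b, x} \<le> card ?T" by (intro card_mono) auto
      moreover have "card {a, b, x} = 3" using \<open>x \<notin> {a, b}\<close> \<open>a \<noteq> b\<close> by (auto simp: card_insert_if)
      ultimately show ?thesis by simp
    qed
    have "(\<Sum>c\<in>G. of_bool (act c e) * of_bool (act c e')) = (\<Sum>c\<in>G. of_bool (\<forall>v\<in>?T. c v = 0) :: real)"
      by (intro sum.cong) (auto simp: act_def e e')
    also have "\<dots> = N * h / g ^ card ?T" using ab by (intro cnt) auto
    also have "\<dots> \<le> N * h / g ^ 3"
      using \<open>card ?T \<ge> 3\<close> g N0 h0 by (intro divide_left_mono power_increasing) auto
    finally show ?thesis .
  qed
  have EX: "(\<Sum>c\<in>G. X c) = q * (N * h / g\<^sup>2)"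
    unfolding X_def by (subst sum.swap) (simp add: one q_def)
  have "(\<Sum>c\<in>G. (X c)\<^sup>2) = (\<Sum>c\<in>G. \<Sum>e\<in>es. \<Sum>e'\<in>es. of_bool (act c e) * of_bool (act c e'))"
    unfolding X_def power2_eq_square by (simp add: sum_product)
  also have "\<dots> = (\<Sum>e\<in>es. \<Sum>e'\<in>es. \<Sum>c\<in>G. of_bool (act c e) * of_bool (act c e'))"
    by (subst sum.swap, rule sum.cong[OF refl], subst sum.swap) simp
  also have "\<dots> \<le> (\<Sum>e\<in>es. \<Sum>e'\<in>es. (if e' = e then N * h / g\<^sup>2 else 0) + N * h / g ^ 3)"
  proof (intro sum_mono)
    fix e e' assume ee: "e \<in> es" "e' \<in> es"
    have "(\<Sum>c\<in>G. of_bool (act c e) * of_bool (act c e)) = (\<Sum>c\<in>G. of_bool (act c e) :: real)"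
      by (intro sum.cong) auto
    moreover have "N * h / g ^ 3 \<ge> 0" using N0 h0 g by simp
    ultimately show "(\<Sum>c\<in>G. of_bool (act c e) * of_bool (act c e')) \<le> (if e' = e then N * h / g\<^sup>2 else 0) + N * h / g ^ 3"
      using one[OF ee(1)] two[OF ee] by auto
  qed
  also have "\<dots> = q * (N * h / g\<^sup>2) + q * (q * (N * h / g ^ 3))"
    using assms(5) by (simp add: sum.distrib q_def distrib_left)
  also have "\<dots> = q * (N * h / g\<^sup>2) * (1 + q / g)"
    using g by (simp add: field_simps power3_eq_cube power2_eq_square)
  finally have EX2: "(\<Sum>c\<in>G. (X c)\<^sup>2) \<le> q * (N * h / g\<^sup>2) * (1 + q / g)" .
  \<comment> \<open>For every t the expression 2tX - (tX)^2 is at most the indicator of X being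
    nonzero. This t maximises the average of the left side for the moment bounds just
    obtained.\<close>
  define t where "t = 1 / (1 + q / g)"
  have qg: "1 + q / g > 0" using g q by (simp add: add_pos_nonneg)
  have "N / (3 * g\<^sup>2 * (1 / q + 1 / g)) = (1/3) * (q * (N / g\<^sup>2) * t)"
    using g q qg by (simp add: t_def field_simps)
  also have "\<dots> \<le> h * (q * (N / g\<^sup>2) * t)"
    using h0 g q N0 qg by (intro mult_right_mono) (auto simp: t_def)
  also have "\<dots> = 2 * t * (q * (N * h / g\<^sup>2)) - t\<^sup>2 * (q * (N * h / g\<^sup>2) * (1 + q / g))"
  proof -
    have "t\<^sup>2 * (q * (N * h / g\<^sup>2) * (1 + q / g)) = q * (N * h / g\<^sup>2) * t * (t * (1 + q / g))"
      by (simp only: power2_eq_square mult_ac)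
    also have "t * (1 + q / g) = 1" using qg by (simp add: t_def)
    finally have "t\<^sup>2 * (q * (N * h / g\<^sup>2) * (1 + q / g)) = q * (N * h / g\<^sup>2) * t" by (simp only: mult_1_right)
    moreover have "h * (q * (N / g\<^sup>2) * t) = q * (N * h / g\<^sup>2) * t" by simp
    moreover have "2 * t * (q * (N * h / g\<^sup>2)) = q * (N * h / g\<^sup>2) * t + q * (N * h / g\<^sup>2) * t" by simp
    ultimately show ?thesis by (simp only: add_diff_cancel_right')
  qed
  also have "\<dots> \<le> 2 * t * (\<Sum>c\<in>G. X c) - t\<^sup>2 * (\<Sum>c\<in>G. (X c)\<^sup>2)"
    unfolding EX using EX2 by (intro diff_left_mono mult_left_mono) auto
  also have "\<dots> = (\<Sum>c\<in>G. 2 * t * X c - t\<^sup>2 * (X c)\<^sup>2)"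
    by (simp add: sum_subtractf sum_distrib_left)
  also have "\<dots> \<le> (\<Sum>c\<in>G. of_bool (\<exists>e\<in>es. act c e))"
  proof (rule sum_mono)
    fix c
    show "2 * t * X c - t\<^sup>2 * (X c)\<^sup>2 \<le> of_bool (\<exists>e\<in>es. act c e)"
    proof (cases "\<exists>e\<in>es. act c e")
      case True
      have "0 \<le> (1 - t * X c)\<^sup>2" by simp
      then show ?thesis using True by (simp add: power2_eq_square algebra_simps)
    next
      case False
      then have "X c = 0" by (simp add: X_def)
      then show ?thesis by simp
    qed
  qed
  also have "\<dots> = real (card (G \<inter> {c. \<exists>e\<in>es. act c e}))"
    using finG by (simp add: sum.If_cases of_bool_def)
  also have "G \<inter> {c. \<exists>e\<in>es. act c e} =
    {c \<in> PiE U (\<lambda>_. {..f}). (\<forall>v\<in>F. c v \<noteq> 0) \<and> (\<exists>(a, b)\<in>es. c a = 0 \<and> c b = 0)}"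
    by (auto simp: G_def act_def case_prod_beta)
  finally show ?thesis by (simp add: N_def g_def q_def)
qed

section \<open>Random instances and successful elimination\<close>

definition grid :: "nat \<Rightarrow> addr set" where
  "grid n = {..<n} \<times> {..<n}"

text \<open>Independent sampling with probability 1/(f+1) is encoded by uniform colourings with f+1
  colours, colour 0 meaning "sampled". Probabilities become ratios of cardinalities.\<close>

definition colourings :: "nat \<Rightarrow> nat \<Rightarrow> (addr \<Rightarrow> nat) set" where
  "colourings n f = PiE (grid n) (\<lambda>_. {..f})"

text \<open>A universe of pairs depending on n alone, so that the same instance can be used for
  every graph with n vertices.\<close>

definition all_names :: "nat \<Rightarrow> name set" where
  "all_names n = grid n \<times> grid n \<times> insert None (Some ` {..<n})"

definition zeros :: "nat \<Rightarrow> (addr \<Rightarrow> nat) \<Rightarrow> addr set" where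
  "zeros n c = {v \<in> grid n. c v = 0}"

definition instances :: "nat \<Rightarrow> nat \<Rightarrow> ((addr \<Rightarrow> nat) \<times> name set) set" where
  "instances n f = colourings n f \<times> Pow (all_names n)"

lemma finite_grid [simp]: "finite (grid n)"
  by (simp add: grid_def)

lemma finite_colourings [simp]: "finite (colourings n f)"
  by (simp add: colourings_def finite_PiE)

lemma finite_all_names [simp]: "finite (all_names n)"
  by (simp add: all_names_def)

lemma finite_instances [simp]: "finite (instances n f)"
  by (simp add: instances_def)

lemma instances_nonempty: "instances n f \<noteq> {}"
  by (auto simp: instances_def colourings_def PiE_eq_empty_iff)

context scheme begin

lemma names_subset: "names R \<subseteq> all_names n"
proof (rule subsetI)
  fix e assume e: "e \<in> names R"
  obtain a b \<tau> where "e = (a, b, \<tau>)" by (cases e)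
  then show "e \<in> all_names n"
    using names_V[of a b \<tau> R] e V_bound H_bound by (auto simp: all_names_def grid_def)
qed

end

context query begin

text \<open>A sample that hits F gives no sound constraint and is replaced by the zero
  functional.\<close>

definition check :: "((addr \<Rightarrow> nat) \<times> name set) \<Rightarrow> (addr \<Rightarrow> bit) \<Rightarrow> bit" where
  "check z \<alpha> = (if zeros n (fst z) \<inter> F = {} then functional (zeros n (fst z)) (snd z) \<alpha> else 0)"

lemma additive_check: "bit_additive (check z)"
  by (simp add: bit_additive_def check_def functional_add)

lemma check_consistent: "\<alpha> \<in> consistent \<Longrightarrow> check z \<alpha> = 0"
  by (simp add: check_def functional_consistent)

text \<open>The possible first positions of pieces: path beginnings and successors of failed
  vertices. The bits there determine a vector in \<open>pieces\<close>, which bounds the size of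
  that space.\<close>

definition starts :: "addr set" where
  "starts = (\<lambda>c. (c, 0)) ` {c \<in> H. touched c} \<union> (\<lambda>(c, i). (c, Suc i)) ` F"

lemma inj_on_pieces: "inj_on (\<lambda>\<alpha>. {v \<in> starts. \<alpha> v = 1}) pieces"
proof (rule inj_onI)
  fix \<alpha> \<beta> assume p: "\<alpha> \<in> pieces" "\<beta> \<in> pieces" and eq: "{v \<in> starts. \<alpha> v = 1} = {v \<in> starts. \<beta> v = 1}"
  have st: "\<alpha> v = \<beta> v" if "v \<in> starts" for v
  proof -
    have "\<alpha> v = 1 \<longleftrightarrow> \<beta> v = 1" using eq that by blast
    then show ?thesis by (cases "\<alpha> v"; cases "\<beta> v") auto
  qed
  have Q: "(c, i) \<in> Q \<Longrightarrow> \<alpha> (c, i) = \<beta> (c, i)" for c i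
  proof (induction i)
    case 0
    then have "(c, 0) \<in> starts" using fst_H[of "(c, 0)"] unfolding starts_def Q_def by auto
    then show ?case by (rule st)
  next
    case (Suc i)
    show ?case
    proof (cases "(c, i) \<in> F")
      case True
      then have "(c, Suc i) \<in> starts" unfolding starts_def by force
      then show ?thesis by (rule st)
    next
      case False
      then have "(c, i) \<in> Q" using Suc.prems path_down by (auto simp: Q_def)
      then have "\<alpha> (c, i) = \<alpha> (c, Suc i)" "\<beta> (c, i) = \<beta> (c, Suc i)"
        using p Suc.prems unfolding pieces_def by blast+
      then show ?thesis using Suc.IH \<open>(c, i) \<in> Q\<close> by simp
    qed
  qed
  show "\<alpha> = \<beta>"
  proof (rule ext)
    fix v show "\<alpha> v = \<beta> v"
    proof (cases "v \<in> Q")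
      case True then show ?thesis using Q[of "fst v" "snd v"] by simp
    next
      case False
      then have "\<alpha> v = 0" "\<beta> v = 0" using p unfolding pieces_def by blast+
      then show ?thesis by simp
    qed
  qed
qed

lemma finite_F: "finite F" and finite_T: "finite T"
  by (rule finite_subset[OF subset_trans[OF F_T T_V] finite_V], rule finite_subset[OF T_V finite_V])

lemma finite_starts: "finite starts"
  by (simp add: starts_def finite_F)

lemma finite_pieces: "finite pieces"
  by (rule inj_on_finite[OF inj_on_pieces, of "Pow starts"]) (auto simp: finite_starts)

lemma card_starts: "card starts \<le> card T * L + card F"
proof -
  have "{c \<in> H. touched c} = (\<Union>x\<in>T. {c \<in> H. x \<in> Cl c})"
    by (auto simp: touched_def)
  then have "card {c \<in> H. touched c} \<le> (\<Sum>x\<in>T. card {c \<in> H. x \<in> Cl c})"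
    using card_UN_le[OF finite_T] by simp
  also have "\<dots> \<le> (\<Sum>x\<in>T. L)"
    using Cl_depth T_V unfolding H_def by (intro sum_mono) blast
  finally have "card {c \<in> H. touched c} \<le> card T * L" by simp
  moreover have "card ((\<lambda>c. (c, 0::nat)) ` {c \<in> H. touched c}) \<le> card {c \<in> H. touched c}"
    by (rule card_image_le) simp
  moreover have "card ((\<lambda>(c, i). (c, Suc i)) ` F) \<le> card F"
    by (rule card_image_le) (rule finite_F)
  ultimately show ?thesis
    unfolding starts_def using card_Un_le[of "(\<lambda>c. (c, 0::nat)) ` {c \<in> H. touched c}" "(\<lambda>(c, i). (c, Suc i)) ` F"]
    by linarith
qed

lemma card_pieces: "card pieces \<le> 2 ^ (card T * L + card F)"
proof -
  have "card pieces \<le> card (Pow starts)"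
    using inj_on_pieces by (rule card_inj_on_le) (auto simp: finite_starts)
  also have "\<dots> = 2 ^ card starts" using finite_starts by (rule card_Pow)
  also have "\<dots> \<le> 2 ^ (card T * L + card F)" using card_starts by (intro power_increasing) auto
  finally show ?thesis .
qed

definition test_value :: "addr \<times> addr \<Rightarrow> (addr \<Rightarrow> bit) \<Rightarrow> bit" where
  "test_value e \<alpha> = value_at {} \<alpha> (fst e) + value_at {} \<alpha> (snd e)"

lemma tests_independent:
  assumes "K \<subseteq> pieces" "add_closed K" "consistent \<subseteq> K"
  shows "\<exists>es \<subseteq> tests. finite es \<and> card K = 2 ^ card es * card consistent \<and>
    (\<forall>e\<in>es. \<exists>\<alpha>\<in>K. test_value e \<alpha> = 1) \<and>
    (\<forall>e\<in>es. \<forall>e'\<in>es. e \<noteq> e' \<longrightarrow> (\<exists>\<alpha>\<in>K. test_value e \<alpha> \<noteq> test_value e' \<alpha>))"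
proof (rule independent_tests[OF _ assms(2,3)])
  show "finite K" using assms(1) finite_pieces finite_subset by blast
  show "bit_additive (test_value e)" for e
    by (simp add: bit_additive_def test_value_def value_at_add)
  show "\<alpha> \<in> consistent" if "\<alpha> \<in> K" "\<forall>e\<in>tests. test_value e \<alpha> = 0" for \<alpha>
  proof (rule consistent_if_tests)
    show "\<alpha> \<in> pieces" using that assms by blast
    fix a b assume "(a, b) \<in> tests"
    then have "test_value (a, b) \<alpha> = 0" using that by blast
    then show "value_at {} \<alpha> a = value_at {} \<alpha> b" by (simp add: test_value_def bit_neq_iff)
  qed
  show "test_value e \<alpha> = 0" if "\<alpha> \<in> consistent" "e \<in> tests" for e \<alpha>
    using tests_consistent[of \<alpha> "fst e" "snd e"] that by (simp add: test_value_def)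
qed

lemma consistent_nonempty: "consistent \<noteq> {}"
  using zero_consistent by blast

lemma consistent_subset: "consistent \<subseteq> pieces"
  using consistent_pieces by blast

lemma finite_consistent: "finite consistent"
  using consistent_subset finite_pieces finite_subset by blast

text \<open>First the colouring must avoid F and sample both ends of one of q independent tests. A
  uniform Z then exposes a vector violating that test with probability 1/2, which turns the constant
  3 into 6.\<close>

lemma check_hit:
  assumes K: "K \<subseteq> pieces" "add_closed K" "consistent \<subseteq> K" "card K = 2 ^ q * card consistent" "q \<ge> 1"
    and f: "card F \<le> f" "f \<ge> 1"
  shows "real (card {z\<in>instances n f. \<exists>\<alpha>\<in>K. check z \<alpha> = 1}) \<ge>
    real (card (instances n f)) / (6 * (real (Suc f))\<^sup>2 * (1 / q + 1 / real (Suc f)))"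
proof -
  have cc: "card consistent > 0" using consistent_nonempty finite_consistent by (simp add: card_gt_0_iff)
  obtain es where es: "es \<subseteq> tests" "finite es" "card K = 2 ^ card es * card consistent"
    "\<forall>e\<in>es. \<exists>\<alpha>\<in>K. test_value e \<alpha> = 1"
    "\<forall>e\<in>es. \<forall>e'\<in>es. e \<noteq> e' \<longrightarrow> (\<exists>\<alpha>\<in>K. test_value e \<alpha> \<noteq> test_value e' \<alpha>)"
    using tests_independent[OF K(1-3)] by (elim exE conjE) (rule that; assumption)
  have "(2::nat) ^ card es = 2 ^ q" using es(3) K(4) cc by simp
  then have q: "card es = q" by simp
  define G where "G = {c \<in> colourings n f. (\<forall>v\<in>F. c v \<noteq> 0) \<and> (\<exists>(a, b)\<in>es. c a = 0 \<and> c b = 0)}"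
  have pair: "a \<in> grid n - F \<and> b \<in> grid n - F \<and> a \<noteq> b \<and> (b, a) \<notin> es" if ab_es: "(a, b) \<in> es" for a b
  proof (intro conjI)
    have t: "(a, b) \<in> tests" using ab_es es by blast
    then have "a \<in> live" "b \<in> live" and ab: "a \<noteq> b" by (auto simp: tests_def)
    then show "a \<in> grid n - F" "b \<in> grid n - F" using V_bound by (auto simp: live_def grid_def)
    show "a \<noteq> b" by (rule ab)
    \<comment> \<open>A pair and its reversal are the same functional, while the chosen tests differ
      pairwise.\<close>
    show "(b, a) \<notin> es"
    proof
      assume "(b, a) \<in> es"
      moreover have "(a, b) \<noteq> (b, a)" using ab by simp
      ultimately obtain \<alpha> where "test_value (a, b) \<alpha> \<noteq> test_value (b, a) \<alpha>" using bspec[OF bspec[OF es(5) ab_es], of "(b, a)"] by blast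
      then show False by (simp add: test_value_def add.commute)
    qed
  qed
  have "F \<subseteq> grid n" using F_T T_V V_bound by (auto simp: grid_def)
  then have G: "real (card G) \<ge> real (card (colourings n f)) / (3 * (real (Suc f))\<^sup>2 * (1 / q + 1 / real (Suc f)))"
    unfolding G_def colourings_def q[symmetric]
    using pair_hit_colourings[of "grid n" F f es] f es(2) pair q K(5) by simp
  have half: "real (card {Z \<in> Pow (all_names n). \<exists>\<alpha>\<in>K. check (c, Z) \<alpha> = 1}) \<ge> real (card (Pow (all_names n))) / 2"
    if c: "c \<in> G" for c
  proof -
    obtain a b where ab: "(a, b) \<in> es" "c a = 0" "c b = 0" using c by (auto simp: G_def)
    obtain \<alpha> where \<alpha>: "\<alpha> \<in> K" "test_value (a, b) \<alpha> = 1" using es(4) ab by blast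
    have F0: "zeros n c \<inter> F = {}" using c by (auto simp: G_def zeros_def)
    have "2 * card {Z \<in> Pow (all_names n). functional (zeros n c) Z \<alpha> = 1} = card (Pow (all_names n))"
    proof (rule test_half)
      show "(a, b) \<in> tests" "\<alpha> \<in> pieces" using es ab \<alpha> K by auto
      show "a \<in> zeros n c" "b \<in> zeros n c" using pair[OF ab(1)] ab by (auto simp: zeros_def)
      show "value_at {} \<alpha> a \<noteq> value_at {} \<alpha> b" using \<alpha>(2) by (simp add: test_value_def bit_neq_iff)
    qed (simp_all add: names_subset)
    moreover have "card {Z \<in> Pow (all_names n). functional (zeros n c) Z \<alpha> = 1} \<le>
        card {Z \<in> Pow (all_names n). \<exists>\<alpha>\<in>K. check (c, Z) \<alpha> = 1}"
      using \<alpha>(1) F0 by (intro card_mono) (auto simp: check_def)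
    ultimately show ?thesis by linarith
  qed
  have finG: "finite G" by (simp add: G_def)
  have "real (card (instances n f)) / (6 * (real (Suc f))\<^sup>2 * (1 / q + 1 / real (Suc f))) =
     real (card (colourings n f)) / (3 * (real (Suc f))\<^sup>2 * (1 / q + 1 / real (Suc f))) * (real (card (Pow (all_names n))) / 2)"
    unfolding instances_def card_cartesian_product by simp
  also have "\<dots> \<le> real (card G) * (real (card (Pow (all_names n))) / 2)"
    using G by (intro mult_right_mono) auto
  also have "\<dots> = (\<Sum>c\<in>G. real (card (Pow (all_names n))) / 2)" by simp
  also have "\<dots> \<le> (\<Sum>c\<in>G. real (card {Z \<in> Pow (all_names n). \<exists>\<alpha>\<in>K. check (c, Z) \<alpha> = 1}))"
    by (intro sum_mono half)
  also have "\<dots> = real (card (SIGMA c:G. {Z \<in> Pow (all_names n). \<exists>\<alpha>\<in>K. check (c, Z) \<alpha> = 1}))"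
    using finG by simp
  also have "\<dots> \<le> real (card {z\<in>instances n f. \<exists>\<alpha>\<in>K. check z \<alpha> = 1})"
    by (intro of_nat_mono card_mono) (auto simp: instances_def G_def)
  finally show ?thesis .
qed

text \<open>The initial excess is at most the number of pieces, so the initial potential is at most
  exp(W)/2, while R checks contribute a factor (1 - 1/(12 g^2))^R <= exp(-W).\<close>

lemma elimination_fails:
  assumes f: "card F \<le> f" "f \<ge> 1" and T: "card T \<le> f + 2"
    and W: "2 * potential (real (Suc f)) ((f + 2) * L + f) \<le> exp (real W)" and R: "R \<ge> 12 * (Suc f)\<^sup>2 * W"
  shows "2 * card {zs. set zs \<subseteq> instances n f \<and> length zs = R \<and>
      \<not> {\<alpha>\<in>pieces. \<forall>z\<in>set zs. check z \<alpha> = 0} \<subseteq> consistent} \<le> card (instances n f) ^ R"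
proof -
  let ?p = "(f + 2) * L + f" and ?I = "real (card (instances n f))"
  define g where "g = real (Suc f)"
  have g: "g \<ge> 1" "g\<^sup>2 \<ge> 1" using one_le_power[of g 2] by (simp_all add: g_def)
  have addp: "add_closed pieces" by (simp add: add_closed_def pieces_add)
  obtain es :: "(addr \<times> addr) set" where es: "card pieces = 2 ^ card es * card consistent"
    using tests_independent[OF order_refl addp consistent_subset] by (elim exE conjE) (rule that; assumption)
  have cc: "card consistent > 0" using consistent_nonempty finite_consistent by (simp add: card_gt_0_iff)
  have "(2::nat) ^ card es \<le> 2 ^ card es * card consistent" using cc by simp
  also have "\<dots> \<le> 2 ^ (card T * L + card F)" using card_pieces es by simp
  finally have "card es \<le> card T * L + card F" by simp
  also have "\<dots> \<le> ?p" using f T by (intro add_mono mult_right_mono) auto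
  finally have q: "card es \<le> ?p" .
  then have pot: "potential g (card es) \<le> potential g ?p"
    by (rule potential_mono) (rule g)
  let ?d = "1 / (12 * g\<^sup>2)"
  have "?d \<le> 1" by (subst divide_le_eq_1_pos) (use g(2) in linarith)+
  then have lam: "0 \<le> ?d" "?d \<le> 1" by simp_all
  have "(1 - ?d) ^ R \<le> (1 - ?d) ^ (12 * (Suc f)\<^sup>2 * W)" using R lam by (intro power_decreasing) auto
  also have "\<dots> \<le> exp (- ?d) ^ (12 * (Suc f)\<^sup>2 * W)"
    using exp_ge_add_one_self[of "- ?d"] lam by (intro power_mono) auto
  also have "\<dots> = exp (real (12 * (Suc f)\<^sup>2 * W) * (- ?d))"
    by (simp only: exp_of_nat_mult)
  also have "real (12 * (Suc f)\<^sup>2 * W) * (- ?d) = - real W" using g(1) by (simp add: g_def del: of_nat_Suc)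
  finally have decay: "(1 - ?d) ^ R \<le> exp (- real W)" .
  have "real (card {zs. set zs \<subseteq> instances n f \<and> length zs = R \<and>
      \<not> {\<alpha>\<in>pieces. \<forall>z\<in>set zs. check z \<alpha> = 0} \<subseteq> consistent}) \<le> potential g (card es) * ((1 - ?d) * ?I) ^ R"
    by (rule elimination_count[where K\<^sub>0 = pieces])
      (use finite_pieces finite_consistent consistent_nonempty additive_check check_consistent
         addp consistent_subset es check_hit[OF _ _ _ _ _ f] g in \<open>simp_all only: g_def[symmetric] finite_instances not_False_eq_True\<close>)
  also have "\<dots> = potential g (card es) * (1 - ?d) ^ R * ?I ^ R"
    by (simp add: power_mult_distrib)
  also have "\<dots> \<le> (exp (real W) / 2) * exp (- real W) * ?I ^ R"
    using decay pot W[folded g_def] lam by (intro mult_mono) auto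
  also have "\<dots> = ?I ^ R / 2" by (simp add: exp_minus)
  finally show ?thesis by (simp flip: of_nat_power)
qed

end

section \<open>Inner products from prefix sums\<close>

text \<open>Abel summation: the prefix sums of \<open>\<delta>\<close> vanish at every place where
  \<open>\<alpha>\<close> may jump, and so does the total.\<close>

lemma sum_constant_on_runs:
  fixes \<delta> \<alpha> :: "nat \<Rightarrow> bit"
  assumes whole: "(\<Sum>i<l. \<delta> i) = 0"
    and cut: "\<And>i. i < l \<Longrightarrow> i \<in> F \<Longrightarrow> (\<Sum>i'<i. \<delta> i') = 0 \<and> (\<Sum>i'<Suc i. \<delta> i') = 0"
    and run: "\<And>i. Suc i < l \<Longrightarrow> i \<notin> F \<Longrightarrow> Suc i \<notin> F \<Longrightarrow> \<alpha> i = \<alpha> (Suc i)"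
  shows "(\<Sum>i<l. \<delta> i * \<alpha> i) = 0"
proof -
  have *: "Suc k \<le> l \<Longrightarrow> (\<Sum>i<Suc k. \<delta> i * \<alpha> i) = (\<Sum>i<Suc k. \<delta> i) * \<alpha> k" for k
  proof (induction k)
    case (Suc k)
    have "(\<Sum>i<Suc k. \<delta> i) * \<alpha> k = (\<Sum>i<Suc k. \<delta> i) * \<alpha> (Suc k)"
    proof (cases "k \<in> F \<or> Suc k \<in> F")
      case True
      then have "(\<Sum>i<Suc k. \<delta> i) = 0" using cut[of k] cut[of "Suc k"] Suc.prems by auto
      then show ?thesis by simp
    next
      case False
      then show ?thesis using run[of k] Suc.prems by auto
    qed
    then show ?case using Suc by (simp add: distrib_right)
  qed simp
  show ?thesis
    using *[of "l - 1"] whole by (cases l) auto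
qed

section \<open>Label format and decoder\<close>

text \<open>An entry describes a path: its name, its length, the neighbours of its cluster, and for
  each copy the smallness flag with, per instance, the path total and the representative. A label
  holds the address and colour of a vertex, the prefix sums before and through it per copy and
  instance, and the entries of all clusters containing it. A seed lists for each copy the colour
  class used as S and the instances.\<close>

type_synonym entry = "nat \<times> nat \<times> addr list \<times> (bool \<times> (bit \<times> addr option) list) list"
type_synonym label = "addr \<times> nat \<times> (bit \<times> bit) list list \<times> entry list"
type_synonym seed = "(nat \<times> ((addr \<Rightarrow> nat) \<times> name set) list) list"

definition seen_vertices :: "entry set \<Rightarrow> addr set \<Rightarrow> addr set" where
  "seen_vertices T F = {(c, i) |c i. \<exists>l ns ps. (c, l, ns, ps) \<in> T \<and> i < l} - F"

definition seen_pieces :: "addr set \<Rightarrow> (addr \<Rightarrow> bit) set" where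
  "seen_pieces Q = {\<alpha>. (\<forall>v. v \<notin> Q \<longrightarrow> \<alpha> v = 0) \<and> (\<forall>c i. (c, i) \<in> Q \<and> (c, Suc i) \<in> Q \<longrightarrow> \<alpha> (c, i) = \<alpha> (c, Suc i))}"

definition seen_shortcuts :: "entry set \<Rightarrow> nat \<Rightarrow> addr set \<Rightarrow> name set" where
  "seen_shortcuts T k R = {(a, b, Some c) |a b c. \<exists>l ns ps. (c, l, ns, ps) \<in> T \<and> fst (ps ! k) \<and>
     a \<in> set ns \<inter> R \<and> b \<in> set ns \<inter> R}"

text \<open>The true mass on touched paths is unknown to the decoder. It may use any M with the
  recorded path totals and prefix sums at failed vertices, since all of these give the same inner
  product (\<open>sum_matching_mass\<close>).\<close>

definition passes :: "nat \<Rightarrow> (addr \<Rightarrow> nat) \<times> name set \<Rightarrow> entry set \<Rightarrow> label set \<Rightarrow> nat \<Rightarrow> nat \<Rightarrow> (addr \<Rightarrow> bit) \<Rightarrow> bool" where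
  "passes n z T F k j \<alpha> \<longleftrightarrow> (\<exists>M.
     (\<forall>(c, l, ns, ps)\<in>T. (\<Sum>i<l. M (c, i)) = fst (snd (ps ! k) ! j)) \<and>
     (\<forall>(v, x, pre, es)\<in>F. (\<Sum>i<snd v. M (fst v, i)) = fst (pre ! k ! j) \<and>
        (\<Sum>i<Suc (snd v). M (fst v, i)) = snd (pre ! k ! j)) \<and>
     (\<Sum>v\<in>seen_vertices T (fst ` F). M v * \<alpha> v) +
     (\<Sum>(c, l, ns, ps)\<in>T. fst (snd (ps ! k) ! j) * (case snd (snd (ps ! k) ! j) of None \<Rightarrow> 0 | Some x \<Rightarrow> \<alpha> x)) +
     (\<Sum>e\<in>seen_shortcuts T k (zeros n (fst z)) \<inter> snd z. \<alpha> (fst e) + \<alpha> (fst (snd e))) = 0)"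

text \<open>A copy is usable if no failed vertex has its colour. Consistent vectors survive all
  checks of a usable copy, so leftover spurious vectors can spoil a positive answer but never
  produce a wrong one.\<close>

definition decode :: "nat \<Rightarrow> seed \<Rightarrow> label \<Rightarrow> label \<Rightarrow> label set \<Rightarrow> bool" where
  "decode n \<omega> ls lt F \<longleftrightarrow> fst ls \<notin> fst ` F \<and> fst lt \<notin> fst ` F \<and>
     (let T = (\<Union>l\<in>insert ls (insert lt F). set (snd (snd (snd l)))) in
      \<exists>k<length \<omega>. (\<forall>l\<in>F. fst (snd l) \<noteq> fst (\<omega> ! k)) \<and>
        (\<forall>\<alpha>\<in>seen_pieces (seen_vertices T (fst ` F)).
           (\<forall>j<length (snd (\<omega> ! k)). zeros n (fst (snd (\<omega> ! k) ! j)) \<inter> fst ` F = {} \<longrightarrow>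
              passes n (snd (\<omega> ! k) ! j) T F k j \<alpha>) \<longrightarrow>
           \<alpha> (fst ls) = \<alpha> (fst lt)))"

context cluster_graph begin

definition path_length :: "nat \<Rightarrow> nat" where
  "path_length c = card {i. (c, i) \<in> V}"

lemma path_length: "(c, i) \<in> V \<longleftrightarrow> i < path_length c"
proof -
  define I where "I = {i. (c, i) \<in> V}"
  have I: "(c, i) \<in> V \<longleftrightarrow> i \<in> I" for i by (simp add: I_def)
  have "I \<subseteq> snd ` V" by (force simp: I_def)
  then have fin: "finite I" by (rule finite_subset) simp
  have down: "j \<in> I" if "i \<in> I" "j \<le> i" for i j
    using that(2,1) by (induction rule: inc_induct) (use path_down I in blast)+
  have "card I \<notin> I"
  proof
    assume "card I \<in> I"
    then have "{..card I} \<subseteq> I" using down by blast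
    then have "card {..card I} \<le> card I" by (rule card_mono[OF fin])
    then show False by simp
  qed
  then have "I \<subseteq> {..<card I}" using down by (metis lessThan_iff not_less subsetI)
  then have "I = {..<card I}" by (intro card_subset_eq) simp_all
  then have "i \<in> I \<longleftrightarrow> i < card I" by blast
  moreover have "path_length c = card I" by (simp only: path_length_def I_def)
  ultimately show ?thesis using I[of i] by (simp only:)
qed

end

context scheme begin

lemma path_total_eq: "path_total R Z c = (\<Sum>i<path_length c. mass R Z (c, i))"
proof -
  have "path_total R Z c = (\<Sum>v\<in>Pair c ` {..<path_length c}. mass R Z v)"
    unfolding path_total_def by (intro sum.cong) (auto simp: path_length)
  also have "\<dots> = (\<Sum>i<path_length c. mass R Z (c, i))"
    by (subst sum.reindex) (auto simp: inj_on_def)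
  finally show ?thesis .
qed

end

context query begin

lemma pieces_zero: "\<alpha> \<in> pieces \<Longrightarrow> v \<notin> Q \<Longrightarrow> \<alpha> v = 0"
  unfolding pieces_def by blast

text \<open>Apply \<open>sum_constant_on_runs\<close> on each touched path to the difference of M
  and the true mass, cutting the path at its failed vertices.\<close>

lemma sum_matching_mass:
  assumes \<alpha>: "\<alpha> \<in> pieces"
    and tot: "\<And>c. c \<in> H \<Longrightarrow> touched c \<Longrightarrow> (\<Sum>i<path_length c. M (c, i)) = path_total R Z c"
    and pre: "\<And>v. v \<in> F \<Longrightarrow> (\<Sum>i<snd v. M (fst v, i)) = (\<Sum>i<snd v. mass R Z (fst v, i)) \<and>
      (\<Sum>i<Suc (snd v). M (fst v, i)) = (\<Sum>i<Suc (snd v). mass R Z (fst v, i))"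
  shows "(\<Sum>v\<in>Q. M v * \<alpha> v) = (\<Sum>v\<in>Q. mass R Z v * \<alpha> v)"
proof -
  let ?\<delta> = "\<lambda>v. M v + mass R Z v"
  have Qsum: "(\<Sum>v\<in>Q. ?\<delta> v * \<alpha> v) = (\<Sum>c | c \<in> H \<and> touched c. \<Sum>i<path_length c. ?\<delta> (c, i) * \<alpha> (c, i))"
  proof -
    have "(\<Sum>v\<in>Q. ?\<delta> v * \<alpha> v) = (\<Sum>v\<in>(SIGMA c:{c. c \<in> H \<and> touched c}. {..<path_length c}). ?\<delta> v * \<alpha> v)"
    proof (rule sum.mono_neutral_left)
      show "Q \<subseteq> (SIGMA c:{c. c \<in> H \<and> touched c}. {..<path_length c})"
        unfolding Q_def using path_length fst_H by force
      show "\<forall>v\<in>(SIGMA c:{c. c \<in> H \<and> touched c}. {..<path_length c}) - Q. ?\<delta> v * \<alpha> v = 0"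
        using pieces_zero[OF \<alpha>] by simp
    qed simp
    then show ?thesis by (simp add: sum.Sigma case_prod_beta)
  qed
  have "(\<Sum>i<path_length c. ?\<delta> (c, i) * \<alpha> (c, i)) = 0" if c: "c \<in> H" "touched c" for c
  proof (rule sum_constant_on_runs[where F = "{i. (c, i) \<in> F}"])
    show "(\<Sum>i<path_length c. ?\<delta> (c, i)) = 0" using tot[OF c] by (simp add: sum.distrib path_total_eq)
  next
    fix i assume "i \<in> {i. (c, i) \<in> F}"
    then have "(c, i) \<in> F" by simp
    from pre[OF this] show "(\<Sum>i'<i. ?\<delta> (c, i')) = 0 \<and> (\<Sum>i'<Suc i. ?\<delta> (c, i')) = 0"
      by (simp only: sum.distrib fst_conv snd_conv bit_add_self)
  next
    fix i assume i: "Suc i < path_length c" "i \<notin> {i. (c, i) \<in> F}" "Suc i \<notin> {i. (c, i) \<in> F}"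
    then have "(c, i) \<in> V" "(c, Suc i) \<in> V" by (auto simp: path_length)
    then have "(c, i) \<in> Q" "(c, Suc i) \<in> Q" using i c by (auto simp: Q_def)
    then show "\<alpha> (c, i) = \<alpha> (c, Suc i)" using \<alpha> unfolding pieces_def by blast
  qed
  then have "(\<Sum>v\<in>Q. ?\<delta> v * \<alpha> v) = 0" unfolding Qsum by simp
  then show ?thesis by (simp add: distrib_right sum.distrib bit_neq_iff)
qed

end

section \<open>Correctness of decoding for a clustered graph\<close>

text \<open>The threshold \<open>\<theta>\<close> limits stored neighbour lists. A cluster with more
  neighbours meets all 2f colour classes, so it is never small and its list is never consulted for
  shortcuts.\<close>

locale labelled = cluster_graph +
  fixes colour :: "addr \<Rightarrow> nat" and f \<theta> :: nat
  assumes hit: "c \<in> H \<Longrightarrow> card (nb c) > \<theta> \<Longrightarrow> a < 2 * f \<Longrightarrow> \<exists>x\<in>nb c. colour x = a"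
begin

definition shade :: "nat \<Rightarrow> addr set" where
  "shade a = {v \<in> V. colour v = a}"

definition nb_list :: "nat \<Rightarrow> addr list" where
  "nb_list c = (if card (nb c) \<le> \<theta> then (SOME xs. set xs = nb c \<and> length xs = card (nb c)) else [])"

definition clusters_at :: "addr \<Rightarrow> nat list" where
  "clusters_at v = (SOME cs. set cs = {c \<in> H. v \<in> Cl c} \<and> length cs = card {c \<in> H. v \<in> Cl c})"

definition the_entry :: "seed \<Rightarrow> nat \<Rightarrow> entry" where
  "the_entry \<omega> c = (c, path_length c, nb_list c,
     map (\<lambda>(a, zs). (scheme.small V E Cl (shade a) c,
       map (\<lambda>(col, Z). (scheme.path_total V E Cl (shade a) (zeros n col) Z c, scheme.rep V E Cl (shade a) (zeros n col) c)) zs)) \<omega>)"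

definition the_label :: "seed \<Rightarrow> addr \<Rightarrow> label" where
  "the_label \<omega> v = (v, colour v,
     map (\<lambda>(a, zs). map (\<lambda>(col, Z). (\<Sum>i<snd v. scheme.mass V E Cl (shade a) (zeros n col) Z (fst v, i),
        \<Sum>i<Suc (snd v). scheme.mass V E Cl (shade a) (zeros n col) Z (fst v, i))) zs) \<omega>,
     map (the_entry \<omega>) (clusters_at v))"

lemma exists_list: "finite A \<Longrightarrow> \<exists>xs. set xs = A \<and> length xs = card A"
  by (metis finite_distinct_list distinct_card)

lemma nb_list: "card (nb c) \<le> \<theta> \<Longrightarrow> set (nb_list c) = nb c" "length (nb_list c) \<le> \<theta>" "set (nb_list c) \<subseteq> nb c"
  using someI_ex[OF exists_list[OF finite_nb[of c]]] by (auto simp: nb_list_def)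

lemma clusters_at: "set (clusters_at v) = {c \<in> H. v \<in> Cl c}" "length (clusters_at v) = card {c \<in> H. v \<in> Cl c}"
  using someI_ex[OF exists_list[of "{c \<in> H. v \<in> Cl c}"]] by (auto simp: clusters_at_def)

lemma small_nb_list:
  assumes "c \<in> H" "a < 2 * f" "scheme.small V E Cl (shade a) c"
  shows "set (nb_list c) = nb c"
proof -
  interpret scheme n L V E Cl "shade a" by unfold_locales
  have "card (nb c) \<le> \<theta>"
  proof (rule ccontr)
    assume "\<not> ?thesis"
    then obtain x where "x \<in> nb c" "colour x = a" using hit assms by force
    then have "x \<in> nb c \<inter> shade a" using nb_V by (auto simp: shade_def)
    then show False using assms(3) unfolding small_def by blast
  qed
  then show ?thesis by (rule nb_list)
qed

lemma fst_the_label [simp]: "fst (the_label \<omega> v) = v"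
  by (simp add: the_label_def)

lemma fst_the_entry [simp]: "fst (the_entry \<omega> c) = c"
  by (simp add: the_entry_def)

lemma the_entry_nth:
  assumes "k < length \<omega>" "\<omega> ! k = (a, zs)" "j < length zs"
  shows "the_entry \<omega> c = (c, path_length c, nb_list c, snd (snd (snd (the_entry \<omega> c))))"
    "fst (snd (snd (snd (the_entry \<omega> c))) ! k) = scheme.small V E Cl (shade a) c"
    "snd (snd (snd (snd (the_entry \<omega> c))) ! k) ! j =
       (scheme.path_total V E Cl (shade a) (zeros n (fst (zs ! j))) (snd (zs ! j)) c,
        scheme.rep V E Cl (shade a) (zeros n (fst (zs ! j))) c)"
  using assms by (simp_all add: the_entry_def case_prod_beta)

lemma the_label_nth:
  assumes "k < length \<omega>" "\<omega> ! k = (a, zs)" "j < length zs"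
  shows "fst (snd (snd (the_label \<omega> v))) ! k ! j =
      (\<Sum>i<snd v. scheme.mass V E Cl (shade a) (zeros n (fst (zs ! j))) (snd (zs ! j)) (fst v, i),
       \<Sum>i<Suc (snd v). scheme.mass V E Cl (shade a) (zeros n (fst (zs ! j))) (snd (zs ! j)) (fst v, i))"
  using assms by (simp add: the_label_def case_prod_beta)

text \<open>The entries read off the labels are exactly those of the touched paths. From them the
  decoder rebuilds Q, the touched shortcuts and the representative terms, while the unknown mass
  enters only through an inner product that its recorded sums determine.\<close>

lemma passes_iff:
  assumes F: "F \<subseteq> T" "T \<subseteq> V" "F \<inter> shade a = {}" and a: "a < 2 * f"
    and k: "k < length \<omega>" "\<omega> ! k = (a, zs)" and j: "j < length zs"
    and T': "T' = the_entry \<omega> ` {c \<in> H. query.touched Cl T c}"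
    and \<alpha>: "\<alpha> \<in> query.pieces V Cl F T"
  shows "passes n (zs ! j) T' (the_label \<omega> ` F) k j \<alpha> \<longleftrightarrow>
     query.functional V E Cl (shade a) F T (zeros n (fst (zs ! j))) (snd (zs ! j)) \<alpha> = 0"
proof -
  interpret q: query n L V E Cl "shade a" F T
    using F by unfold_locales
  define R where "R = zeros n (fst (zs ! j))"
  define Z where "Z = snd (zs ! j)"
  define P where "P c = snd (snd (snd (the_entry \<omega> c)))" for c
  note en = the_entry_nth[OF k j, folded R_def Z_def P_def] and la = the_label_nth[OF k j, folded R_def Z_def]
  have T'P: "T' = (\<lambda>c. (c, path_length c, nb_list c, P c)) ` {c \<in> H. q.touched c}"
    unfolding T' using en(1) by simp
  have T'_iff: "(c, l, ns, ps) \<in> T' \<longleftrightarrow> c \<in> H \<and> q.touched c \<and> l = path_length c \<and> ns = nb_list c \<and> ps = P c" for c l ns ps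
    unfolding T'P by blast
  have FF: "fst ` the_label \<omega> ` F = F" by (simp add: image_image)
  have Q: "seen_vertices T' F = q.Q"
  proof -
    have "(\<exists>l ns ps. (c, l, ns, ps) \<in> T' \<and> i < l) \<longleftrightarrow> c \<in> H \<and> q.touched c \<and> i < path_length c" for c i
      unfolding T'_iff by blast
    moreover have "c \<in> H \<and> q.touched c \<and> i < path_length c \<longleftrightarrow> (c, i) \<in> V \<and> q.touched c" for c i
      unfolding path_length[symmetric] using fst_H[of "(c, i)"] by auto
    ultimately show ?thesis unfolding seen_vertices_def q.Q_def by auto
  qed
  have S: "seen_shortcuts T' k R \<inter> Z = {e. e \<in> q.names R \<inter> Z \<and> q.touched_name e}"
  proof -
    have iff: "(\<exists>l ns ps. (c, l, ns, ps) \<in> T' \<and> fst (ps ! k) \<and> x \<in> set ns \<inter> R \<and> y \<in> set ns \<inter> R) \<longleftrightarrow>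
        c \<in> H \<and> q.touched c \<and> q.small c \<and> x \<in> nb c \<inter> R \<and> y \<in> nb c \<inter> R" for c x y
    proof -
      have "(\<exists>l ns ps. (c, l, ns, ps) \<in> T' \<and> fst (ps ! k) \<and> x \<in> set ns \<inter> R \<and> y \<in> set ns \<inter> R) \<longleftrightarrow>
        c \<in> H \<and> q.touched c \<and> q.small c \<and> x \<in> set (nb_list c) \<inter> R \<and> y \<in> set (nb_list c) \<inter> R"
        unfolding T'_iff en(2)[symmetric] by blast
      then show ?thesis using small_nb_list[OF _ a] by blast
    qed
    show ?thesis
      unfolding seen_shortcuts_def iff q.names_def q.touched_name_def by auto
  qed
  have tot: "(\<forall>(c, l, ns, ps)\<in>T'. (\<Sum>i<l. M (c, i)) = fst (snd (ps ! k) ! j)) \<longleftrightarrow>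
      (\<forall>c\<in>H. q.touched c \<longrightarrow> (\<Sum>i<path_length c. M (c, i)) = q.path_total R Z c)" for M
  proof -
    have "(\<Sum>i<path_length c. M (c, i)) = fst (snd (P c ! k) ! j) \<longleftrightarrow>
        (\<Sum>i<path_length c. M (c, i)) = q.path_total R Z c" for c
      by (simp add: en(3))
    then show ?thesis unfolding T'P by auto
  qed
  have pre: "(\<forall>(v, x, pre, es)\<in>the_label \<omega> ` F. (\<Sum>i<snd v. M (fst v, i)) = fst (pre ! k ! j) \<and>
        (\<Sum>i<Suc (snd v). M (fst v, i)) = snd (pre ! k ! j)) \<longleftrightarrow>
      (\<forall>v\<in>F. (\<Sum>i<snd v. M (fst v, i)) = (\<Sum>i<snd v. q.mass R Z (fst v, i)) \<and>
      (\<Sum>i<Suc (snd v). M (fst v, i)) = (\<Sum>i<Suc (snd v). q.mass R Z (fst v, i)))" for M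
  proof -
    have "(case the_label \<omega> v of (v, x, pre, es) \<Rightarrow> (\<Sum>i<snd v. M (fst v, i)) = fst (pre ! k ! j) \<and>
        (\<Sum>i<Suc (snd v). M (fst v, i)) = snd (pre ! k ! j)) \<longleftrightarrow>
      (\<Sum>i<snd v. M (fst v, i)) = (\<Sum>i<snd v. q.mass R Z (fst v, i)) \<and>
      (\<Sum>i<Suc (snd v). M (fst v, i)) = (\<Sum>i<Suc (snd v). q.mass R Z (fst v, i))" for v
    proof -
      obtain x pr es where L: "the_label \<omega> v = (v, x, pr, es)" by (simp add: the_label_def)
      have "pr ! k ! j = (\<Sum>i<snd v. q.mass R Z (fst v, i), \<Sum>i<Suc (snd v). q.mass R Z (fst v, i))"
        using la[of v] by (simp only: L fst_conv snd_conv)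
      then show ?thesis by (simp only: L case_prod_conv fst_conv snd_conv)
    qed
    then show ?thesis unfolding Ball_image_comp o_def by (simp only:)
  qed
  have reps: "(\<Sum>(c, l, ns, ps)\<in>T'. fst (snd (ps ! k) ! j) * (case snd (snd (ps ! k) ! j) of None \<Rightarrow> 0 | Some x \<Rightarrow> \<alpha> x)) =
     (\<Sum>c | c \<in> H \<and> q.touched c. q.path_total R Z c * (case q.rep R c of None \<Rightarrow> 0 | Some x \<Rightarrow> \<alpha> x))"
  proof -
    have "inj_on (\<lambda>c. (c, path_length c, nb_list c, P c)) {c \<in> H. q.touched c}"
      by (rule inj_onI) simp
    then show ?thesis unfolding T'P
      by (subst sum.reindex) (simp_all add: en(3))
  qed
  define match where "match M \<longleftrightarrow>
      (\<forall>c\<in>H. q.touched c \<longrightarrow> (\<Sum>i<path_length c. M (c, i)) = q.path_total R Z c) \<and>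
      (\<forall>v\<in>F. (\<Sum>i<snd v. M (fst v, i)) = (\<Sum>i<snd v. q.mass R Z (fst v, i)) \<and>
      (\<Sum>i<Suc (snd v). M (fst v, i)) = (\<Sum>i<Suc (snd v). q.mass R Z (fst v, i)))" for M
  define rest where "rest = (\<Sum>c | c \<in> H \<and> q.touched c. q.path_total R Z c * (case q.rep R c of None \<Rightarrow> 0 | Some x \<Rightarrow> \<alpha> x))"
  define cuts where "cuts = (\<Sum>e | e \<in> q.names R \<inter> Z \<and> q.touched_name e. \<alpha> (fst e) + \<alpha> (fst (snd e)))"
  have "passes n (zs ! j) T' (the_label \<omega> ` F) k j \<alpha> \<longleftrightarrow>
    (\<exists>M. match M \<and> (\<Sum>v\<in>q.Q. M v * \<alpha> v) + rest + cuts = 0)"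
    unfolding passes_def tot pre FF Q reps R_def[symmetric] Z_def[symmetric] S match_def rest_def cuts_def conj_assoc ..
  also have "\<dots> \<longleftrightarrow> (\<Sum>v\<in>q.Q. q.mass R Z v * \<alpha> v) + rest + cuts = 0"
  proof -
    have "match (q.mass R Z)" unfolding match_def by (simp add: q.path_total_eq)
    moreover have "(\<Sum>v\<in>q.Q. M v * \<alpha> v) = (\<Sum>v\<in>q.Q. q.mass R Z v * \<alpha> v)" if "match M" for M
      by (rule q.sum_matching_mass[OF \<alpha>]) (use that in \<open>unfold match_def, blast+\<close>)
    ultimately show ?thesis by metis
  qed
  also have "\<dots> \<longleftrightarrow> q.functional R Z \<alpha> = 0"
    unfolding q.functional_def rest_def cuts_def ..
  finally show ?thesis unfolding R_def Z_def .
qed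

definition recovers :: "addr set \<Rightarrow> addr set \<Rightarrow> nat \<times> ((addr \<Rightarrow> nat) \<times> name set) list \<Rightarrow> bool" where
  "recovers F T c \<longleftrightarrow> shade (fst c) \<inter> F = {} \<and>
     {\<alpha> \<in> query.pieces V Cl F T. \<forall>z\<in>set (snd c). query.check n V E Cl (shade (fst c)) F T z \<alpha> = 0}
       \<subseteq> query.consistent V E Cl F T"

text \<open>If s and t are disconnected, a consistent vector separating them passes every check and
  refutes every usable copy. If they are connected, a recovering copy leaves only consistent
  vectors, which agree on s and t.\<close>

lemma decode_correct:
  assumes st: "s \<in> V" "t \<in> V" and F: "F \<subseteq> V" and \<omega>: "\<forall>c\<in>set \<omega>. fst c < 2 * f"
    and rec: "\<exists>c\<in>set \<omega>. recovers F (insert s (insert t F)) c"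
  shows "decode n \<omega> (the_label \<omega> s) (the_label \<omega> t) (the_label \<omega> ` F) \<longleftrightarrow>
    s \<notin> F \<and> t \<notin> F \<and> conn E (V - F) s t"
proof (cases "s \<in> F \<or> t \<in> F")
  case True
  then show ?thesis by (auto simp: decode_def image_image)
next
  case False
  define T where "T = insert s (insert t F)"
  have FT: "F \<subseteq> T" "T \<subseteq> V" using st F by (auto simp: T_def)
  \<comment> \<open>\<open>touched\<close>, \<open>Q\<close>, \<open>pieces\<close> and
    \<open>consistent\<close> do not mention S, so this instance with empty S speaks about all
    copies at once.\<close>
  interpret q0: query n L V E Cl "{}" F T using FT by unfold_locales auto
  have FF: "fst ` the_label \<omega> ` F = F" by (simp add: image_image)
  define T' where "T' = (\<Union>l\<in>insert (the_label \<omega> s) (insert (the_label \<omega> t) (the_label \<omega> ` F)). set (snd (snd (snd l))))"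
  have T': "T' = the_entry \<omega> ` {c \<in> H. q0.touched c}"
  proof -
    have "T' = (\<Union>v\<in>T. the_entry \<omega> ` {c \<in> H. v \<in> Cl c})"
      unfolding T'_def T_def by (simp add: the_label_def clusters_at)
    also have "\<dots> = the_entry \<omega> ` {c \<in> H. q0.touched c}"
      unfolding q0.touched_def by blast
    finally show ?thesis .
  qed
  have sQ: "s \<in> q0.Q" "t \<in> q0.Q"
    using False st q0.touched_self[of s] q0.touched_self[of t] unfolding q0.Q_def by (simp_all add: T_def)
  have Qv: "seen_pieces (seen_vertices T' F) = q0.pieces"
  proof -
    have "seen_vertices T' F = q0.Q"
    proof -
      have "(\<exists>l ns ps. (c, l, ns, ps) \<in> T' \<and> i < l) \<longleftrightarrow> (c, i) \<in> V \<and> q0.touched c" for c i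
      proof -
        have "(\<exists>l ns ps. (c, l, ns, ps) \<in> T' \<and> i < l) \<longleftrightarrow> c \<in> H \<and> q0.touched c \<and> i < path_length c"
          unfolding T' by (auto simp: the_entry_def)
        then show ?thesis unfolding path_length[symmetric] using fst_H[of "(c, i)"] by auto
      qed
      then show ?thesis unfolding seen_vertices_def q0.Q_def by auto
    qed
    then show ?thesis unfolding seen_pieces_def q0.pieces_def by simp
  qed
  have good: "(\<forall>l\<in>the_label \<omega> ` F. fst (snd l) \<noteq> a) \<longleftrightarrow> F \<inter> shade a = {}" for a
    using F by (auto simp: the_label_def shade_def)
  have valid: "(\<forall>j<length (snd (\<omega> ! k)). zeros n (fst (snd (\<omega> ! k) ! j)) \<inter> F = {} \<longrightarrow>
        passes n (snd (\<omega> ! k) ! j) T' (the_label \<omega> ` F) k j \<alpha>) \<longleftrightarrow>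
      (\<forall>z\<in>set (snd (\<omega> ! k)). query.check n V E Cl (shade (fst (\<omega> ! k))) F T z \<alpha> = 0)"
    if k: "k < length \<omega>" "F \<inter> shade (fst (\<omega> ! k)) = {}" and \<alpha>: "\<alpha> \<in> q0.pieces" for k \<alpha>
  proof -
    interpret q: query n L V E Cl "shade (fst (\<omega> ! k))" F T using FT k by unfold_locales auto
    have "(zeros n (fst (snd (\<omega> ! k) ! j)) \<inter> F = {} \<longrightarrow> passes n (snd (\<omega> ! k) ! j) T' (the_label \<omega> ` F) k j \<alpha>) \<longleftrightarrow>
      q.check (snd (\<omega> ! k) ! j) \<alpha> = 0" if j: "j < length (snd (\<omega> ! k))" for j
      unfolding q.check_def using passes_iff[OF FT k(2) _ k(1) _ j T' \<alpha>] \<omega> k(1) by simp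
    then show ?thesis unfolding all_set_conv_all_nth by blast
  qed
  have "decode n \<omega> (the_label \<omega> s) (the_label \<omega> t) (the_label \<omega> ` F) \<longleftrightarrow>
     (\<exists>k<length \<omega>. F \<inter> shade (fst (\<omega> ! k)) = {} \<and> (\<forall>\<alpha>\<in>q0.pieces.
        (\<forall>z\<in>set (snd (\<omega> ! k)). query.check n V E Cl (shade (fst (\<omega> ! k))) F T z \<alpha> = 0) \<longrightarrow> \<alpha> s = \<alpha> t))"
  proof -
    have "decode n \<omega> (the_label \<omega> s) (the_label \<omega> t) (the_label \<omega> ` F) \<longleftrightarrow>
     (\<exists>k<length \<omega>. F \<inter> shade (fst (\<omega> ! k)) = {} \<and> (\<forall>\<alpha>\<in>q0.pieces.
        (\<forall>j<length (snd (\<omega> ! k)). zeros n (fst (snd (\<omega> ! k) ! j)) \<inter> F = {} \<longrightarrow>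
          passes n (snd (\<omega> ! k) ! j) T' (the_label \<omega> ` F) k j \<alpha>) \<longrightarrow> \<alpha> s = \<alpha> t))"
      unfolding decode_def Let_def T'_def[symmetric] FF Qv fst_the_label good using False by simp
    also have "\<dots> \<longleftrightarrow> (\<exists>k<length \<omega>. F \<inter> shade (fst (\<omega> ! k)) = {} \<and> (\<forall>\<alpha>\<in>q0.pieces.
        (\<forall>z\<in>set (snd (\<omega> ! k)). query.check n V E Cl (shade (fst (\<omega> ! k))) F T z \<alpha> = 0) \<longrightarrow> \<alpha> s = \<alpha> t))"
      by (intro ex_cong1 conj_cong refl ball_cong imp_cong) (rule valid; assumption)
    finally show ?thesis .
  qed
  also have "\<dots> \<longleftrightarrow> conn E (V - F) s t"
  proof
    assume "\<exists>k<length \<omega>. F \<inter> shade (fst (\<omega> ! k)) = {} \<and> (\<forall>\<alpha>\<in>q0.pieces.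
        (\<forall>z\<in>set (snd (\<omega> ! k)). query.check n V E Cl (shade (fst (\<omega> ! k))) F T z \<alpha> = 0) \<longrightarrow> \<alpha> s = \<alpha> t)"
    then obtain k where k: "F \<inter> shade (fst (\<omega> ! k)) = {}" "\<And>\<alpha>. \<alpha> \<in> q0.pieces \<Longrightarrow>
        (\<forall>z\<in>set (snd (\<omega> ! k)). query.check n V E Cl (shade (fst (\<omega> ! k))) F T z \<alpha> = 0) \<Longrightarrow> \<alpha> s = \<alpha> t"
      by blast
    interpret q: query n L V E Cl "shade (fst (\<omega> ! k))" F T using FT k by unfold_locales auto
    show "conn E (V - F) s t"
    proof (rule ccontr)
      assume "\<not> ?thesis"
      then obtain \<alpha> where "\<alpha> \<in> q.consistent" "\<alpha> s \<noteq> \<alpha> t" using q.separating_exists[OF sQ] by blast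
      then show False using k(2)[of \<alpha>] q.check_consistent q.consistent_pieces by blast
    qed
  next
    assume conn: "conn E (V - F) s t"
    obtain c where "c \<in> set \<omega>" "recovers F T c" using rec by (auto simp: T_def)
    then obtain k where k: "k < length \<omega>" "recovers F T (\<omega> ! k)" by (metis in_set_conv_nth)
    have "\<alpha> s = \<alpha> t" if "\<alpha> \<in> q0.pieces"
      "\<forall>z\<in>set (snd (\<omega> ! k)). query.check n V E Cl (shade (fst (\<omega> ! k))) F T z \<alpha> = 0" for \<alpha>
      using q0.consistentD[OF _ sQ conn, of \<alpha>] k(2) that unfolding recovers_def by blast
    moreover have "F \<inter> shade (fst (\<omega> ! k)) = {}" using k(2) unfolding recovers_def by blast
    ultimately show "\<exists>k<length \<omega>. F \<inter> shade (fst (\<omega> ! k)) = {} \<and> (\<forall>\<alpha>\<in>q0.pieces.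
        (\<forall>z\<in>set (snd (\<omega> ! k)). query.check n V E Cl (shade (fst (\<omega> ! k))) F T z \<alpha> = 0) \<longrightarrow> \<alpha> s = \<alpha> t)"
      using k(1) by blast
  qed
  finally show ?thesis using False by simp
qed

end

section \<open>Failure probability over the seeds\<close>

definition copies :: "nat \<Rightarrow> nat \<Rightarrow> nat \<Rightarrow> (nat \<times> ((addr \<Rightarrow> nat) \<times> name set) list) set" where
  "copies n f R = {..<2 * f} \<times> {zs. set zs \<subseteq> instances n f \<and> length zs = R}"

definition seeds :: "nat \<Rightarrow> nat \<Rightarrow> nat \<Rightarrow> nat \<Rightarrow> seed set" where
  "seeds n f R m = {\<omega>. set \<omega> \<subseteq> copies n f R \<and> length \<omega> = m}"

lemma finite_copies [simp]: "finite (copies n f R)"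
  by (simp add: copies_def finite_lists_length_eq)

lemma finite_seeds [simp]: "finite (seeds n f R m)"
  by (simp add: seeds_def finite_lists_length_eq)

lemma card_copies: "card (copies n f R) = 2 * f * card (instances n f) ^ R"
  by (simp add: copies_def card_cartesian_product card_lists_length_eq)

lemma card_seeds: "card (seeds n f R m) = card (copies n f R) ^ m"
  by (simp add: seeds_def card_lists_length_eq)

lemma seeds_nonempty: "f \<ge> 1 \<Longrightarrow> seeds n f R m \<noteq> {}"
proof -
  assume "f \<ge> 1"
  then have "card (seeds n f R m) \<noteq> 0"
    using instances_nonempty[of n f] by (simp add: card_seeds card_copies card_gt_0_iff)
  then show ?thesis by force
qed

context labelled begin

text \<open>At most f of the 2f colour classes meet F, and for each of the others at most half of
  the instance lists fail, so the failing fraction is at most 1/2 + 1/4.\<close>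

lemma card_bad_copies:
  assumes F: "F \<subseteq> V" "card F \<le> f" and f: "f \<ge> 1" and st: "s \<in> V" "t \<in> V"
    and W: "2 * potential (real (Suc f)) ((f + 2) * L + f) \<le> exp (real W)" and R: "R \<ge> 12 * (Suc f)\<^sup>2 * W"
  shows "4 * card {c \<in> copies n f R. \<not> recovers F (insert s (insert t F)) c} \<le> 3 * card (copies n f R)"
proof -
  define T where "T = insert s (insert t F)"
  define N where "N = card (instances n f) ^ R"
  define ZS where "ZS = {zs. set zs \<subseteq> instances n f \<and> length zs = R}"
  define A where "A = {a\<in>{..<2 * f}. shade a \<inter> F \<noteq> {}}"
  have finF: "finite F" by (rule finite_subset[OF F(1) finite_V])
  have cT: "card T \<le> f + 2"
    unfolding T_def using F(2) card_insert_le_m1[of "f + 2" "insert t F" s] card_insert_le_m1[of "f + 1" F t] by simp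
  have ZS: "finite ZS" "card ZS = N" unfolding ZS_def N_def by (simp_all add: finite_lists_length_eq card_lists_length_eq)
  have "A \<subseteq> colour ` F" by (auto simp: A_def shade_def)
  then have cA: "card A \<le> f" using card_mono[OF finite_imageI[OF finF]] card_image_le[OF finF] F(2) by (meson le_trans)
  have A: "A \<subseteq> {..<2 * f}" "finite A" by (auto simp: A_def)
  have half: "2 * card {zs\<in>ZS. \<not> recovers F T (a, zs)} \<le> N" if a: "a \<in> {..<2 * f} - A" for a
  proof -
    have sF: "shade a \<inter> F = {}" using a by (auto simp: A_def)
    interpret q: query n L V E Cl "shade a" F T
      using F st sF by unfold_locales (auto simp: T_def)
    have "{zs\<in>ZS. \<not> recovers F T (a, zs)} = {zs. set zs \<subseteq> instances n f \<and> length zs = R \<and>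
      \<not> {\<alpha>\<in>q.pieces. \<forall>z\<in>set zs. q.check z \<alpha> = 0} \<subseteq> q.consistent}"
      using sF by (auto simp: ZS_def recovers_def)
    then show ?thesis using q.elimination_fails[OF F(2) f cT W R] by (simp add: N_def)
  qed
  have "{c \<in> copies n f R. \<not> recovers F T c} = (SIGMA a:{..<2 * f}. {zs\<in>ZS. \<not> recovers F T (a, zs)})"
    by (auto simp: copies_def ZS_def)
  then have "2 * card {c \<in> copies n f R. \<not> recovers F T c} = (\<Sum>a<2 * f. 2 * card {zs\<in>ZS. \<not> recovers F T (a, zs)})"
    using ZS by (simp add: sum_distrib_left)
  also have "\<dots> = (\<Sum>a\<in>{..<2 * f} - A. 2 * card {zs\<in>ZS. \<not> recovers F T (a, zs)}) + (\<Sum>a\<in>A. 2 * card {zs\<in>ZS. \<not> recovers F T (a, zs)})"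
    using A by (intro sum.subset_diff) auto
  also have "\<dots> \<le> (\<Sum>a\<in>{..<2 * f} - A. N) + (\<Sum>a\<in>A. 2 * N)"
    using half ZS by (intro add_mono sum_mono) (auto intro: card_mono)
  also have "\<dots> = (2 * f - card A) * N + card A * (2 * N)"
    using A by (simp add: card_Diff_subset)
  also have "\<dots> = (2 * f + card A) * N"
    using cA by (simp add: algebra_simps diff_mult_distrib)
  also have "\<dots> \<le> (3 * f) * N" using cA by (intro mult_right_mono) auto
  finally have "4 * card {c \<in> copies n f R. \<not> recovers F T c} \<le> 3 * (2 * f * N)" by (simp add: mult_ac)
  then show ?thesis by (simp add: card_copies N_def T_def)
qed

text \<open>An error requires that all m independent copies fail.\<close>

lemma card_bad_seeds:
  assumes F: "F \<subseteq> V" "card F \<le> f" and f: "f \<ge> 1" and st: "s \<in> V" "t \<in> V"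
    and W: "2 * potential (real (Suc f)) ((f + 2) * L + f) \<le> exp (real W)" and R: "R \<ge> 12 * (Suc f)\<^sup>2 * W"
  shows "real (card {\<omega> \<in> seeds n f R m. \<not> (decode n \<omega> (the_label \<omega> s) (the_label \<omega> t) (the_label \<omega> ` F) \<longleftrightarrow>
    s \<notin> F \<and> t \<notin> F \<and> conn E (V - F) s t)}) \<le> (3 / 4) ^ m * card (seeds n f R m)"
proof -
  let ?B = "{c \<in> copies n f R. \<not> recovers F (insert s (insert t F)) c}"
  have "{\<omega> \<in> seeds n f R m. \<not> (decode n \<omega> (the_label \<omega> s) (the_label \<omega> t) (the_label \<omega> ` F) \<longleftrightarrow>
    s \<notin> F \<and> t \<notin> F \<and> conn E (V - F) s t)} \<subseteq> {\<omega>. set \<omega> \<subseteq> ?B \<and> length \<omega> = m}"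
  proof (rule subsetI)
    fix \<omega> assume \<omega>: "\<omega> \<in> {\<omega> \<in> seeds n f R m. \<not> (decode n \<omega> (the_label \<omega> s) (the_label \<omega> t) (the_label \<omega> ` F) \<longleftrightarrow>
      s \<notin> F \<and> t \<notin> F \<and> conn E (V - F) s t)}"
    then have w: "set \<omega> \<subseteq> copies n f R" "length \<omega> = m" by (simp_all add: seeds_def)
    then have "\<forall>c\<in>set \<omega>. fst c < 2 * f" by (auto simp: copies_def)
    then have "\<not> (\<exists>c\<in>set \<omega>. recovers F (insert s (insert t F)) c)"
      using decode_correct[OF st F(1)] \<omega> by blast
    then show "\<omega> \<in> {\<omega>. set \<omega> \<subseteq> ?B \<and> length \<omega> = m}" using w by blast
  qed
  then have "card {\<omega> \<in> seeds n f R m. \<not> (decode n \<omega> (the_label \<omega> s) (the_label \<omega> t) (the_label \<omega> ` F) \<longleftrightarrow>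
    s \<notin> F \<and> t \<notin> F \<and> conn E (V - F) s t)} \<le> card {\<omega>. set \<omega> \<subseteq> ?B \<and> length \<omega> = m}"
    by (intro card_mono) (simp_all add: finite_lists_length_eq)
  also have "\<dots> = card ?B ^ m" by (simp add: card_lists_length_eq)
  finally have "real (card {\<omega> \<in> seeds n f R m. \<not> (decode n \<omega> (the_label \<omega> s) (the_label \<omega> t) (the_label \<omega> ` F) \<longleftrightarrow>
    s \<notin> F \<and> t \<notin> F \<and> conn E (V - F) s t)}) \<le> real (card ?B) ^ m"
    by (simp flip: of_nat_power)
  also have "\<dots> \<le> (3 / 4 * real (card (copies n f R))) ^ m"
    using card_bad_copies[OF assms] by (intro power_mono) auto
  finally show ?thesis by (simp only: power_mult_distrib card_seeds of_nat_power)
qed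

end

section \<open>A colouring that hits all large neighbourhoods\<close>

text \<open>Probabilistic method. With g = 2f, a random colouring avoids a given colour on more than
  gW vertices with probability at most (1 - 1/g)^(gW) <= 2^(-W), and fewer than 2^W pairs of cluster
  and colour compete in the union bound.\<close>

lemma hitting_colouring:
  assumes "finite V" "finite H" "card H \<le> n" "n * (2 * f) < 2 ^ W" "f \<ge> 1"
    and "\<And>c. c \<in> H \<Longrightarrow> nb c \<subseteq> V"
  shows "\<exists>colour. (\<forall>v. colour v < 2 * f) \<and>
    (\<forall>c\<in>H. card (nb c) > 2 * f * W \<longrightarrow> (\<forall>a<2 * f. \<exists>x\<in>nb c. colour x = a))"
proof -
  define g where "g = 2 * f"
  define \<theta> where "\<theta> = g * W"
  let ?X = "PiE V (\<lambda>_. {..<g})"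
  define P where "P = {c\<in>H. card (nb c) > \<theta>} \<times> {..<g}"
  define bad where "bad p = {colour\<in>?X. \<forall>x\<in>nb (fst p). colour x \<noteq> snd p}" for p
  have g: "g \<ge> 1" using assms by (simp add: g_def)
  have finX: "finite ?X" using assms by (simp add: finite_PiE)
  have cX: "card ?X = g ^ card V" using assms by (simp add: card_PiE)
  have finP: "finite P" using assms by (simp add: P_def)
  have "card {c\<in>H. card (nb c) > \<theta>} \<le> card H" using assms by (intro card_mono) auto
  then have cP: "card P \<le> n * g" using assms(3) by (simp add: P_def card_cartesian_product)
  have cbad: "real (card (bad p)) \<le> (1 - 1 / real g) ^ \<theta> * real g ^ card V" if p: "p \<in> P" for p
  proof -
    obtain c a where p': "p = (c, a)" by (cases p)
    then have c: "c \<in> H" "card (nb c) > \<theta>" "a < g" using p by (auto simp: P_def)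
    have nV: "nb c \<subseteq> V" using assms c by auto
    have "bad p \<subseteq> PiE V (\<lambda>v. if v \<in> nb c then {..<g} - {a} else {..<g})"
      using nV by (auto simp: bad_def p' PiE_def Pi_iff)
    moreover have "finite (PiE V (\<lambda>v. if v \<in> nb c then {..<g} - {a} else {..<g}))"
      using assms by (intro finite_PiE) auto
    ultimately have "card (bad p) \<le> card (PiE V (\<lambda>v. if v \<in> nb c then {..<g} - {a} else {..<g}))"
      by (rule card_mono[rotated])
    also have "\<dots> = (\<Prod>v\<in>V. card (if v \<in> nb c then {..<g} - {a} else {..<g}))"
      using assms by (simp add: card_PiE)
    also have "\<dots> = (\<Prod>v\<in>V. if v \<in> nb c then g - 1 else g)"
      using c by (intro prod.cong) auto
    also have "\<dots> = (g - 1) ^ card (nb c) * g ^ card (V - nb c)"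
      using assms nV by (simp add: prod.If_cases Int_absorb1 Diff_eq Collect_neg_eq)
    also have "card (V - nb c) = card V - card (nb c)"
      using nV assms(1) by (intro card_Diff_subset) (auto intro: finite_subset)
    finally have "real (card (bad p)) \<le> real ((g - 1) ^ card (nb c) * g ^ (card V - card (nb c)))"
      by (simp only: of_nat_le_iff)
    also have "\<dots> = (1 - 1 / real g) ^ card (nb c) * real g ^ card V"
    proof -
      have "card (nb c) \<le> card V" using nV assms(1) by (rule card_mono[rotated])
      then have "real g ^ card V = real g ^ card (nb c) * real g ^ (card V - card (nb c))"
        by (simp flip: power_add)
      moreover have "(1 - 1 / real g) * real g = real (g - 1)" using g by (simp add: algebra_simps of_nat_diff)
      then have "real (g - 1) ^ card (nb c) = (1 - 1 / real g) ^ card (nb c) * real g ^ card (nb c)"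
        by (simp flip: power_mult_distrib)
      ultimately show ?thesis by simp
    qed
    also have "\<dots> \<le> (1 - 1 / real g) ^ \<theta> * real g ^ card V"
      using c g by (intro mult_right_mono power_decreasing) auto
    finally show ?thesis .
  qed
  have "(1 - 1 / real g) ^ g \<le> exp (- (1 / real g)) ^ g"
    using exp_ge_add_one_self[of "- (1 / real g)"] g by (intro power_mono) auto
  also have "\<dots> = exp (- 1)" using g by (simp flip: exp_of_nat_mult)
  also have "\<dots> \<le> 1 / 2" using exp_ge_add_one_self[of 1] by (simp add: exp_minus field_simps)
  finally have "((1 - 1 / real g) ^ g) ^ W \<le> (1 / 2) ^ W" using g by (intro power_mono) auto
  then have decay: "(1 - 1 / real g) ^ \<theta> \<le> (1 / 2) ^ W" by (simp add: \<theta>_def power_mult)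
  have "real (card (\<Union>p\<in>P. bad p)) \<le> (\<Sum>p\<in>P. real (card (bad p)))"
    using card_UN_le[OF finP, of bad] by (simp flip: of_nat_sum)
  also have "\<dots> \<le> (\<Sum>p\<in>P. (1 / 2) ^ W * real g ^ card V)"
    using cbad decay mult_right_mono[OF decay, of "real g ^ card V"] by (intro sum_mono) (meson order_trans zero_le_power of_nat_0_le_iff)
  also have "\<dots> \<le> real (n * g) * ((1 / 2) ^ W * real g ^ card V)"
    using cP by (simp only: sum_constant, intro mult_right_mono) (auto simp del: of_nat_mult)
  also have "\<dots> < 2 ^ W * ((1 / 2) ^ W * real g ^ card V)"
  proof (rule mult_strict_right_mono)
    have "real (n * g) < real (2 ^ W)" using assms(4) unfolding g_def by (simp only: of_nat_less_iff)
    then show "real (n * g) < 2 ^ W" by simp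
    show "(1 / 2) ^ W * real g ^ card V > 0" using g by simp
  qed
  also have "\<dots> = real (card ?X)" by (simp add: cX power_one_over)
  finally have lt: "card (\<Union>p\<in>P. bad p) < card ?X" by simp
  have "(\<Union>p\<in>P. bad p) \<subseteq> ?X" by (auto simp: bad_def)
  then obtain colour where colour: "colour \<in> ?X" "colour \<notin> (\<Union>p\<in>P. bad p)" using lt by (metis less_irrefl subsetI subset_antisym)
  define colour' where "colour' v = (if v \<in> V then colour v else 0)" for v
  show ?thesis
  proof (intro exI[of _ colour'] conjI allI ballI impI)
    show "colour' v < 2 * f" for v using colour(1) assms(5) by (auto simp: colour'_def g_def PiE_iff)
    fix c a assume c: "c \<in> H" "card (nb c) > 2 * f * W" "a < 2 * f"
    then have "(c, a) \<in> P" by (simp add: P_def g_def \<theta>_def)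
    then have "colour \<notin> bad (c, a)" using colour by blast
    then obtain x where "x \<in> nb c" "colour x = a" using colour(1) by (auto simp: bad_def)
    then show "\<exists>x\<in>nb c. colour' x = a" using assms(6)[OF c(1)] by (intro bexI[of _ x]) (auto simp: colour'_def)
  qed
qed

section \<open>Reducing the number of seeds\<close>

text \<open>Greedy form of Newman's argument: the number of random seeds can be reduced to a polynomial one.\<close>

lemma few_seeds:
  fixes \<epsilon> :: real and M :: nat
  assumes "finite Om" "Om \<noteq> {}" "finite I" "\<epsilon> \<ge> 0"
    and bad: "\<And>i. i \<in> I \<Longrightarrow> real (card {\<omega>\<in>Om. bad i \<omega>}) \<le> \<epsilon> * card Om"
  shows "\<exists>g. (\<forall>l<M. g l \<in> Om) \<and> (\<Sum>i\<in>I. 2 ^ card {l. l < M \<and> bad i (g l)}) \<le> real (card I) * (1 + \<epsilon>) ^ M"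
proof (induction M)
  case 0
  then show ?case by simp
next
  case (Suc M)
  then obtain g where g: "\<forall>l<M. g l \<in> Om" "(\<Sum>i\<in>I. 2 ^ card {l. l < M \<and> bad i (g l)}) \<le> real (card I) * (1 + \<epsilon>) ^ M"
    by blast
  define w where "w i = (2::real) ^ card {l. l < M \<and> bad i (g l)}" for i
  have cO: "real (card Om) > 0" using assms by (simp add: card_gt_0_iff)
  have "(\<Sum>\<omega>\<in>Om. \<Sum>i\<in>I. w i * (1 + of_bool (bad i \<omega>))) = (\<Sum>i\<in>I. \<Sum>\<omega>\<in>Om. w i * (1 + of_bool (bad i \<omega>)))"
    by (rule sum.swap)
  also have "\<dots> = (\<Sum>i\<in>I. w i * (real (card Om) + real (card {\<omega>\<in>Om. bad i \<omega>})))"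
    using assms(1) by (intro sum.cong refl) (simp add: sum_distrib_left[symmetric] sum.distrib of_bool_def sum.If_cases Int_def)
  also have "\<dots> \<le> (\<Sum>i\<in>I. w i * (card Om * (1 + \<epsilon>)))"
    using bad by (intro sum_mono mult_left_mono) (auto simp: w_def algebra_simps)
  also have "\<dots> = (\<Sum>i\<in>I. w i) * (1 + \<epsilon>) * card Om"
    by (simp only: sum_distrib_right[symmetric] mult_ac)
  also have "\<dots> \<le> real (card I) * (1 + \<epsilon>) ^ M * (1 + \<epsilon>) * card Om"
    using g(2) assms(4) unfolding w_def by (intro mult_right_mono) auto
  finally have avg: "(\<Sum>\<omega>\<in>Om. \<Sum>i\<in>I. w i * (1 + of_bool (bad i \<omega>))) \<le> (\<Sum>\<omega>\<in>Om. real (card I) * (1 + \<epsilon>) ^ Suc M)"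
    by (simp add: mult_ac)
  \<comment> \<open>By averaging, some seed lets the exponentially weighted error count grow by a
    factor of at most \<open>1 + \<epsilon>\<close>.\<close>
  obtain \<omega> where \<omega>: "\<omega> \<in> Om" "(\<Sum>i\<in>I. w i * (1 + of_bool (bad i \<omega>))) \<le> real (card I) * (1 + \<epsilon>) ^ Suc M"
  proof (rule ccontr)
    assume "\<not> thesis"
    then have "real (card I) * (1 + \<epsilon>) ^ Suc M < (\<Sum>i\<in>I. w i * (1 + of_bool (bad i \<omega>)))" if "\<omega> \<in> Om" for \<omega>
      using that \<open>\<And>\<omega>. \<omega> \<in> Om \<Longrightarrow> _ \<Longrightarrow> thesis\<close> by (meson not_le)
    then have "(\<Sum>\<omega>\<in>Om. real (card I) * (1 + \<epsilon>) ^ Suc M) < (\<Sum>\<omega>\<in>Om. \<Sum>i\<in>I. w i * (1 + of_bool (bad i \<omega>)))"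
      using assms(1,2) by (intro sum_strict_mono) auto
    then show False using avg by simp
  qed
  have "2 ^ card {l. l < Suc M \<and> bad i ((g(M := \<omega>)) l)} = w i * (1 + of_bool (bad i \<omega>))" for i
  proof -
    have "{l. l < Suc M \<and> bad i ((g(M := \<omega>)) l)} = {l. l < M \<and> bad i (g l)} \<union> (if bad i \<omega> then {M} else {})"
      by (auto simp: less_Suc_eq)
    then show ?thesis by (auto simp: w_def)
  qed
  then show ?case using g(1) \<omega> by (intro exI[of _ "g(M := \<omega>)"]) (auto simp: less_Suc_eq)
qed

text \<open>A single summand is bounded by the whole weighted count; taking logarithms bounds the
  errors of each query. The factor 2 comes from ln 2 >= 1/2.\<close>

lemma few_seeds_bound:
  fixes \<epsilon> :: real and M N :: nat
  assumes "finite Om" "Om \<noteq> {}" "finite I" "card I \<le> 2 ^ N" "\<epsilon> \<ge> 0"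
    and bad: "\<And>i. i \<in> I \<Longrightarrow> real (card {\<omega>\<in>Om. bad i \<omega>}) \<le> \<epsilon> * card Om"
  shows "\<exists>g. (\<forall>l<M. g l \<in> Om) \<and> (\<forall>i\<in>I. real (card {l. l < M \<and> bad i (g l)}) \<le> real N + 2 * \<epsilon> * M)"
proof -
  obtain g where g: "\<forall>l<M. g l \<in> Om" "(\<Sum>i\<in>I. 2 ^ card {l. l < M \<and> bad i (g l)}) \<le> real (card I) * (1 + \<epsilon>) ^ M"
    using few_seeds[OF assms(1-3,5), of bad M] bad by blast
  have "real (card {l. l < M \<and> bad i (g l)}) \<le> real N + 2 * \<epsilon> * M" if i: "i \<in> I" for i
  proof -
    let ?c = "card {l. l < M \<and> bad i (g l)}"
    have "(2::real) ^ ?c \<le> (\<Sum>i\<in>I. 2 ^ card {l. l < M \<and> bad i (g l)})"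
      using assms(3) i by (intro member_le_sum) auto
    also have "\<dots> \<le> real (card I) * (1 + \<epsilon>) ^ M" by (rule g)
    also have "\<dots> \<le> real (2 ^ N) * exp \<epsilon> ^ M"
      using assms(4,5) exp_ge_add_one_self[of \<epsilon>] by (intro mult_mono power_mono of_nat_mono) auto
    finally have "2 ^ ?c \<le> 2 ^ N * exp (M * \<epsilon>)" by (simp add: exp_of_nat_mult)
    then have "ln ((2::real) ^ ?c) \<le> ln (2 ^ N * exp (M * \<epsilon>))" by (subst ln_le_cancel_iff) auto
    then have "?c * ln 2 \<le> N * ln 2 + M * \<epsilon>" by (simp add: ln_mult ln_realpow)
    moreover have "ln (2::real) \<ge> 1 / 2" using ln_le_minus_one[of "1 / 2 :: real"] by (simp add: ln_div)
    then have "M * \<epsilon> \<le> 2 * \<epsilon> * M * ln 2"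
      using mult_left_mono[of "1/2" "ln (2::real)" "2 * \<epsilon> * M"] assms(5) by (simp add: mult.commute)
    ultimately have "?c * ln 2 \<le> (N + 2 * \<epsilon> * M) * ln 2" by (simp add: distrib_right)
    then show ?thesis by (rule mult_right_le_imp_le) simp
  qed
  then show ?thesis using g(1) by blast
qed

section \<open>Transport to addresses\<close>

lemma conn_image:
  assumes "inj_on h V" "E \<subseteq> V \<times> V" "C \<subseteq> V" "u \<in> C" "v \<in> C"
  shows "conn (map_prod h h ` E) (h ` C) (h u) (h v) \<longleftrightarrow> conn E C u v"
proof
  assume "conn E C u v"
  then have "(u, v) \<in> (Restr E C)\<^sup>*" by (simp add: conn_def)
  then have "(h u, h v) \<in> (Restr (map_prod h h ` E) (h ` C))\<^sup>*"
  proof (induction rule: rtrancl_induct)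
    case (step y z)
    have "(h y, h z) \<in> Restr (map_prod h h ` E) (h ` C)" using step(2) by force
    then show ?case using step(3) by (meson rtrancl.rtrancl_into_rtrancl)
  qed simp
  then show "conn (map_prod h h ` E) (h ` C) (h u) (h v)" by (simp add: conn_def)
next
  assume "conn (map_prod h h ` E) (h ` C) (h u) (h v)"
  then have "(h u, h v) \<in> (Restr (map_prod h h ` E) (h ` C))\<^sup>*" by (simp add: conn_def)
  then have "\<exists>x\<in>C. h x = h v \<and> (u, x) \<in> (Restr E C)\<^sup>*"
  proof (induction rule: rtrancl_induct)
    case base then show ?case using assms(4) by blast
  next
    case (step y z)
    then obtain x where x: "x \<in> C" "h x = y" "(u, x) \<in> (Restr E C)\<^sup>*" by blast
    obtain a b where ab: "(a, b) \<in> E" "h a = y" "h b = z" using step(2) by auto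
    obtain b' where b': "b' \<in> C" "h b' = z" using step(2) by auto
    have "a = x" "b = b'" using inj_onD[OF assms(1)] ab x b' assms(2,3) by blast+
    then have "(x, b) \<in> Restr E C" using ab x b' by blast
    then have "(u, b) \<in> (Restr E C)\<^sup>*" by (rule rtrancl.rtrancl_into_rtrancl[OF x(3)])
    then show ?case using ab(3) b'(1) \<open>b = b'\<close> by blast
  qed
  then obtain x where "x \<in> C" "h x = h v" "(u, x) \<in> (Restr E C)\<^sup>*" by blast
  moreover have "x = v" using inj_onD[OF assms(1)] calculation assms(3,5) by blast
  ultimately show "conn E C u v" by (simp add: conn_def)
qed

text \<open>Path and position identify a vertex, so the renaming is injective. Clusters can be
  indexed by the path name because the apex of a path has the same cluster as all vertices on
  it.\<close>

lemma cluster_graph_of_decomposition: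
  assumes "path_decomposition E {..<n} L apex pos K" "sym E" "E \<subseteq> {..<n} \<times> {..<n}"
  defines "h \<equiv> \<lambda>v. (apex v, pos v)"
  shows "inj_on h {..<n}" "cluster_graph n L (h ` {..<n}) (map_prod h h ` E) (\<lambda>c. h ` K c)"
proof -
  interpret P: path_decomposition E "{..<n}" L apex pos K by (rule assms(1))
  let ?V = "{..<n}"
  show inj: "inj_on h ?V" unfolding h_def by (rule inj_onI) (auto intro: P.pos_inj)
  have Kapex: "K (apex v) = K v" if "v \<in> ?V" for v
    using P.K_eq_iff[OF P.apex_in[OF that] that] P.apex_apex[OF that] by simp
  have fsth: "fst (h v) = apex v" for v by (simp add: h_def)
  have Kh: "h ` K (fst (h v)) = h ` K v" if "v \<in> ?V" for v using Kapex[OF that] by (simp add: fsth)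
  have memK: "h u \<in> h ` K v \<longleftrightarrow> u \<in> K v" if "u \<in> ?V" "v \<in> ?V" for u v
    using inj_on_image_mem_iff[OF inj that(1) P.K_subset[OF that(2)]] .
  show "cluster_graph n L (h ` ?V) (map_prod h h ` E) (\<lambda>c. h ` K c)"
  proof
    show "h ` ?V \<subseteq> {..<n} \<times> {..<n}"
      using P.apex_in P.pos_less by (auto simp: h_def)
    show "map_prod h h ` E \<subseteq> h ` ?V \<times> h ` ?V" using assms(3) by auto
    show "sym (map_prod h h ` E)" using assms(2) by (auto simp: sym_def) (metis map_prod_imageI)
  next
    fix x assume "x \<in> h ` ?V"
    then obtain v where v: "v \<in> ?V" "x = h v" by blast
    show "x \<in> h ` K (fst x)" using P.mem_K[OF v(1)] Kh[OF v(1)] v(2) by blast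
    show "h ` K (fst x) \<subseteq> h ` ?V" using P.K_subset[OF v(1)] Kh[OF v(1)] v(2) by blast
    show "conn_set (map_prod h h ` E) (h ` K (fst x))"
      unfolding v(2) Kh[OF v(1)] conn_set_def
    proof (intro ballI)
      fix a b assume "a \<in> h ` K v" "b \<in> h ` K v"
      then obtain a' b' where "a' \<in> K v" "a = h a'" "b' \<in> K v" "b = h b'" by blast
      then show "conn (map_prod h h ` E) (h ` K v) a b"
        using conn_image[OF inj assms(3) P.K_subset[OF v(1)], of a' b'] P.conn_K[OF v(1)]
        unfolding conn_set_def by blast
    qed
    have "{c \<in> fst ` h ` ?V. x \<in> h ` K c} = apex ` {u \<in> ?V. v \<in> K u}"
    proof (intro equalityI subsetI)
      fix c assume "c \<in> {c \<in> fst ` h ` ?V. x \<in> h ` K c}"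
      then obtain u where "u \<in> ?V" "c = apex u" "h v \<in> h ` K u" using v Kapex by (auto simp: fsth)
      then show "c \<in> apex ` {u \<in> ?V. v \<in> K u}" using memK[OF v(1), of u] by blast
    next
      fix c assume "c \<in> apex ` {u \<in> ?V. v \<in> K u}"
      then obtain u where "u \<in> ?V" "c = apex u" "v \<in> K u" by blast
      then show "c \<in> {c \<in> fst ` h ` ?V. x \<in> h ` K c}" using v Kapex[of u] by (force simp: fsth)
    qed
    then show "card {c \<in> fst ` h ` ?V. x \<in> h ` K c} \<le> L" using P.depth[OF v(1)] by simp
  next
    fix x y assume "x \<in> h ` ?V" "y \<in> h ` ?V"
    then obtain u v where uv: "u \<in> ?V" "x = h u" "v \<in> ?V" "y = h v" by blast
    show "h ` K (fst x) \<subseteq> h ` K (fst y)" if "x \<in> h ` K (fst y)"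
    proof -
      have "u \<in> K v" using that memK[OF uv(1,3)] Kh uv by simp
      then show ?thesis using P.K_mono[OF uv(1,3)] Kh uv by (simp add: image_mono)
    qed
    have "h ` (K u \<inter> K v) = h ` K u \<inter> h ` K v"
      using inj_on_image_Int[OF inj P.K_subset[OF uv(1)] P.K_subset[OF uv(3)]] .
    then show "h ` K (fst x) \<inter> h ` K (fst y) = {} \<or> h ` K (fst x) \<subseteq> h ` K (fst y) \<or> h ` K (fst y) \<subseteq> h ` K (fst x)"
      using P.laminar[OF uv(1,3)] Kh[OF uv(1)] Kh[OF uv(3)] uv by (metis image_empty image_mono)
  next
    fix c i assume "(c, Suc i) \<in> h ` ?V"
    then obtain v where v: "v \<in> ?V" "apex v = c" "pos v = Suc i" by (auto simp: h_def)
    then obtain u where "u \<in> ?V" "apex u = c" "pos u = i" "(u, v) \<in> E" using P.path_step by blast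
    moreover have "h u = (c, i)" "h v = (c, Suc i)" using v calculation by (auto simp: h_def)
    ultimately show "(c, i) \<in> h ` ?V \<and> ((c, i), c, Suc i) \<in> map_prod h h ` E"
      by (metis image_eqI map_prod_imageI)
  next
    fix x y assume "(x, y) \<in> map_prod h h ` E"
    then obtain u v where uv: "(u, v) \<in> E" "x = h u" "y = h v" by auto
    then have "u \<in> ?V" "v \<in> ?V" using assms(3) by auto
    then show "x \<in> h ` K (fst y) \<or> y \<in> h ` K (fst x)"
      using P.edge_nested[of u v] uv Kh by (metis imageI)
  qed
qed

lemma path_decomposition_nat:
  fixes n :: nat
  assumes "n < 2 ^ L" "sym E"
  shows "\<exists>apex pos K. path_decomposition E {..<n} L apex pos K"
proof (rule path_decomposition_exists)
  show "\<forall>v\<in>{..<n}. card (component E {..<n} v) < 2 ^ L"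
  proof
    fix v
    have "card (component E {..<n} v) \<le> card {..<n}"
      by (rule card_mono[OF finite_lessThan component_subset])
    then show "card (component E {..<n} v) < 2 ^ L" using assms(1) by simp
  qed
qed (simp_all add: assms)

section \<open>Bounding label lengths by counting\<close>

text \<open>Label length is bounded by counting the possible labels and numbering them, without
  fixing a concrete bit layout.\<close>

definition fits :: "nat \<Rightarrow> 'x set \<Rightarrow> bool" where
  "fits b X \<longleftrightarrow> finite X \<and> card X \<le> 2 ^ b"

lemma fits_Times: "fits a X \<Longrightarrow> fits b Y \<Longrightarrow> fits (a + b) (X \<times> Y)"
  unfolding fits_def by (auto simp: card_cartesian_product power_add intro: mult_mono)

lemma fits_lists_eq: "fits b X \<Longrightarrow> fits (b * m) {xs. set xs \<subseteq> X \<and> length xs = m}"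
  unfolding fits_def by (auto simp: finite_lists_length_eq card_lists_length_eq power_mult intro: power_mono)

text \<open>The extra bit per slot pays for the unknown length of the list.\<close>

lemma fits_lists_le:
  assumes "fits b X"
  shows "fits ((b + 1) * m) {xs. set xs \<subseteq> X \<and> length xs \<le> m}"
proof -
  have "(\<Sum>i\<le>m. ((2::nat) ^ b) ^ i) \<le> 2 ^ ((b + 1) * m)" for m
  proof (induction m)
    case (Suc m)
    have "((2::nat) ^ b) ^ Suc m = 2 ^ (b * m + b)" by (simp add: power_mult power_add mult.commute)
    also have "\<dots> \<le> 2 ^ ((b + 1) * m + b)" by (intro power_increasing) auto
    finally have "((2::nat) ^ b) ^ Suc m \<le> 2 ^ ((b + 1) * m + b)" .
    moreover have "(2::nat) ^ ((b + 1) * m) \<le> 2 ^ ((b + 1) * m + b)" by (intro power_increasing) auto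
    ultimately have "(\<Sum>i\<le>Suc m. ((2::nat) ^ b) ^ i) \<le> 2 * 2 ^ ((b + 1) * m + b)"
      using Suc.IH unfolding sum.atMost_Suc by linarith
    also have "\<dots> = 2 ^ ((b + 1) * Suc m)" by (simp add: power_add algebra_simps)
    finally show ?case .
  qed simp
  moreover have "(\<Sum>i\<le>m. card X ^ i) \<le> (\<Sum>i\<le>m. (2 ^ b) ^ i)"
    using assms by (intro sum_mono power_mono) (auto simp: fits_def)
  ultimately have "(\<Sum>i\<le>m. card X ^ i) \<le> 2 ^ ((b + 1) * m)" by (rule order_trans[rotated])
  moreover have "finite X" using assms by (simp add: fits_def)
  ultimately show ?thesis
    using finite_lists_length_le[of X m] card_lists_length_le[of X m] unfolding fits_def by simp
qed

lemma fits_option: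
  assumes "fits b X" shows "fits (b + 1) (insert None (Some ` X))"
proof -
  have "card (insert None (Some ` X)) = Suc (card X)"
    using assms by (subst card_insert_disjoint) (auto simp: fits_def card_image)
  also have "\<dots> \<le> 2 ^ b + 2 ^ b"
    using assms one_le_power[of "2 :: nat" b] unfolding fits_def by linarith
  finally show ?thesis using assms by (simp add: fits_def)
qed

lemma fits_code:
  assumes "fits b X"
  shows "\<exists>e. inj_on e X \<and> (\<forall>x\<in>X. length (e x :: bool list) = b)"
proof -
  have "card {xs :: bool list. set xs \<subseteq> UNIV \<and> length xs = b} = 2 ^ b"
    by (subst card_lists_length_eq) simp_all
  then have "card X \<le> card {xs :: bool list. length xs = b}" using assms by (simp add: fits_def)
  moreover have "finite {xs :: bool list. length xs = b}" using finite_lists_length_eq[of "UNIV :: bool set" b] by simp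
  ultimately obtain e where "e ` X \<subseteq> {xs :: bool list. length xs = b}" "inj_on e X"
    using card_le_inj[of X "{xs :: bool list. length xs = b}"] assms by (auto simp: fits_def)
  then show ?thesis by (intro exI[of _ e]) blast
qed

definition entries :: "nat \<Rightarrow> nat \<Rightarrow> nat \<Rightarrow> nat \<Rightarrow> entry set" where
  "entries n \<theta> R m = {..<n} \<times> {..n} \<times> {xs. set xs \<subseteq> grid n \<and> length xs \<le> \<theta>} \<times>
     {ps. set ps \<subseteq> UNIV \<times> {ds. set ds \<subseteq> UNIV \<times> insert None (Some ` grid n) \<and> length ds = R} \<and> length ps = m}"

definition labels :: "nat \<Rightarrow> nat \<Rightarrow> nat \<Rightarrow> nat \<Rightarrow> nat \<Rightarrow> nat \<Rightarrow> label set" where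
  "labels n f L \<theta> R m = grid n \<times> {..<2 * f} \<times>
     {ps. set ps \<subseteq> {ds. set ds \<subseteq> UNIV \<and> length ds = R} \<and> length ps = m} \<times>
     {es. set es \<subseteq> entries n \<theta> R m \<and> length es \<le> L}"

definition entry_bits :: "nat \<Rightarrow> nat \<Rightarrow> nat \<Rightarrow> nat \<Rightarrow> nat" where
  "entry_bits L \<theta> R m = L + (L + ((2 * L + 1) * \<theta> + (1 + (1 + (2 * L + 1)) * R) * m))"

definition label_bits :: "nat \<Rightarrow> nat \<Rightarrow> nat \<Rightarrow> nat \<Rightarrow> nat" where
  "label_bits L \<theta> R m = 2 * L + ((L + 1) + (2 * R * m + (entry_bits L \<theta> R m + 1) * L))"

lemma UNIV_bit: "(UNIV :: bit set) = {0, 1}"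
proof -
  have "x \<in> {0, 1}" for x :: bit by (cases x) auto
  then show ?thesis by blast
qed

lemma fits_bit: "fits 1 (UNIV :: bit set)"
  unfolding fits_def UNIV_bit by simp

lemma fits_grid: "n < 2 ^ L \<Longrightarrow> fits (2 * L) (grid n)"
  unfolding mult_2 grid_def by (intro fits_Times) (auto simp: fits_def)

lemma fits_labels:
  assumes "n < 2 ^ L" "f \<le> n"
  shows "fits (label_bits L \<theta> R m) (labels n f L \<theta> R m)"
proof -
  have "fits 1 (UNIV :: bool set)" by (simp add: fits_def)
  have p: "fits (1 + (2 * L + 1)) ((UNIV :: bit set) \<times> insert None (Some ` grid n))"
    by (intro fits_Times fits_bit fits_option fits_grid assms)
  have q: "fits (1 + (1 + (2 * L + 1)) * R) ((UNIV :: bool set) \<times> {ds. set ds \<subseteq> (UNIV :: bit set) \<times> insert None (Some ` grid n) \<and> length ds = R})"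
    by (rule fits_Times[OF \<open>fits 1 (UNIV :: bool set)\<close> fits_lists_eq[OF p]])
  have e: "fits (entry_bits L \<theta> R m) (entries n \<theta> R m)"
    unfolding entries_def entry_bits_def
    by (rule fits_Times[OF _ fits_Times[OF _ fits_Times[OF fits_lists_le[OF fits_grid[OF assms(1)]] fits_lists_eq[OF q]]]])
      (use assms in \<open>auto simp: fits_def\<close>)
  have "fits (1 + 1) (UNIV :: (bit \<times> bit) set)" using fits_Times[OF fits_bit fits_bit] by simp
  then have "fits (2 * R * m) {ps. set ps \<subseteq> {ds. set ds \<subseteq> (UNIV :: (bit \<times> bit) set) \<and> length ds = R} \<and> length ps = m}"
    using fits_lists_eq[OF fits_lists_eq[of 2 "UNIV :: (bit \<times> bit) set" R], of m] by (simp add: numeral_2_eq_2)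
  moreover have "fits (L + 1) {..<2 * f}" using assms by (simp add: fits_def)
  ultimately show ?thesis
    unfolding labels_def label_bits_def by (intro fits_Times fits_lists_le fits_grid e assms(1))
qed

context labelled begin

lemma the_label_in:
  assumes v: "v \<in> V" and colour: "\<And>v. colour v < 2 * f" and \<omega>: "\<omega> \<in> seeds n f R m"
  shows "the_label \<omega> v \<in> labels n f L \<theta> R m"
proof -
  have len: "length \<omega> = m" and "set \<omega> \<subseteq> copies n f R" using \<omega> by (auto simp: seeds_def)
  then have zs: "length (snd p) = R" if "p \<in> set \<omega>" for p using that by (force simp: copies_def)
  have grid: "V \<subseteq> grid n" using V_bound by (simp add: grid_def)
  have entry: "the_entry \<omega> c \<in> entries n \<theta> R m" if c: "c \<in> H" for c
  proof -
    have "path_length c \<le> card {..<n}"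
      unfolding path_length_def using V_bound by (intro card_mono) auto
    moreover have "set (nb_list c) \<subseteq> grid n" using nb_list(3)[of c] nb_V grid by blast
    moreover have "scheme.rep V E Cl S Z c = None" if "scheme.rep V E Cl S Z c \<notin> Some ` grid n" for S Z
    proof -
      interpret scheme n L V E Cl S by unfold_locales
      show ?thesis
      proof (cases "rep Z c")
        case (Some x)
        then have "x \<in> grid n" using rep_SomeD[OF Some] nb_V grid by blast
        then show ?thesis using Some that by simp
      qed simp
    qed
    moreover have "c < n" using c H_bound by auto
    ultimately show ?thesis
      using nb_list(2)[of c] len zs
      by (auto simp: entries_def the_entry_def case_prod_beta)
  qed
  have "card {c \<in> H. v \<in> Cl c} \<le> L" using Cl_depth[OF v] by (simp add: H_def)
  then have "length (map (the_entry \<omega>) (clusters_at v)) \<le> L" by (simp add: clusters_at)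
  moreover have "set (map (the_entry \<omega>) (clusters_at v)) \<subseteq> entries n \<theta> R m" using entry by (auto simp: clusters_at)
  ultimately show ?thesis
    using v grid colour[of v] len zs by (auto simp: labels_def the_label_def case_prod_beta)
qed

end

section \<open>The scheme for graphs on an initial segment of the naturals\<close>

lemma scheme_exists:
  assumes n: "n < 2 ^ L" and f: "f \<ge> 1" "f \<le> n" and E: "E \<subseteq> {..<n} \<times> {..<n}" "sym E"
    and W: "2 * potential (real (Suc f)) ((f + 2) * L + f) \<le> exp (real W)" and R: "R \<ge> 12 * (Suc f)\<^sup>2 * W"
  shows "\<exists>lab. (\<forall>\<omega>\<in>seeds n f R m. \<forall>v<n. lab \<omega> v \<in> labels n f L (2 * f * (2 * L + 1)) R m) \<and>
    (\<forall>s<n. \<forall>t<n. \<forall>F. F \<subseteq> {..<n} \<and> card F \<le> f \<longrightarrow>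
      real (card {\<omega> \<in> seeds n f R m. \<not> (decode n \<omega> (lab \<omega> s) (lab \<omega> t) (lab \<omega> ` F) \<longleftrightarrow>
        s \<notin> F \<and> t \<notin> F \<and> conn E ({..<n} - F) s t)}) \<le> (3 / 4) ^ m * card (seeds n f R m))"
proof -
  obtain apex pos K where dec: "path_decomposition E {..<n} L apex pos K"
    using path_decomposition_nat[OF n E(2)] by blast
  define h where "h v = (apex v, pos v)" for v :: nat
  define V where "V = h ` {..<n}"
  define E' where "E' = map_prod h h ` E"
  define Cl where "Cl c = h ` K c" for c
  note cg = cluster_graph_of_decomposition[OF dec E(2,1), folded h_def]
  have inj: "inj_on h {..<n}" using cg(1) by (simp add: h_def[abs_def])
  interpret cluster_graph n L V E' Cl
    using cg(2) unfolding V_def E'_def Cl_def[abs_def] h_def[abs_def] .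
  have cH: "card H \<le> n" using card_mono[OF _ H_bound] by simp
  \<comment> \<open>At most n clusters and 2f colours give fewer than 2^(2L+1) pairs, the count that
    the hitting colouring has to beat.\<close>
  have nf: "n * (2 * f) < 2 ^ (2 * L + 1)"
  proof -
    have "n * n < 2 ^ L * 2 ^ L" using n by (intro mult_strict_mono') auto
    moreover have "n * f \<le> n * n" using f by simp
    moreover have "n * (2 * f) = 2 * (n * f)" "(2::nat) ^ (2 * L + 1) = 2 * (2 ^ L * 2 ^ L)"
      by (simp_all add: power_add mult_2 distrib_left)
    ultimately show ?thesis by linarith
  qed
  have "\<exists>colour. (\<forall>v. colour v < 2 * f) \<and>
    (\<forall>c\<in>H. card (nb c) > 2 * f * (2 * L + 1) \<longrightarrow> (\<forall>a<2 * f. \<exists>x\<in>nb c. colour x = a))"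
    by (rule hitting_colouring[OF finite_V finite_H cH nf f(1)]) (rule subsetI, erule nb_V)
  then obtain colour where colour: "\<And>v. colour v < 2 * f"
    "\<And>c a. c \<in> H \<Longrightarrow> card (nb c) > 2 * f * (2 * L + 1) \<Longrightarrow> a < 2 * f \<Longrightarrow> \<exists>x\<in>nb c. colour x = a"
    by blast
  interpret labelled n L V E' Cl colour f "2 * f * (2 * L + 1)"
    by unfold_locales (rule colour(2))
  show ?thesis
  proof (intro exI[of _ "\<lambda>\<omega> v. the_label \<omega> (h v)"] conjI ballI allI impI)
    fix \<omega> v assume "\<omega> \<in> seeds n f R m" "v < n"
    then show "the_label \<omega> (h v) \<in> labels n f L (2 * f * (2 * L + 1)) R m"
      by (intro the_label_in colour) (auto simp: V_def)
  next
    fix s t F assume st: "s < n" "t < n" and F: "F \<subseteq> {..<n} \<and> card F \<le> f"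
    have hF: "h ` F \<subseteq> V" "card (h ` F) \<le> f" "h s \<in> V" "h t \<in> V"
      using F st card_image_le[of F h] finite_subset[of F "{..<n}"] by (auto simp: V_def)
    have mem: "h x \<in> h ` F \<longleftrightarrow> x \<in> F" if "x < n" for x
      using inj_on_image_mem_iff[OF inj, of x F] that F by simp
    have VF: "V - h ` F = h ` ({..<n} - F)"
      unfolding V_def using inj_on_image_set_diff[OF inj, of "{..<n}" F] F by auto
    have "s \<notin> F \<and> t \<notin> F \<and> conn E ({..<n} - F) s t \<longleftrightarrow> h s \<notin> h ` F \<and> h t \<notin> h ` F \<and> conn E' (V - h ` F) (h s) (h t)"
      unfolding mem[OF st(1)] mem[OF st(2)] VF E'_def
      using conn_image[OF inj E(1), of "{..<n} - F" s t] st by auto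
    moreover have "(\<lambda>v. the_label \<omega> (h v)) ` F = the_label \<omega> ` h ` F" for \<omega> by (simp add: image_image)
    ultimately show "real (card {\<omega> \<in> seeds n f R m. \<not> (decode n \<omega> (the_label \<omega> (h s)) (the_label \<omega> (h t))
        ((\<lambda>v. the_label \<omega> (h v)) ` F) \<longleftrightarrow> s \<notin> F \<and> t \<notin> F \<and> conn E ({..<n} - F) s t)}) \<le> (3 / 4) ^ m * card (seeds n f R m)"
      using card_bad_seeds[OF hF(1,2) f(1) hF(3,4) W R, of m] by simp
  qed
qed

text \<open>With p pieces and g = f+1, the exponents of 2 <= e, 2L+1 <= e^(2L), g <= e^L and (1 +
  1/g)^p <= e^(p/g) <= e^(2L+1) add up to 5L + 2.\<close>

lemma potential_bound:
  assumes f: "f < (2::nat) ^ L"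
  shows "2 * potential (real (Suc f)) ((f + 2) * L + f) \<le> exp (real (5 * L + 2))"
proof -
  define p where "p = (f + 2) * L + f"
  define g where "g = real (Suc f)"
  have g: "g \<ge> 1" by (simp add: g_def)
  have pg: "real p \<le> (2 * L + 1) * g"
  proof -
    have "p \<le> (2 * L + 1) * Suc f" by (simp add: p_def algebra_simps)
    then have "real p \<le> real ((2 * L + 1) * Suc f)" by (simp only: of_nat_le_iff)
    then show ?thesis by (simp add: g_def algebra_simps)
  qed
  have "(1 + 1 / g) ^ p \<le> exp (1 / g) ^ p"
    using exp_ge_add_one_self[of "1 / g"] g by (intro power_mono) auto
  also have "\<dots> = exp (real p / g)" by (simp flip: exp_of_nat_mult)
  also have "\<dots> \<le> exp (2 * L + 1)" using pg g by (simp add: divide_le_eq)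
  finally have 1: "(1 + 1 / g) ^ p \<le> exp (2 * L + 1)" .
  have two: "(2::real) ^ L \<le> exp (real L)"
  proof -
    have "(2::real) ^ L \<le> exp 1 ^ L" using exp_ge_add_one_self[of 1] by (intro power_mono) auto
    then show ?thesis by (simp flip: exp_of_nat_mult)
  qed
  have "g \<le> 2 ^ L"
  proof -
    have "real (Suc f) \<le> real (2 ^ L)" using f by (simp only: of_nat_le_iff Suc_le_eq)
    then show ?thesis by (simp add: g_def)
  qed
  then have 2: "g \<le> exp (real L)" using two by simp
  have 3: "real (2 * L + 1) \<le> exp (2 * L)" using exp_ge_add_one_self[of "2 * real L"] by simp
  have 4: "(2::real) \<le> exp 1" using exp_ge_add_one_self[of 1] by simp
  have "2 * potential g p \<le> 2 * ((2 * L + 1) * g * exp (2 * L + 1))"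
    unfolding potential_def using pg 1 g by (intro mult_left_mono mult_mono) auto
  also have "\<dots> \<le> exp 1 * (exp (2 * L) * exp (real L) * exp (2 * L + 1))"
    using 2 3 4 g by (intro mult_mono) auto
  also have "\<dots> = exp (real (5 * L + 2))" by (simp flip: exp_add)
  finally show ?thesis unfolding p_def g_def .
qed

text \<open>Since (3/4)^4 <= 1/2, four copies gain a factor two; the summand 2 supplies the factor 4
  in the denominator.\<close>

lemma three_quarters_power:
  assumes "n < (2::nat) ^ L" "n > 0"
  shows "(3 / 4) ^ (4 * (L * c + 2)) \<le> 1 / (4 * real n ^ c)"
proof -
  have "(3 / 4 :: real) ^ (4 * (L * c + 2)) = ((3 / 4) ^ 4) ^ (L * c + 2)" by (rule power_mult)
  also have "\<dots> \<le> (1 / 2) ^ (L * c + 2)" by (intro power_mono) (simp_all add: power4_eq_xxxx)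
  also have "\<dots> = 1 / (4 * (2 ^ L) ^ c)" by (simp add: power_add power_mult power_one_over)
  also have "\<dots> \<le> 1 / (4 * real n ^ c)"
  proof -
    have "real n \<le> real (2 ^ L)" using assms(1) by (simp only: of_nat_le_iff)
    then have "real n ^ c \<le> (2 ^ L) ^ c" by (intro power_mono) auto
    then show ?thesis using assms(2) by (intro divide_left_mono) auto
  qed
  finally show ?thesis .
qed

definition num_instances :: "nat \<Rightarrow> nat \<Rightarrow> nat" where
  "num_instances L f = 12 * (Suc f)\<^sup>2 * (5 * L + 2)"

definition num_copies :: "nat \<Rightarrow> nat \<Rightarrow> nat" where
  "num_copies c L = 4 * (L * c + 2)"

definition label_set :: "nat \<Rightarrow> nat \<Rightarrow> nat \<Rightarrow> nat \<Rightarrow> label set" where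
  "label_set c L n f = labels n f L (2 * f * (2 * L + 1)) (num_instances L f) (num_copies c L)"

definition edge_sets :: "nat \<Rightarrow> (nat \<times> nat) set set" where
  "edge_sets n = {E. E \<subseteq> {..<n} \<times> {..<n} \<and> sym E}"

text \<open>The order of the quantifiers matters: the table g of seeds is chosen before the graph,
  so a fixed decoder can contain it. Every graph and every query count as one item in
  \<open>few_seeds_bound\<close>.\<close>

lemma seeded_scheme:
  assumes n: "n < 2 ^ L" "n \<ge> 2" and f: "f \<ge> 1" "f \<le> n"
  shows "\<exists>g lab. (\<forall>l E v. E \<in> edge_sets n \<longrightarrow> l < 2 * n ^ (4 + c) \<longrightarrow> v < n \<longrightarrow> lab E (g l) v \<in> label_set c L n f) \<and>
    (\<forall>E s t F. E \<in> edge_sets n \<longrightarrow> s < n \<longrightarrow> t < n \<longrightarrow> F \<subseteq> {..<n} \<longrightarrow> card F \<le> f \<longrightarrow>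
      real (card {l. l < 2 * n ^ (4 + c) \<and> \<not> (decode n (g l) (lab E (g l) s) (lab E (g l) t) (lab E (g l) ` F) \<longleftrightarrow>
        s \<notin> F \<and> t \<notin> F \<and> conn E ({..<n} - F) s t)}) \<le> real (2 * n ^ (4 + c)) / real n ^ c)"
proof -
  define R where "R = num_instances L f"
  define m where "m = num_copies c L"
  define M where "M = 2 * n ^ (4 + c)"
  define ok where "ok lb E s t F \<omega> \<longleftrightarrow> (decode n \<omega> (lb \<omega> s) (lb \<omega> t) (lb \<omega> ` F) \<longleftrightarrow>
        s \<notin> F \<and> t \<notin> F \<and> conn E ({..<n} - F) s t)" for lb :: "seed \<Rightarrow> nat \<Rightarrow> label" and E s t F \<omega>
  have fL: "f < 2 ^ L" using f n by simp
  define good where "good E lb \<longleftrightarrow> (\<forall>\<omega>\<in>seeds n f R m. \<forall>v<n. lb \<omega> v \<in> label_set c L n f) \<and>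
    (\<forall>s<n. \<forall>t<n. \<forall>F. F \<subseteq> {..<n} \<and> card F \<le> f \<longrightarrow>
      real (card {\<omega> \<in> seeds n f R m. \<not> ok lb E s t F \<omega>}) \<le> (3 / 4) ^ m * card (seeds n f R m))"
    for E and lb :: "seed \<Rightarrow> nat \<Rightarrow> label"
  have "\<forall>E\<in>edge_sets n. \<exists>lb. good E lb"
  proof
    fix E assume "E \<in> edge_sets n"
    then have E: "E \<subseteq> {..<n} \<times> {..<n}" "sym E" by (simp_all add: edge_sets_def)
    have "12 * (Suc f)\<^sup>2 * (5 * L + 2) \<le> R" by (simp add: R_def num_instances_def)
    from scheme_exists[OF n(1) f E potential_bound[OF fL] this, of m]
    show "\<exists>lb. good E lb"
      unfolding good_def label_set_def R_def[symmetric] m_def[symmetric] ok_def .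
  qed
  from bchoice[OF this] obtain lab where "\<forall>E\<in>edge_sets n. good E (lab E)" ..
  then have lab: "\<And>E \<omega> v. E \<in> edge_sets n \<Longrightarrow> \<omega> \<in> seeds n f R m \<Longrightarrow> v < n \<Longrightarrow> lab E \<omega> v \<in> label_set c L n f"
    "\<And>E s t F. E \<in> edge_sets n \<Longrightarrow> s < n \<Longrightarrow> t < n \<Longrightarrow> F \<subseteq> {..<n} \<Longrightarrow> card F \<le> f \<Longrightarrow>
      real (card {\<omega> \<in> seeds n f R m. \<not> ok (lab E) E s t F \<omega>}) \<le> (3 / 4) ^ m * card (seeds n f R m)"
    unfolding good_def by simp_all
  define I where "I = edge_sets n \<times> {..<n} \<times> {..<n} \<times> {F. F \<subseteq> {..<n} \<and> card F \<le> f}"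
  define bad where "bad i \<omega> \<longleftrightarrow> (case i of (E, s, t, F) \<Rightarrow> \<not> ok (lab E) E s t F \<omega>)" for i \<omega>
  have Isub: "I \<subseteq> Pow ({..<n} \<times> {..<n}) \<times> {..<n} \<times> {..<n} \<times> Pow {..<n}"
    by (auto simp: I_def edge_sets_def)
  have finU: "finite (Pow ({..<n} \<times> {..<n}) \<times> {..<n} \<times> {..<n} \<times> Pow {..<n})" by simp
  have finI: "finite I" by (rule finite_subset[OF Isub finU])
  \<comment> \<open>An item consists of an edge set, two vertices and a failure set: at most n^2 +
    3n bits, hence at most n^4.\<close>
  have "card I \<le> card (Pow ({..<n} \<times> {..<n}) \<times> {..<n} \<times> {..<n} \<times> Pow {..<n})"
    by (rule card_mono[OF finU Isub])
  also have "\<dots> = 2 ^ (n * n) * (n * (n * 2 ^ n))" by (simp add: card_cartesian_product card_Pow)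
  also have "\<dots> \<le> 2 ^ (n * n) * (2 ^ n * (2 ^ n * 2 ^ n))"
    using less_exp[of n] by (intro mult_mono) auto
  also have "\<dots> = 2 ^ (n * n + 3 * n)" by (simp flip: power_add)
  also have "\<dots> \<le> 2 ^ (n ^ 4)"
  proof (rule power_increasing)
    have "3 * n \<le> 3 * (n * n)" using n(2) by simp
    moreover have "4 * (n * n) \<le> (n * n) * (n * n)" using n(2) mult_mono[of 2 n 2 n] by (intro mult_right_mono) auto
    moreover have "n ^ 4 = (n * n) * (n * n)" by (simp add: power4_eq_xxxx)
    ultimately show "n * n + 3 * n \<le> n ^ 4" by linarith
  qed simp
  finally have cI: "card I \<le> 2 ^ (n ^ 4)" .
  have bad: "real (card {\<omega> \<in> seeds n f R m. bad i \<omega>}) \<le> (3 / 4) ^ m * card (seeds n f R m)" if "i \<in> I" for i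
    using that lab(2) by (auto simp: I_def bad_def)
  have "\<exists>g. (\<forall>l<M. g l \<in> seeds n f R m) \<and> (\<forall>i\<in>I. real (card {l. l < M \<and> bad i (g l)}) \<le> real (n ^ 4) + 2 * (3 / 4) ^ m * M)"
    by (rule few_seeds_bound[OF finite_seeds seeds_nonempty[OF f(1)] finI cI _ bad]) simp_all
  then obtain g where "(\<forall>l<M. g l \<in> seeds n f R m) \<and>
    (\<forall>i\<in>I. real (card {l. l < M \<and> bad i (g l)}) \<le> real (n ^ 4) + 2 * (3 / 4) ^ m * M)" ..
  then have g: "\<And>l. l < M \<Longrightarrow> g l \<in> seeds n f R m"
    "\<And>i. i \<in> I \<Longrightarrow> real (card {l. l < M \<and> bad i (g l)}) \<le> real (n ^ 4) + 2 * (3 / 4) ^ m * M"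
    by blast+
  \<comment> \<open>With M = 2 n^(4+c) the term n^4 is exactly M / (2 n^c), and the copies are
    numerous enough for the second term to stay within the other half.\<close>
  have "real (n ^ 4) + 2 * (3 / 4) ^ m * M \<le> M / real n ^ c"
  proof -
    have n0: "real n ^ c > 0" using n by simp
    have "(3 / 4 :: real) ^ m \<le> 1 / (4 * real n ^ c)"
      unfolding m_def num_copies_def using three_quarters_power[OF n(1)] n(2) by simp
    then have "2 * (3 / 4) ^ m * M \<le> 2 * (1 / (4 * real n ^ c)) * M" by (intro mult_right_mono mult_left_mono) auto
    moreover have "real (n ^ 4) = 2 * (1 / (4 * real n ^ c)) * M" using n0 by (simp add: M_def power_add)
    moreover have "2 * (1 / (4 * real n ^ c)) * M + 2 * (1 / (4 * real n ^ c)) * M = M / real n ^ c"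
      using n0 by (simp add: field_simps)
    ultimately show ?thesis by linarith
  qed
  note bound = order_trans[OF g(2) this]
  show ?thesis
  proof (intro exI[of _ g] exI[of _ lab] conjI allI impI)
    fix l E v assume "E \<in> edge_sets n" "l < 2 * n ^ (4 + c)" "v < n"
    then show "lab E (g l) v \<in> label_set c L n f" using lab(1) g(1) by (simp add: M_def)
  next
    fix E s t F assume "E \<in> edge_sets n" "s < n" "t < n" "F \<subseteq> {..<n}" "card F \<le> f"
    then have "(E, s, t, F) \<in> I" by (simp add: I_def)
    from bound[OF this] show "real (card {l. l < 2 * n ^ (4 + c) \<and> \<not> (decode n (g l) (lab E (g l) s) (lab E (g l) t) (lab E (g l) ` F) \<longleftrightarrow>
        s \<notin> F \<and> t \<notin> F \<and> conn E ({..<n} - F) s t)}) \<le> real (2 * n ^ (4 + c)) / real n ^ c"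
      unfolding bad_def ok_def M_def by simp
  qed
qed

section \<open>Bit strings for labels and their length\<close>

definition bit_length :: "nat \<Rightarrow> nat" where
  "bit_length n = (LEAST L. n < 2 ^ L)"

lemma less_bit_length: "n < 2 ^ bit_length n"
  unfolding bit_length_def using less_exp[of n] by (rule LeastI)

lemma bit_length_le_log:
  assumes "n \<ge> 2"
  shows "real (bit_length n) \<le> 2 * log 2 n" "bit_length n \<ge> 1" "log 2 n \<ge> 1"
proof -
  show log: "log 2 n \<ge> 1" using assms by simp
  show pos: "bit_length n \<ge> 1" using less_bit_length[of n] assms by (cases "bit_length n") auto
  have "\<not> n < 2 ^ (bit_length n - 1)"
    unfolding bit_length_def by (rule not_less_Least) (use pos in \<open>simp add: bit_length_def\<close>)
  then have "2 ^ (bit_length n - 1) \<le> real n" by (metis not_less of_nat_le_iff of_nat_numeral of_nat_power)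
  then have "real (bit_length n - 1) \<le> log 2 n" using assms by (simp add: le_log_of_power)
  then show "real (bit_length n) \<le> 2 * log 2 n" using log pos by simp
qed

definition payload_bits :: "nat \<Rightarrow> nat \<Rightarrow> nat \<Rightarrow> nat" where
  "payload_bits c L f = (1 + L * (4 + c)) + label_bits L (2 * f * (2 * L + 1)) (num_instances L f) (num_copies c L)"

definition payloads :: "nat \<Rightarrow> nat \<Rightarrow> nat \<Rightarrow> (nat \<times> label) set" where
  "payloads c n f = {..<2 * n ^ (4 + c)} \<times> label_set c (bit_length n) n f"

lemma fits_payloads:
  assumes "f \<le> n"
  shows "fits (payload_bits c (bit_length n) f) (payloads c n f)"
proof -
  let ?L = "bit_length n"
  have "2 * n ^ (4 + c) \<le> 2 * (2 ^ ?L) ^ (4 + c)"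
    using less_bit_length[of n] by (intro mult_left_mono power_mono) auto
  also have "\<dots> = 2 ^ (1 + ?L * (4 + c))" by (simp add: power_mult power_add)
  finally have "fits (1 + ?L * (4 + c)) {..<2 * n ^ (4 + c)}" by (simp add: fits_def)
  then show ?thesis
    unfolding payload_bits_def payloads_def label_set_def
    by (rule fits_Times) (rule fits_labels[OF less_bit_length assms])
qed

text \<open>Choosing one injection per pair of arguments lets labelling and decoder share
  it.\<close>

definition code :: "nat \<Rightarrow> 'x set \<Rightarrow> 'x \<Rightarrow> bool list" where
  "code b X = (SOME e. inj_on e X \<and> (\<forall>x\<in>X. length (e x) = b))"

lemma code:
  assumes "fits b X" shows "inj_on (code b X) X" "x \<in> X \<Longrightarrow> length (code b X x) = b"
  using someI_ex[OF fits_code[OF assms]] by (auto simp: code_def)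

text \<open>A self-delimiting format: the unary prefix fixes the length of the header, and the
  header gives n and f, which select the payload code and the table of seeds. Labels alone thus tell
  the decoder which scheme they belong to.\<close>

definition to_string :: "nat \<Rightarrow> nat \<Rightarrow> nat \<Rightarrow> nat \<times> label \<Rightarrow> bool list" where
  "to_string c n f x = replicate (bit_length n) True @ False #
     code (2 * bit_length n) ({..<2 ^ bit_length n} \<times> {..<2 ^ bit_length n}) (n, f) @
     code (payload_bits c (bit_length n) f) (payloads c n f) x"

lemma fits_header: "fits (2 * L) ({..<2 ^ L :: nat} \<times> {..<2 ^ L :: nat})"
  unfolding mult_2 by (rule fits_Times) (simp_all add: fits_def)

lemma length_to_string:
  assumes "f \<le> n" "x \<in> payloads c n f"
  shows "length (to_string c n f x) = 3 * bit_length n + 1 + payload_bits c (bit_length n) f"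
  using code(2)[OF fits_header, of "(n, f)" "bit_length n"] code(2)[OF fits_payloads[OF assms(1)] assms(2)]
    less_bit_length[of n] assms(1)
  by (simp add: to_string_def)

lemma replicate_True_inj:
  "replicate a True @ False # xs = replicate b True @ False # ys \<Longrightarrow> a = b \<and> xs = ys"
proof (induction a arbitrary: b)
  case 0 then show ?case by (cases b) auto
next
  case (Suc a) then show ?case by (cases b) auto
qed

lemma to_string_inj:
  assumes "f \<le> n" "f' \<le> n'" "x \<in> payloads c n f" "y \<in> payloads c n' f'"
    and eq: "to_string c n f x = to_string c n' f' y"
  shows "n = n' \<and> f = f' \<and> x = y"
proof -
  let ?L = "bit_length n" and ?h = "\<lambda>L. code (2 * L) ({..<2 ^ L :: nat} \<times> {..<2 ^ L})"
  have L: "?L = bit_length n'" and rest: "?h ?L (n, f) @ code (payload_bits c ?L f) (payloads c n f) x =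
      ?h (bit_length n') (n', f') @ code (payload_bits c (bit_length n') f') (payloads c n' f') y"
    using replicate_True_inj[OF eq[unfolded to_string_def]] by auto
  have in1: "(n, f) \<in> {..<2 ^ ?L} \<times> {..<2 ^ ?L}" using less_bit_length[of n] assms by simp
  have in2: "(n', f') \<in> {..<2 ^ ?L} \<times> {..<2 ^ ?L}" unfolding L using less_bit_length[of n'] assms by simp
  have len: "length (?h ?L (n, f)) = length (?h ?L (n', f'))"
    using code(2)[OF fits_header in1] code(2)[OF fits_header in2] by simp
  have h: "?h ?L (n, f) = ?h ?L (n', f')"
    and r: "code (payload_bits c ?L f) (payloads c n f) x = code (payload_bits c ?L f') (payloads c n' f') y"
    using rest len unfolding L[symmetric] by auto
  have "(n, f) = (n', f')" by (rule inj_onD[OF code(1)[OF fits_header] h in1 in2])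
  then have nf: "n = n'" "f = f'" by auto
  have "x = y" by (rule inj_onD[OF code(1)[OF fits_payloads[OF assms(1)]]]) (use r assms nf in auto)
  then show ?thesis using nf by simp
qed

text \<open>The dominant contribution comes from L entries, each with O(L) copies of O(f^2 L)
  instances of O(L) bits. All terms are compared with \<open>d * P k\<close>, where
  \<open>P k\<close> is f^2 L^k and d absorbs the dependence on c.\<close>

lemma payload_bits_bound:
  assumes "f \<ge> 1" "L \<ge> 1"
  shows "3 * L + 1 + payload_bits c L f \<le> 8192 * (c + 2) * (f\<^sup>2 * L ^ 4)"
proof -
  define d where "d = 4 * (c + 2)"
  define P where "P k = f\<^sup>2 * L ^ k" for k
  have f2: "f\<^sup>2 \<ge> 1" "f \<le> f\<^sup>2" using assms by (simp_all add: power2_eq_square)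
  have Pmono: "P i \<le> P j" if "i \<le> j" for i j
    unfolding P_def using that assms(2) by (intro mult_left_mono power_increasing) auto
  have PL: "P k * L = P (Suc k)" "L * P k = P (Suc k)" for k by (simp_all add: P_def)
  have LP: "L ^ k \<le> P k" for k using f2 by (simp add: P_def)
  have d1: "d \<ge> 1" by (simp add: d_def)
  define R where "R = num_instances L f"
  define m where "m = num_copies c L"
  define \<theta> where "\<theta> = 2 * f * (2 * L + 1)"
  have "(Suc f)\<^sup>2 \<le> (2 * f)\<^sup>2" using assms by (intro power_mono) auto
  then have "R \<le> 12 * (4 * f\<^sup>2) * (7 * L)"
    unfolding R_def num_instances_def using assms by (intro mult_mono) (auto simp: power_mult_distrib)
  then have R: "R \<le> 336 * P 1" by (simp add: P_def)
  have "\<theta> \<le> 2 * f\<^sup>2 * (3 * L)" unfolding \<theta>_def using f2 assms by (intro mult_mono) auto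
  then have \<theta>: "\<theta> \<le> 6 * P 1" by (simp add: P_def)
  have m: "m \<le> d * L" using assms by (simp add: m_def num_copies_def d_def algebra_simps)
  have inner: "1 + (1 + (2 * L + 1)) * R \<le> 1345 * P 2"
  proof -
    have "(1 + (2 * L + 1)) * R \<le> (4 * L) * (336 * P 1)" using R assms by (intro mult_mono) auto
    also have "\<dots> = 1344 * P 2" using PL(2)[of 1] by (simp add: numeral_2_eq_2)
    finally show ?thesis using LP[of 2] one_le_power[OF assms(2), of 2] by linarith
  qed
  have entry: "entry_bits L \<theta> R m \<le> 1365 * d * P 3"
  proof -
    have "(2 * L + 1) * \<theta> \<le> (3 * L) * (6 * P 1)" using \<theta> assms by (intro mult_mono) auto
    also have "\<dots> = 18 * P 2" using PL(2)[of 1] by (simp add: numeral_2_eq_2)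
    also have "\<dots> \<le> 18 * (d * P 3)" using Pmono[of 2 3] d1 mult_mono[of 1 d "P 2" "P 3"] by simp
    finally have a: "(2 * L + 1) * \<theta> \<le> 18 * (d * P 3)" .
    have "(1 + (1 + (2 * L + 1)) * R) * m \<le> (1345 * P 2) * (d * L)" using inner m by (intro mult_mono) auto
    also have "\<dots> = 1345 * (d * P 3)" using PL(1)[of 2] by (simp add: numeral_3_eq_3 mult_ac)
    finally have b: "(1 + (1 + (2 * L + 1)) * R) * m \<le> 1345 * (d * P 3)" .
    have "L \<le> d * P 3" using LP[of 1] Pmono[of 1 3] d1 mult_mono[of 1 d "P 1" "P 3"] by simp
    then show ?thesis using a b unfolding entry_bits_def by linarith
  qed
  have label: "label_bits L \<theta> R m \<le> 2042 * (d * P 4)"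
  proof -
    have "(entry_bits L \<theta> R m + 1) * L \<le> (1366 * (d * P 3)) * L"
    proof (rule mult_right_mono)
      have "1 \<le> d * P 3" using LP[of 3] one_le_power[OF assms(2), of 3] d1 mult_mono[of 1 d 1 "P 3"] by simp
      then show "entry_bits L \<theta> R m + 1 \<le> 1366 * (d * P 3)" using entry by linarith
    qed simp
    also have "\<dots> = 1366 * (d * P 4)" using PL(1)[of 3] by (simp add: mult.assoc)
    finally have a: "(entry_bits L \<theta> R m + 1) * L \<le> 1366 * (d * P 4)" .
    have "2 * R * m \<le> 2 * (336 * P 1) * (d * L)" using R m by (intro mult_mono) auto
    also have "\<dots> = 672 * (d * P 2)" using PL(1)[of 1] by (simp add: mult_ac numeral_2_eq_2)
    also have "\<dots> \<le> 672 * (d * P 4)" using Pmono[of 2 4] by (intro mult_left_mono) auto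
    finally have b: "2 * R * m \<le> 672 * (d * P 4)" .
    have "L \<le> d * P 4" using LP[of 1] Pmono[of 1 4] d1 mult_mono[of 1 d "P 1" "P 4"] by simp
    then show ?thesis using a b assms(2) unfolding label_bits_def by linarith
  qed
  have "L \<le> P 4" using LP[of 1] Pmono[of 1 4] by simp
  then have "L * (4 + c) \<le> d * P 4" using mult_mono[of L "P 4" "4 + c" d] by (simp add: d_def mult.commute)
  moreover have "P 4 \<le> d * P 4" using d1 by simp
  ultimately have "3 * L + 1 + payload_bits c L f \<le> 2048 * (d * P 4)"
    using label \<open>L \<le> P 4\<close> assms(2)
    unfolding payload_bits_def R_def[symmetric] m_def[symmetric] \<theta>_def[symmetric] by linarith
  then show ?thesis by (simp add: d_def P_def mult_ac)
qed

section \<open>From digraphs to the final scheme\<close>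

text \<open>Membership of the endpoints is stated separately because \<open>conn\<close> is
  reflexive even at vertices outside the set.\<close>

lemma connected_avoiding_conn:
  assumes "graph G"
  shows "connected_avoiding G F s t \<longleftrightarrow>
    s \<in> verts G - F \<and> t \<in> verts G - F \<and> conn (arcs_ends G) (verts G - F) s t"
proof -
  let ?S = "verts G - F" and ?H = "induce_subgraph G (verts G - F)"
  have ends: "arcs_ends ?H = Restr (arcs_ends G) ?S"
    by (auto simp: arcs_ends_conv)
  have "(s, t) \<in> rtrancl_on ?S (Restr (arcs_ends G) ?S) \<longleftrightarrow> s \<in> ?S \<and> t \<in> ?S \<and> (s, t) \<in> (Restr (arcs_ends G) ?S)\<^sup>*"
  proof (intro iffI conjI)
    assume "(s, t) \<in> rtrancl_on ?S (Restr (arcs_ends G) ?S)"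
    then show "s \<in> ?S" "t \<in> ?S" "(s, t) \<in> (Restr (arcs_ends G) ?S)\<^sup>*"
      by - (erule in_rtrancl_on_in_F rtrancl_on_rtranclI)+
  next
    assume *: "s \<in> ?S \<and> t \<in> ?S \<and> (s, t) \<in> (Restr (arcs_ends G) ?S)\<^sup>*"
    then have "(s, t) \<in> (Restr (arcs_ends G) ?S)\<^sup>*" by blast
    then show "(s, t) \<in> rtrancl_on ?S (Restr (arcs_ends G) ?S)"
      by (induction rule: rtrancl_induct) (use * in \<open>auto intro: rtrancl_on_into_rtrancl_on\<close>)
  qed
  then show ?thesis
    unfolding connected_avoiding_def reachable_def ends conn_def by simp
qed

theorem mainTheorem4:
  fixes c :: nat
  shows "\<exists>(D :: bool list \<Rightarrow> bool list \<Rightarrow> bool list set \<Rightarrow> bool) (C :: real).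
    \<forall>(G :: ('a, 'b) pre_digraph) (f :: nat) (n :: nat).
      graph G \<and> card (verts G) = n \<and> f \<ge> 1 \<longrightarrow>
      (\<exists>(k :: nat) (LV :: ('a \<Rightarrow> bool list) pmf).
         real k \<le> C * real f ^ 2 * log 2 (real n) ^ 6 \<and>
         (\<forall>L\<in>set_pmf LV. \<forall>v\<in>verts G. length (L v) = k) \<and>
         (\<forall>s\<in>verts G. \<forall>t\<in>verts G. \<forall>F\<subseteq>verts G. card F \<le> f \<longrightarrow>
            measure_pmf.prob LV {L. answers_correctly D G L s t F} \<ge> 1 - 1 / real n ^ c))"
proof -
  define M where "M n = 2 * n ^ (4 + c)" for n :: nat
  define valid where "valid p \<longleftrightarrow> (case p of (n, f) \<Rightarrow> 2 \<le> n \<and> 1 \<le> f \<and> f \<le> (n::nat))" for p :: "nat \<times> nat"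
  define good where "good p g lab \<longleftrightarrow> (case p of (n, f) \<Rightarrow>
    (\<forall>l E v. E \<in> edge_sets n \<longrightarrow> l < M n \<longrightarrow> v < n \<longrightarrow> lab E (g l) v \<in> label_set c (bit_length n) n f) \<and>
    (\<forall>E s t F. E \<in> edge_sets n \<longrightarrow> s < n \<longrightarrow> t < n \<longrightarrow> F \<subseteq> {..<n} \<longrightarrow> card F \<le> f \<longrightarrow>
      real (card {l. l < M n \<and> \<not> (decode n (g l) (lab E (g l) s) (lab E (g l) t) (lab E (g l) ` F) \<longleftrightarrow>
        s \<notin> F \<and> t \<notin> F \<and> conn E ({..<n} - F) s t)}) \<le> real (M n) / real n ^ c))"
    for p and g :: "nat \<Rightarrow> seed" and lab :: "(nat \<times> nat) set \<Rightarrow> seed \<Rightarrow> nat \<Rightarrow> label"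
  have "\<forall>p. valid p \<longrightarrow> (\<exists>gl. good p (fst gl) (snd gl))"
  proof (intro allI impI)
    fix p assume p: "valid p"
    obtain n f where nf: "p = (n, f)" by (cases p)
    then have "n \<ge> 2" "f \<ge> 1" "f \<le> n" using p by (auto simp: valid_def)
    from seeded_scheme[OF less_bit_length this, of c] obtain g lab where "good p g lab"
      unfolding good_def nf M_def by auto
    then show "\<exists>gl. good p (fst gl) (snd gl)" by (intro exI[of _ "(g, lab)"]) simp
  qed
  \<comment> \<open>Seed tables for all admissible n and f are fixed before any graph is given, so
    that the decoder may refer to them.\<close>
  then obtain gl where gl: "\<And>p. valid p \<Longrightarrow> good p (fst (gl p)) (snd (gl p))" by metis
  define g where "g n f = fst (gl (n, f))" for n f
  define lab where "lab n f = snd (gl (n, f))" for n f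
  have lab_in: "lab n f E (g n f l) v \<in> label_set c (bit_length n) n f"
    if "2 \<le> n" "1 \<le> f" "f \<le> n" "E \<in> edge_sets n" "l < M n" "v < n" for n f E l v
    using gl[of "(n, f)"] that unfolding good_def valid_def g_def lab_def by simp
  have errors: "real (card {l. l < M n \<and> \<not> (decode n (g n f l) (lab n f E (g n f l) s) (lab n f E (g n f l) t)
        (lab n f E (g n f l) ` F) \<longleftrightarrow> s \<notin> F \<and> t \<notin> F \<and> conn E ({..<n} - F) s t)}) \<le> real (M n) / real n ^ c"
    if "2 \<le> n" "1 \<le> f" "f \<le> n" "E \<in> edge_sets n" "s < n" "t < n" "F \<subseteq> {..<n}" "card F \<le> f" for n f E s t F
    using gl[of "(n, f)"] that unfolding good_def valid_def g_def lab_def by simp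
  \<comment> \<open>The decoder accepts if some parse of the strings decodes positively;
    \<open>to_string_inj\<close> makes the parse unique.\<close>
  define D where "D ls lt LF \<longleftrightarrow> (\<exists>n f x y X. f \<le> n \<and> x \<in> payloads c n f \<and> y \<in> payloads c n f \<and> X \<subseteq> payloads c n f \<and>
     ls = to_string c n f x \<and> lt = to_string c n f y \<and> LF = to_string c n f ` X \<and>
     decode n (g n f (fst x)) (snd x) (snd y) (snd ` X))" for ls lt LF
  have D: "D (to_string c n f x) (to_string c n f y) (to_string c n f ` X) \<longleftrightarrow> decode n (g n f (fst x)) (snd x) (snd y) (snd ` X)"
    if v: "f \<le> n" "x \<in> payloads c n f" "y \<in> payloads c n f" "X \<subseteq> payloads c n f" for n f x y X
  proof
    assume "D (to_string c n f x) (to_string c n f y) (to_string c n f ` X)"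
    then obtain n' f' x' y' X' where *: "f' \<le> n'" "x' \<in> payloads c n' f'" "y' \<in> payloads c n' f'" "X' \<subseteq> payloads c n' f'"
      "to_string c n f x = to_string c n' f' x'" "to_string c n f y = to_string c n' f' y'"
      "to_string c n f ` X = to_string c n' f' ` X'" "decode n' (g n' f' (fst x')) (snd x') (snd y') (snd ` X')"
      unfolding D_def by blast
    have x: "n = n'" "f = f'" "x = x'" using to_string_inj[OF v(1) *(1) v(2) *(2) *(5)] by auto
    have y: "y = y'" using to_string_inj[OF v(1) *(1) v(3) *(3) *(6)] by auto
    have "inj_on (to_string c n f) (payloads c n f)"
      using to_string_inj[OF v(1) v(1)] by (intro inj_onI) blast
    then have "X = X'" using *(4,7) v(4) unfolding x[symmetric] by (simp add: inj_on_image_eq_iff)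
    then show "decode n (g n f (fst x)) (snd x) (snd y) (snd ` X)" using *(8) x y by simp
  qed (use v in \<open>unfold D_def, blast\<close>)
  \<comment> \<open>131072 = 8192 * 2^4, the power of two coming from the bound of the bit length by
    2 log n.\<close>
  define C where "C = 131072 * real (c + 2)"
  show ?thesis
  proof (intro exI[of _ D] exI[of _ C] allI impI)
    fix G :: "('a, 'b) pre_digraph" and f\<^sub>0 n :: nat
    assume "graph G \<and> card (verts G) = n \<and> f\<^sub>0 \<ge> 1"
    then have G: "graph G" and n: "card (verts G) = n" and f\<^sub>0: "f\<^sub>0 \<ge> 1" by auto
    interpret graph G by (rule G)
    have C0: "C \<ge> 0" by (simp add: C_def)
    show "\<exists>(k :: nat) (LV :: ('a \<Rightarrow> bool list) pmf).
         real k \<le> C * real f\<^sub>0 ^ 2 * log 2 (real n) ^ 6 \<and>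
         (\<forall>L\<in>set_pmf LV. \<forall>v\<in>verts G. length (L v) = k) \<and>
         (\<forall>s\<in>verts G. \<forall>t\<in>verts G. \<forall>F\<subseteq>verts G. card F \<le> f\<^sub>0 \<longrightarrow>
            measure_pmf.prob LV {L. answers_correctly D G L s t F} \<ge> 1 - 1 / real n ^ c)"
    proof (cases "n \<ge> 2")
      case False
      \<comment> \<open>A graph with one vertex has the trivial probability bound 0, and an empty
        graph has no query, so empty labels do.\<close>
      have "1 - 1 / real n ^ c \<le> 0" if "s \<in> verts G" for s
      proof -
        have "card (verts G) > 0" using that finite_verts by (auto simp: card_gt_0_iff)
        then have "n = 1" using False n by simp
        then show ?thesis by simp
      qed
      then have "\<forall>s\<in>verts G. \<forall>t\<in>verts G. \<forall>F\<subseteq>verts G. card F \<le> f\<^sub>0 \<longrightarrow>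
            measure_pmf.prob (return_pmf (\<lambda>_. [])) {L. answers_correctly D G L s t F} \<ge> 1 - 1 / real n ^ c"
        using measure_nonneg order_trans by blast
      moreover have "real 0 \<le> C * real f\<^sub>0 ^ 2 * log 2 (real n) ^ 6" using C0 by simp
      ultimately show ?thesis by (intro exI[of _ 0] exI[of _ "return_pmf (\<lambda>_. [])"]) simp
    next
      case n2: True
      \<comment> \<open>Failure sets never exceed n vertices, so capping the parameter loses no
        query and ensures the bound \<open>f \<le> n\<close> assumed by the encoding.\<close>
      define f where "f = min f\<^sub>0 n"
      have f: "1 \<le> f" "f \<le> n" "f \<le> f\<^sub>0" using f\<^sub>0 n2 by (auto simp: f_def)
      obtain num where num: "bij_betw num (verts G) {..<n}"
        using ex_bij_betw_finite_nat[OF finite_verts] unfolding n atLeast0LessThan by blast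
      have inj: "inj_on num (verts G)" and img: "num ` verts G = {..<n}" using num by (auto simp: bij_betw_def)
      have numn: "num v < n" if "v \<in> verts G" for v using img that by blast
      have aV: "arcs_ends G \<subseteq> verts G \<times> verts G" by (auto simp: arcs_ends_conv)
      define E where "E = map_prod num num ` arcs_ends G"
      have "sym (arcs_ends G)" using sym_arcs by (simp add: symmetric_def)
      then have "sym E" unfolding E_def sym_def by (auto intro: map_prod_imageI)
      moreover have "E \<subseteq> {..<n} \<times> {..<n}" unfolding E_def using aV img by fastforce
      ultimately have E: "E \<in> edge_sets n" by (simp add: edge_sets_def)
      define lb where "lb l v = to_string c n f (l, lab n f E (g n f l) (num v))" for l v
      define LV where "LV = map_pmf lb (pmf_of_set {..<M n})"
      have M0: "M n > 0" using n2 by (simp add: M_def)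
      then have M1: "{..<M n} \<noteq> {}" by blast
      have set_LV: "set_pmf LV = lb ` {..<M n}" unfolding LV_def using M1 by simp
      have pay: "(l, lab n f E (g n f l) (num v)) \<in> payloads c n f" if "l < M n" "v \<in> verts G" for l v
        using lab_in[OF n2 f(1,2) E that(1) numn[OF that(2)]] that(1) by (simp add: payloads_def M_def)
      define k where "k = 3 * bit_length n + 1 + payload_bits c (bit_length n) f"
      have len: "length (L v) = k" if "L \<in> set_pmf LV" "v \<in> verts G" for L v
        using that length_to_string[OF f(2) pay] by (auto simp: set_LV lb_def k_def)
      have size: "real k \<le> C * real f\<^sub>0 ^ 2 * log 2 (real n) ^ 6"
      proof -
        note bl = bit_length_le_log[OF n2]
        have "real k \<le> real (8192 * (c + 2) * (f\<^sup>2 * bit_length n ^ 4))"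
          unfolding k_def using payload_bits_bound[OF f(1) bl(2)] by (simp only: of_nat_le_iff)
        also have "\<dots> = 8192 * real (c + 2) * (real f ^ 2 * real (bit_length n) ^ 4)" by simp
        also have "\<dots> \<le> 8192 * real (c + 2) * (real f\<^sub>0 ^ 2 * (2 * log 2 n) ^ 4)"
          using f(3) bl by (intro mult_left_mono mult_mono power_mono) auto
        also have "\<dots> = C * real f\<^sub>0 ^ 2 * log 2 n ^ 4" by (simp add: C_def power_mult_distrib)
        \<comment> \<open>From log n >= 1 the fourth power is at most the sixth.\<close>
        also have "\<dots> \<le> C * real f\<^sub>0 ^ 2 * log 2 n ^ 6"
          using bl C0 by (intro mult_left_mono power_increasing) auto
        finally show ?thesis .
      qed
      have prob: "measure_pmf.prob LV {L. answers_correctly D G L s t F} \<ge> 1 - 1 / real n ^ c"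
        if st: "s \<in> verts G" "t \<in> verts G" and F: "F \<subseteq> verts G" "card F \<le> f\<^sub>0" for s t F
      proof -
        have finF: "finite F" by (rule finite_subset[OF F(1) finite_verts])
        have "card F \<le> n" using card_mono[OF finite_verts F(1)] n by simp
        then have cF: "card (num ` F) \<le> f" using F(2) card_image_le[OF finF, of num] by (simp add: f_def)
        have nF: "num ` F \<subseteq> {..<n}" using F img by blast
        have mem: "num x \<in> num ` F \<longleftrightarrow> x \<in> F" if "x \<in> verts G" for x
          by (rule inj_on_image_mem_iff[OF inj that F(1)])
        have VF: "{..<n} - num ` F = num ` (verts G - F)"
          using inj_on_image_set_diff[OF inj, of "verts G" F] F(1) img by auto
        have truth: "connected_avoiding G F s t \<longleftrightarrow> num s \<notin> num ` F \<and> num t \<notin> num ` F \<and> conn E ({..<n} - num ` F) (num s) (num t)"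
          unfolding connected_avoiding_conn[OF G] mem[OF st(1)] mem[OF st(2)] VF E_def
          using conn_image[OF inj aV, of "verts G - F" s t] st by auto
        define bad where "bad = {l. l < M n \<and> \<not> (decode n (g n f l) (lab n f E (g n f l) (num s)) (lab n f E (g n f l) (num t))
          (lab n f E (g n f l) ` num ` F) \<longleftrightarrow> num s \<notin> num ` F \<and> num t \<notin> num ` F \<and> conn E ({..<n} - num ` F) (num s) (num t))}"
        have cbad: "real (card bad) \<le> real (M n) / real n ^ c"
          unfolding bad_def by (rule errors[OF n2 f(1,2) E numn[OF st(1)] numn[OF st(2)] nF cF])
        have "l \<in> bad" if l: "l < M n" and wrong: "\<not> answers_correctly D G (lb l) s t F" for l
        proof -
          have "(\<lambda>v. (l, lab n f E (g n f l) (num v))) ` F \<subseteq> payloads c n f" using pay[OF l] F by blast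
          from D[OF f(2) pay[OF l st(1)] pay[OF l st(2)] this]
          have "D (lb l s) (lb l t) (lb l ` F) \<longleftrightarrow> decode n (g n f l) (lab n f E (g n f l) (num s)) (lab n f E (g n f l) (num t))
            (lab n f E (g n f l) ` num ` F)"
            by (simp add: lb_def image_image)
          then show ?thesis using wrong l truth unfolding bad_def answers_correctly_def by blast
        qed
        then have "{..<M n} - bad \<subseteq> {..<M n} \<inter> lb -` {L. answers_correctly D G L s t F}" by blast
        then have "card ({..<M n} - bad) \<le> card ({..<M n} \<inter> lb -` {L. answers_correctly D G L s t F})"
          by (intro card_mono) auto
        moreover have "card ({..<M n} - bad) = M n - card bad"
          by (subst card_Diff_subset) (auto simp: bad_def)
        ultimately have "real (M n) - real (card bad) \<le> real (card ({..<M n} \<inter> lb -` {L. answers_correctly D G L s t F}))"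
          by linarith
        then have "real (M n) * (1 - 1 / real n ^ c) \<le> real (card ({..<M n} \<inter> lb -` {L. answers_correctly D G L s t F}))"
          using cbad by (simp add: right_diff_distrib)
        then have "1 - 1 / real n ^ c \<le> real (card ({..<M n} \<inter> lb -` {L. answers_correctly D G L s t F})) / real (M n)"
          using M0 by (simp add: pos_le_divide_eq mult.commute)
        also have "\<dots> = measure_pmf.prob LV {L. answers_correctly D G L s t F}"
          unfolding LV_def using M1 by (simp add: measure_pmf_of_set)
        finally show ?thesis .
      qed
      show ?thesis
        by (intro exI[of _ k] exI[of _ LV] conjI ballI allI impI size len prob) auto
    qed
  qed
qed

end
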